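(* Let $k\ge 1$ and let $\mathcal W$ be a germ of $(k+2)$-web on $(\mathbb C^2,0)$ with smooth (but not necessarily reduced) and non-empty discriminant $\Delta(\mathcal W)$. Assume $\mathcal W=\mathcal W_2\boxtimes\mathcal W_k$, where $\mathcal W_2$ is a $2$-web satisfying $\Delta(\mathcal W_2)=\Delta(\mathcal W)$ and $\mathcal W_k$ is a $k$-web. Then the curvature $K(\mathcal W)$ is holomorphic along $\Delta(\mathcal W)$ if and only if $\Delta(\mathcal W)$ is invariant by either $\mathcal W_2$ or the barycenter $\beta_{\mathcal W_2}(\mathcal W_k)$.
   Context: **Webs.** A (germ of) $k$-web on a complex surface is given locally by a holomorphic $k$-symmetric $1$-form $\omega=\sum_{i+j=k}a_{ij}(x,y)dx^i dy^j$ with isolated zeros and with discriminant (of $\omega$ as a binary form in $dx,dy$) not identically zero; forms differing by a unit define the same web. $\Delta(\mathcal W)$ is the divisor of zeros of this discriminant. $\mathcal W\boxtimes\mathcal W'$ is the superposition of webs, defined by the product of the symmetric forms. A $1$-web is a foliation. The web is completely decomposable if it is a superposition of $k$ foliations. At a point $p$, $T_p\mathcal W$ denotes the set (union) of tangent lines of $\mathcal W$ at $p$. **Invariance.** A curve $C$ is invariant by $\mathcal W$ if $TC\subset T\mathcal W|_C$ over the regular part of $C$, i.e. $T_pC$ is one of the tangent lines of $\mathcal W$ at $p$. For a divisor, invariance means invariance of its support. **Barycenter.** Let $\mathcal F$ be a foliation transverse to a $k$-web $\mathcal W$ on an open set $U$. For $p\in U$ the tangent lines of $\mathcal W$ at $p$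 are $k$ points of the affine line $\mathbb P T_pU\setminus[T_p\mathcal F]$; their barycenter defines, as $p$ varies, a foliation $\beta_{\mathcal F}(\mathcal W)$. If in coordinates $\mathcal F$ and $\mathcal W$ have slopes $f$ and $w_1,\dots,w_k$, and $W(t)=\prod_i(t-w_i)$, then $\beta_{\mathcal F}(\mathcal W)$ has slope $f-kW(f)/W'(f)\in\mathbb C\cup\{\infty\}$ (and slope $f$ at points where $W(f)=0$). For an $\ell$-web $\mathcal W'$, written pointwise as $\mathcal F_1\boxtimes\cdots\boxtimes\mathcal F_\ell$, one sets $\beta_{\mathcal W'}(\mathcal W)=\beta_{\mathcal F_1}(\mathcal W)\boxtimes\cdots\boxtimes\beta_{\mathcal F_\ell}(\mathcal W)$. **Curvature.** For a completely decomposable $k$-web $\mathcal W=\mathcal F_1\boxtimes\cdots\boxtimes\mathcal F_k$ with $\mathcal F_i$ defined by a $1$-form $\omega_i$ with isolated singularities, put $\omega_i\wedge\omega_j=\delta_{ij}\,dx\wedge dy$. For $r<s<t$ let $\eta_{rst}$ be the unique meromorphic $1$-form with $d(\delta_{st}\omega_r)=\eta_{rst}\wedge\delta_{st}\omega_r$, $d(\delta_{tr}\omega_s)=\eta_{rst}\wedge\delta_{tr}\omega_s$, $d(\delta_{rs}\omega_t)=\eta_{rst}\wedge\delta_{rs}\omega_t$. The curvature is $K(\mathcal W)=d\sum_{r<s<t}\eta_{rst}$, a meromorphic $2$-form independent of choices, with poles contained in $\Delta(\mathcal W)$ and satisfying $K(\varphi^*\mathcal W)=\varphi^*K(\mathcal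 W)$ for dominant holomorphic maps $\varphi$. For an arbitrary web, one passes to a ramified Galois covering on which the web is completely decomposable; the curvature there is Galois invariant and descends to a meromorphic $2$-form $K(\mathcal W)$. "Holomorphic along a curve" means without poles along it. *)

theory Defs
  imports "HOL-Analysis.Analysis" "Subresultants.Resultant_Prelim"
    "HOL-Computational_Algebra.Fundamental_Theorem_Algebra"
begin

text \<open>Everything is local at the origin of \<open>\<complex>\<^sup>2\<close>: a germ is given by a representative, and only its
  values near \<open>0\<close> (\<open>\<forall>\<^sub>F p in nhds 0. \<dots>\<close>) are ever used.\<close>

type_synonym point = "complex \<times> complex"

section \<open>Holomorphic functions and 1-forms in two variables\<close>

definition holo2_at :: "(point \<Rightarrow> complex) \<Rightarrow> point \<Rightarrow> bool" where
  "holo2_at f p \<longleftrightarrow>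
     (\<forall>\<^sub>F q in nhds p. \<exists>a b. (f has_derivative (\<lambda>v. a * fst v + b * snd v)) (at q))"

definition partial_x :: "(point \<Rightarrow> complex) \<Rightarrow> point \<Rightarrow> complex" where
  "partial_x f p = deriv (\<lambda>z. f (z, snd p)) (fst p)"

definition partial_y :: "(point \<Rightarrow> complex) \<Rightarrow> point \<Rightarrow> complex" where
  "partial_y f p = deriv (\<lambda>z. f (fst p, z)) (snd p)"

definition wedge :: "complex \<times> complex \<Rightarrow> complex \<times> complex \<Rightarrow> complex" where
  "wedge a b = fst a * snd b - snd a * fst b"

definition cscale :: "complex \<Rightarrow> complex \<times> complex \<Rightarrow> complex \<times> complex" where
  "cscale c v = (c * fst v, c * snd v)"

definition cline :: "complex \<times> complex \<Rightarrow> (complex \<times> complex) set" where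
  "cline u = range (\<lambda>c. cscale c u)"

text \<open>The 1-form \<open>A dx + B dy\<close> is the function \<open>p \<mapsto> (A p, B p)\<close>, and a 2-form is identified with
  its coefficient with respect to \<open>dx \<and> dy\<close>.\<close>

type_synonym oneform = "point \<Rightarrow> complex \<times> complex"

definition holo_form_at :: "oneform \<Rightarrow> point \<Rightarrow> bool" where
  "holo_form_at \<alpha> p \<longleftrightarrow> holo2_at (\<lambda>q. fst (\<alpha> q)) p \<and> holo2_at (\<lambda>q. snd (\<alpha> q)) p"

definition ext_deriv :: "oneform \<Rightarrow> point \<Rightarrow> complex" where
  "ext_deriv \<alpha> p = partial_x (\<lambda>q. snd (\<alpha> q)) p - partial_y (\<lambda>q. fst (\<alpha> q)) p"

section \<open>Germs of webs\<close>

text \<open>A \<open>k\<close>-symmetric 1-form \<open>\<Sum>j\<le>k. a\<^sub>j(p) dx\<^bsup>k-j\<^esup> dy\<^sup>j\<close> is the function sending \<open>p\<close> to the polynomial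
  \<open>\<Sum>j\<le>k. a\<^sub>j(p) t\<^sup>j\<close> of formal degree \<open>k\<close>, so that \<open>t = dy/dx\<close> is the slope; a drop of the degree at
  \<open>p\<close> means that the vertical direction is tangent to the web at \<open>p\<close>.  The formal degree \<open>k\<close> is
  always passed separately, and the product of symmetric forms is the product of polynomials.\<close>

type_synonym symform = "point \<Rightarrow> complex poly"

definition form_eval :: "nat \<Rightarrow> complex poly \<Rightarrow> complex \<times> complex \<Rightarrow> complex" where
  "form_eval k P v = (\<Sum>j\<le>k. Polynomial.coeff P j * fst v ^ (k - j) * snd v ^ j)"

text \<open>For the binary form \<open>F\<close> of degree \<open>k\<close> that dehomogenizes to \<open>P\<close>, the partial derivatives
  \<open>F\<^sub>X\<close> and \<open>F\<^sub>Y\<close> dehomogenize to \<open>k P - t P'\<close> and \<open>P'\<close>, of formal degree \<open>k - 1\<close>.  Their resultant is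
  the discriminant of \<open>F\<close> up to the nonzero numerical factor \<open>\<plusminus>k\<^bsup>k-2\<^esup>\<close>, which does not affect
  the divisor of zeros.\<close>

definition form_disc :: "nat \<Rightarrow> complex poly \<Rightarrow> complex" where
  "form_disc k P =
     resultant_sub (k - 1) (k - 1) (Polynomial.smult (of_nat k) P - [:0, 1:] * pderiv P) (pderiv P)"

definition web_disc :: "nat \<Rightarrow> symform \<Rightarrow> point \<Rightarrow> complex" where
  "web_disc k \<omega> p = form_disc k (\<omega> p)"

definition web_germ :: "nat \<Rightarrow> symform \<Rightarrow> bool" where
  "web_germ k \<omega> \<longleftrightarrow>
     (\<forall>\<^sub>F p in nhds 0. Polynomial.degree (\<omega> p) \<le> k) \<and>
     (\<forall>j\<le>k. holo2_at (\<lambda>p. Polynomial.coeff (\<omega> p) j) 0) \<and>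
     (\<forall>\<^sub>F p in at 0. \<omega> p \<noteq> 0) \<and>
     \<not> (\<forall>\<^sub>F p in nhds 0. web_disc k \<omega> p = 0)"

definition same_web :: "symform \<Rightarrow> symform \<Rightarrow> bool" where
  "same_web \<omega> \<omega>' \<longleftrightarrow>
     (\<exists>u. holo2_at u 0 \<and> u 0 \<noteq> 0 \<and> (\<forall>\<^sub>F p in nhds 0. \<omega> p = Polynomial.smult (u p) (\<omega>' p)))"

definition superpose :: "symform \<Rightarrow> symform \<Rightarrow> symform" where
  "superpose \<omega> \<omega>' p = \<omega> p * \<omega>' p"

text \<open>A divisor is given by a local equation: two germs have the same divisor of zeros iff they
  differ by a unit.\<close>

definition same_divisor :: "(point \<Rightarrow> complex) \<Rightarrow> (point \<Rightarrow> complex) \<Rightarrow> bool" where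
  "same_divisor f g \<longleftrightarrow>
     (\<exists>u. holo2_at u 0 \<and> u 0 \<noteq> 0 \<and> (\<forall>\<^sub>F p in nhds 0. f p = u p * g p))"

definition disc_support :: "nat \<Rightarrow> symform \<Rightarrow> point set" where
  "disc_support k \<omega> = {p. web_disc k \<omega> p = 0}"

section \<open>Curves and invariance\<close>

definition smooth_equation :: "point set \<Rightarrow> point \<Rightarrow> (point \<Rightarrow> complex) \<Rightarrow> bool" where
  "smooth_equation S p h \<longleftrightarrow>
     holo2_at h p \<and> h p = 0 \<and> (partial_x h p, partial_y h p) \<noteq> 0 \<and>
     (\<forall>\<^sub>F q in nhds p. q \<in> S \<longleftrightarrow> h q = 0)"

definition regular_point :: "point set \<Rightarrow> point \<Rightarrow> bool" where
  "regular_point S p \<longleftrightarrow> (\<exists>h. smooth_equation S p h)"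

definition tangent_line :: "point set \<Rightarrow> point \<Rightarrow> (complex \<times> complex) set" where
  "tangent_line S p =
     {v. \<exists>h. smooth_equation S p h \<and> partial_x h p * fst v + partial_y h p * snd v = 0}"

text \<open>\<open>T p\<close> is the union of a finite set of lines in the tangent plane at \<open>p\<close>.\<close>

definition invariant_by :: "point set \<Rightarrow> (point \<Rightarrow> (complex \<times> complex) set) \<Rightarrow> bool" where
  "invariant_by S T \<longleftrightarrow>
     (\<forall>\<^sub>F p in nhds 0. regular_point S p \<longrightarrow> tangent_line S p \<subseteq> T p)"

text \<open>At an (isolated) zero of \<open>\<omega>\<close> the following is the whole tangent plane.\<close>

definition web_tangents :: "nat \<Rightarrow> symform \<Rightarrow> point \<Rightarrow> (complex \<times> complex) set" where
  "web_tangents k \<omega> p = {v. form_eval k (\<omega> p) v = 0}"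

section \<open>Barycenters\<close>

text \<open>Barycenter, with respect to the line spanned by \<open>u \<noteq> 0\<close>, of the \<open>k\<close> lines on which the binary
  form \<open>P\<close> vanishes.  A vector \<open>e\<close> independent of \<open>u\<close> identifies the affine line
  \<open>\<P>(\<complex>\<^sup>2) - {[u]}\<close> with \<open>\<complex>\<close> by \<open>s \<mapsto> [e + s u]\<close>; another choice of \<open>e\<close> changes \<open>s\<close> by an affine
  map.  If \<open>u\<close> is not a zero of \<open>P\<close>, then \<open>P\<close> splits in the coordinates \<open>(x, y) \<mapsto> x e + y u\<close> as
  \<open>P(u) \<Prod>i<k. (y - s\<^sub>i x)\<close>, its lines being the \<open>[e + s\<^sub>i u]\<close> with multiplicities.\<close>

definition barycenter_line :: "nat \<Rightarrow> complex poly \<Rightarrow> complex \<times> complex \<Rightarrow> (complex \<times> complex) set" where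
  "barycenter_line k P u =
     (if form_eval k P u = 0 then cline u
      else {v. \<exists>e s. wedge e u \<noteq> 0 \<and>
               (\<forall>x y. form_eval k P (cscale x e + cscale y u) =
                      form_eval k P u * (\<Prod>i<k. y - s i * x)) \<and>
               v \<in> cline (e + cscale ((\<Sum>i<k. s i) / of_nat k) u)})"

lemma form_eval_1: assumes "Polynomial.degree P \<le> k" shows "form_eval k P (1, t) = poly P t"
proof -
  have "poly P t = (\<Sum>j\<le>k. Polynomial.coeff P j * t ^ j)"
    unfolding poly_altdef
    by (rule sum.mono_neutral_left) (use assms in \<open>auto simp: coeff_eq_0\<close>)
  then show ?thesis by (simp add: form_eval_def)
qed

lemma form_eval_scale: "form_eval k P (cscale c v) = c ^ k * form_eval k P v"
  unfolding form_eval_def sum_distrib_left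
proof (rule sum.cong)
  fix j assume "j \<in> {..k}"
  then have c: "c ^ k = c ^ (k - j) * c ^ j" by (simp flip: power_add)
  show "Polynomial.coeff P j * fst (cscale c v) ^ (k - j) * snd (cscale c v) ^ j =
        c ^ k * (Polynomial.coeff P j * fst v ^ (k - j) * snd v ^ j)"
    unfolding c cscale_def fst_conv snd_conv power_mult_distrib by (simp only: mult_ac)
qed simp

text \<open>For \<open>W = P\<close> and a direction of slope \<open>f\<close> with \<open>W(f) \<noteq> 0\<close>, the barycenter has slope
  \<open>f - k W(f) / W'(f) \<in> \<complex> \<union> {\<infinity>}\<close>.\<close>

lemma barycenter_line_slope:
  assumes deg: "Polynomial.degree P \<le> k" and k: "k \<ge> 1" and f: "poly P f \<noteq> 0"
  shows "barycenter_line k P (1, f) =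
           {v. poly (pderiv P) f * snd v =
               (f * poly (pderiv P) f - of_nat k * poly P f) * fst v}"
proof -
  define L where "L v = poly (pderiv P) f * snd v -
     (f * poly (pderiv P) f - of_nat k * poly P f) * fst v" for v :: "complex \<times> complex"
  have Q: "form_eval k P (1, f) = poly P f" by (rule form_eval_1[OF deg])
  have pd: "poly (pderiv P) f = (\<Sum>j\<le>k. Polynomial.coeff P j * (of_nat j * f ^ (j - 1)))"
  proof -
    have "P = (\<Sum>j\<le>k. Polynomial.monom (Polynomial.coeff P j) j)"
      using poly_as_sum_of_monoms'[OF deg] by simp
    then have "pderiv P = (\<Sum>j\<le>k. pderiv (Polynomial.monom (Polynomial.coeff P j) j))"
      by (metis (no_types, lifting) higher_pderiv_sum[of 1, simplified] sum.cong)
    then show ?thesis by (simp add: poly_sum pderiv_monom poly_monom mult_ac)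
  qed
  have pP: "poly P f = (\<Sum>j\<le>k. Polynomial.coeff P j * f ^ j)"
    using Q by (simp add: form_eval_def)
  have key: "L e = - poly P f * (\<Sum>i<k. s i)"
    if "\<forall>x y. form_eval k P (cscale x e + cscale y (1,f)) =
              form_eval k P (1,f) * (\<Prod>i<k. y - s i * x)" for e s
  proof -
    have eq: "(\<lambda>x. form_eval k P (cscale x e + (1,f))) = (\<lambda>x. poly P f * (\<Prod>i<k. 1 - s i * x))"
      using that[rule_format, of _ 1] Q by (auto simp: cscale_def)
    have d1: "((\<lambda>x. form_eval k P (cscale x e + (1,f))) has_field_derivative
        (\<Sum>j\<le>k. Polynomial.coeff P j * (of_nat (k - j) * fst e * f ^ j + of_nat j * f ^ (j - 1) * snd e))) (at 0)"
      unfolding form_eval_def cscale_def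
      by (auto intro!: derivative_eq_intros sum.cong simp: algebra_simps)
    have "(\<Sum>j\<le>k. Polynomial.coeff P j * (of_nat (k - j) * fst e * f ^ j + of_nat j * f ^ (j - 1) * snd e))
       = (\<Sum>j\<le>k. of_nat k * fst e * (Polynomial.coeff P j * f ^ j)
            - f * fst e * (Polynomial.coeff P j * (of_nat j * f ^ (j - 1)))
            + snd e * (Polynomial.coeff P j * (of_nat j * f ^ (j - 1))))"
    proof (rule sum.cong)
      fix j assume "j \<in> {..k}"
      then have *: "of_nat (k - j) = (of_nat k - of_nat j :: complex)" by (simp add: of_nat_diff)
      have **: "of_nat j * f * f ^ (j - 1) = of_nat j * f ^ j" by (cases j) auto
      show "Polynomial.coeff P j * (of_nat (k - j) * fst e * f ^ j + of_nat j * f ^ (j - 1) * snd e)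
        = of_nat k * fst e * (Polynomial.coeff P j * f ^ j)
            - f * fst e * (Polynomial.coeff P j * (of_nat j * f ^ (j - 1)))
            + snd e * (Polynomial.coeff P j * (of_nat j * f ^ (j - 1)))"
        unfolding * by (cases j) (simp_all add: algebra_simps)
    qed simp
    also have "\<dots> = of_nat k * fst e * poly P f - f * fst e * poly (pderiv P) f + snd e * poly (pderiv P) f"
      unfolding pd pP by (simp add: sum.distrib sum_subtractf sum_distrib_left)
    also have "\<dots> = L e" by (simp add: L_def algebra_simps)
    finally have d1: "((\<lambda>x. form_eval k P (cscale x e + (1,f))) has_field_derivative L e) (at 0)"
      using d1 by simp
    have "((\<lambda>x. poly P f * (\<Prod>i<k. 1 - s i * x)) has_field_derivative
        poly P f * (\<Sum>i<k. - s i * (\<Prod>j\<in>{..<k}-{i}. 1 - s j * 0))) (at 0)"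
      by (auto intro!: derivative_eq_intros has_field_derivative_prod)
    then have "((\<lambda>x. poly P f * (\<Prod>i<k. 1 - s i * x)) has_field_derivative
        - poly P f * (\<Sum>i<k. s i)) (at 0)" by (simp add: sum_negf)
    with d1 show ?thesis unfolding eq using DERIV_unique by blast
  qed
  have Lu: "L (1,f) = of_nat k * poly P f" by (simp add: L_def)
  have Lu0: "L (1,f) \<noteq> 0" using Lu k f by simp
  have Ladd: "L (a + cscale c b) = L a + c * L b" for a b c
    by (simp add: L_def cscale_def algebra_simps)
  have line: "cline b = {v. L v = 0}" if "L b = 0" "wedge b (1,f) \<noteq> 0" for b
  proof (intro equalityI subsetI)
    fix v assume "v \<in> cline b"
    then obtain c where "v = 0 + cscale c b" by (auto simp: cline_def)
    then show "v \<in> {v. L v = 0}" using that(1) Ladd[of 0 c b] by (simp add: L_def)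
  next
    fix v assume "v \<in> {v. L v = 0}"
    then have Lv: "L v = 0" by simp
    define c where "c = wedge v (1,f) / wedge b (1,f)"
    define d where "d = wedge b v / wedge b (1,f)"
    have "wedge b (1,f) * fst v = wedge v (1,f) * fst b + wedge b v * 1"
      "wedge b (1,f) * snd v = wedge v (1,f) * snd b + wedge b v * f"
      by (simp_all add: wedge_def algebra_simps)
    then have "fst v = c * fst b + d * 1" "snd v = c * snd b + d * f"
      using that(2) unfolding c_def d_def by (simp_all add: divide_simps) (simp_all add: mult_ac)
    then have v: "v = cscale c b + cscale d (1,f)"
      by (simp add: cscale_def prod_eq_iff)
    have "L v = c * L b + d * L (1,f)" unfolding v by (simp add: L_def cscale_def algebra_simps)
    with Lv that Lu0 have "d = 0" by simp
    then show "v \<in> cline b" using v by (auto simp: cline_def cscale_def)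
  qed
  have main: "cline (e + cscale ((\<Sum>i<k. s i) / of_nat k) (1,f)) = {v. L v = 0}"
    if "wedge e (1,f) \<noteq> 0" "\<forall>x y. form_eval k P (cscale x e + cscale y (1,f)) =
              form_eval k P (1,f) * (\<Prod>i<k. y - s i * x)" for e s
  proof (rule line)
    show "L (e + cscale ((\<Sum>i<k. s i) / of_nat k) (1,f)) = 0"
      using Ladd key[OF that(2)] Lu k by simp
    show "wedge (e + cscale ((\<Sum>i<k. s i) / of_nat k) (1,f)) (1,f) \<noteq> 0"
      using that(1) by (simp add: wedge_def cscale_def algebra_simps)
  qed
  obtain s where s: "\<forall>x y. form_eval k P (cscale x (0,1) + cscale y (1,f)) =
              form_eval k P (1,f) * (\<Prod>i<k. y - s i * x)"
  proof -
    define R where "R = pcompose P [:f, 1:]"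
    define d where "d = Polynomial.degree R"
    have dk: "d \<le> k" using deg degree_pcompose_le[of P "[:f,1:]"] by (simp add: d_def R_def)
    have pR: "poly R x = poly P (f + x)" for x by (simp add: R_def poly_pcompose)
    obtain r where r: "Polynomial.smult (lead_coeff R) (\<Prod>i<d. [:- r i, 1:]) = R"
      using complex_poly_decompose'[of R] unfolding d_def by metis
    have pr: "poly R x = lead_coeff R * (\<Prod>i<d. x - r i)" for x
      by (subst r[symmetric]) (simp add: poly_prod)
    have R0: "poly P f = lead_coeff R * (\<Prod>i<d. - r i)" using pr[of 0] pR[of 0] by simp
    then have r0: "r i \<noteq> 0" if "i < d" for i using f that by auto
    define s where "s i = (if i < d then 1 / r i else 0)" for i
    have split: "poly P (f + x) = poly P f * (\<Prod>i<k. 1 - s i * x)" for x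
    proof -
      have "(\<Prod>i<k. 1 - s i * x) = (\<Prod>i<d. 1 - s i * x)"
        by (rule prod.mono_neutral_right) (use dk in \<open>auto simp: s_def\<close>)
      moreover have "(\<Prod>i<d. - r i) * (\<Prod>i<d. 1 - s i * x) = (\<Prod>i<d. x - r i)"
        unfolding prod.distrib[symmetric]
        by (rule prod.cong) (auto simp: s_def r0 field_simps)
      ultimately show ?thesis using pR[of x] pr[of x] R0 by (simp add: mult.assoc)
    qed
    have *: "form_eval k P (y, y * f + x) = poly P f * (\<Prod>i<k. y - s i * x)" if "y \<noteq> 0" for x y
    proof -
      have "(y, y * f + x) = cscale y (1, f + x / y)" using that by (simp add: cscale_def field_simps)
      then have "form_eval k P (y, y * f + x) = y ^ k * poly P (f + x / y)"
        by (simp add: form_eval_scale form_eval_1[OF deg])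
      also have "\<dots> = poly P f * (y ^ k * (\<Prod>i<k. 1 - s i * (x / y)))" by (simp add: split)
      also have "y ^ k * (\<Prod>i<k. 1 - s i * (x / y)) = (\<Prod>i<k. y * (1 - s i * (x / y)))"
        by (simp add: prod.distrib)
      also have "\<dots> = (\<Prod>i<k. y - s i * x)"
        by (rule prod.cong) (use that in \<open>auto simp: field_simps\<close>)
      finally show ?thesis .
    qed
    have **: "form_eval k P (y, y * f + x) = poly P f * (\<Prod>i<k. y - s i * x)" for x y
    proof (cases "y = 0")
      case True
      have "isCont (\<lambda>y. form_eval k P (y, y * f + x)) 0"
        unfolding form_eval_def fst_conv snd_conv
        by (intro continuous_sum continuous_mult continuous_power continuous_add
              continuous_ident continuous_const)
      then have 1: "((\<lambda>y. form_eval k P (y, y * f + x)) \<longlongrightarrow> form_eval k P (0, 0 * f + x)) (at 0)"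
        by (rule isContD)
      have "isCont (\<lambda>y. poly P f * (\<Prod>i<k. y - s i * x)) 0"
        by (intro continuous_mult continuous_prod continuous_diff continuous_ident continuous_const)
      then have "((\<lambda>y. poly P f * (\<Prod>i<k. y - s i * x)) \<longlongrightarrow> poly P f * (\<Prod>i<k. 0 - s i * x)) (at 0)"
        by (rule isContD)
      then have 2: "((\<lambda>y. form_eval k P (y, y * f + x)) \<longlongrightarrow> poly P f * (\<Prod>i<k. 0 - s i * x)) (at 0)"
        by (rule Lim_transform_eventually) (unfold eventually_at_filter,
            intro always_eventually allI impI, rule *[symmetric])
      show ?thesis unfolding True using LIM_unique[OF 1 2] .
    qed (rule * )
    show thesis by (rule that[of s]) (use ** Q in \<open>simp add: cscale_def add.commute\<close>)
  qed
  have "barycenter_line k P (1, f) = {v. L v = 0}"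
    unfolding barycenter_line_def if_not_P[OF f[folded Q]]
  proof (intro equalityI subsetI)
    fix v assume "v \<in> {v. L v = 0}"
    then have "v \<in> cline ((0,1) + cscale ((\<Sum>i<k. s i) / of_nat k) (1,f))"
      using main[OF _ s] by (simp add: wedge_def)
    moreover have "wedge (0,1) (1,f) \<noteq> 0" by (simp add: wedge_def)
    ultimately show "v \<in> {v. \<exists>e s. wedge e (1,f) \<noteq> 0 \<and>
               (\<forall>x y. form_eval k P (cscale x e + cscale y (1,f)) =
                      form_eval k P (1,f) * (\<Prod>i<k. y - s i * x)) \<and>
               v \<in> cline (e + cscale ((\<Sum>i<k. s i) / of_nat k) (1,f))}" using s by blast
  qed (use main in blast)
  then show ?thesis by (simp add: L_def)
qed

text \<open>The tangent lines at \<open>p\<close> of the barycenter of the \<open>k\<close>-web \<open>\<omega>\<close> with respect to the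
  \<open>l\<close>-web \<open>\<omega>'\<close>.\<close>

definition barycenter_tangents ::
    "nat \<Rightarrow> symform \<Rightarrow> nat \<Rightarrow> symform \<Rightarrow> point \<Rightarrow> (complex \<times> complex) set" where
  "barycenter_tangents l \<omega>' k \<omega> p =
     (\<Union>u \<in> {u. u \<noteq> 0 \<and> form_eval l (\<omega>' p) u = 0}. barycenter_line k (\<omega> p) u)"

section \<open>Curvature\<close>

text \<open>Near a point of the complement of the discriminant a covering that makes the web completely
  decomposable may be taken unramified, and one of its sheets is an ordering of the \<open>k\<close> local
  foliations, that is, a holomorphic factorization \<open>\<omega> = \<alpha>\<^sub>0 \<cdots> \<alpha>\<^bsub>k-1\<^esub>\<close>.  The form \<open>A dx + B dy\<close>
  corresponds to the polynomial \<open>A + B t\<close>.\<close>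

definition decomposes_at :: "point \<Rightarrow> nat \<Rightarrow> symform \<Rightarrow> (nat \<Rightarrow> oneform) \<Rightarrow> bool" where
  "decomposes_at p k \<omega> \<alpha> \<longleftrightarrow>
     (\<forall>i<k. holo_form_at (\<alpha> i) p) \<and>
     (\<forall>\<^sub>F q in nhds p. \<omega> q = (\<Prod>i<k. [:fst (\<alpha> i q), snd (\<alpha> i q):]))"

text \<open>\<open>\<eta>\<close> is the form \<open>\<eta>\<^bsub>rst\<^esub>\<close> of the three foliations defined by \<open>a\<close>, \<open>b\<close>, \<open>c\<close>.  It is required to be
  holomorphic, as it is where these foliations are pairwise transverse.\<close>

definition eta_at :: "point \<Rightarrow> oneform \<Rightarrow> oneform \<Rightarrow> oneform \<Rightarrow> oneform \<Rightarrow> bool" where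
  "eta_at p a b c \<eta> \<longleftrightarrow>
     holo_form_at \<eta> p \<and>
     (let A = (\<lambda>q. cscale (wedge (b q) (c q)) (a q));
          B = (\<lambda>q. cscale (wedge (c q) (a q)) (b q));
          C = (\<lambda>q. cscale (wedge (a q) (b q)) (c q))
      in \<forall>\<^sub>F q in nhds p.
           ext_deriv A q = wedge (\<eta> q) (A q) \<and>
           ext_deriv B q = wedge (\<eta> q) (B q) \<and>
           ext_deriv C q = wedge (\<eta> q) (C q))"

text \<open>The coefficient of the 2-form \<open>K(\<omega>)\<close>.  It is meaningful off the discriminant only, which
  determines \<open>K(\<omega>)\<close> as a meromorphic 2-form, its poles being contained in the discriminant.\<close>

definition curvature :: "nat \<Rightarrow> symform \<Rightarrow> point \<Rightarrow> complex" where
  "curvature k \<omega> p =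
     (THE \<kappa>. \<exists>\<alpha> \<eta>. decomposes_at p k \<omega> \<alpha> \<and>
        (\<forall>r s t. r < s \<and> s < t \<and> t < k \<longrightarrow> eta_at p (\<alpha> r) (\<alpha> s) (\<alpha> t) (\<eta> r s t)) \<and>
        \<kappa> = (\<Sum>t<k. \<Sum>s<t. \<Sum>r<s. ext_deriv (\<eta> r s t) p))"

text \<open>For a germ \<open>f\<close> of a meromorphic function whose poles are contained in the curve \<open>S\<close> through
  \<open>0\<close>: absence of poles along \<open>S\<close>.  The values of \<open>f\<close> on \<open>S\<close> are disregarded.\<close>

definition holomorphic_along :: "(point \<Rightarrow> complex) \<Rightarrow> point set \<Rightarrow> bool" where
  "holomorphic_along f S \<longleftrightarrow>
     (\<exists>g. holo2_at g 0 \<and> (\<forall>\<^sub>F p in nhds 0. p \<notin> S \<longrightarrow> f p = g p))"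

end

theory Submission
  imports Defs "HOL-Complex_Analysis.Complex_Analysis" "Subresultants.Subresultant"
begin

text \<open>Choose coordinates of the tangent plane in which no leaf of \<open>W\<close> through the origin is vertical.  Since the
  discriminant of a product is the product of the discriminants and of the squared resultant, \<open>\<Delta>(W\<^sub>2) = \<Delta>(W)\<close>
  forces \<open>W\<^sub>k\<close> to have distinct slopes \<open>q\<^sub>i\<close> at the origin, transverse to \<open>W\<^sub>2\<close>, whose slopes are \<open>u \<plusminus> \<surd>E\<close> with
  \<open>E = h\<^sup>m c\<^sub>0\<close>, where \<open>h = 0\<close> is the reduced equation of \<open>\<Delta>(W)\<close> and \<open>c\<^sub>0\<close> is a unit.  The form \<open>\<eta>\<close> of three
  foliations is explicit in terms of their slopes, and symmetrization in \<open>\<plusminus>\<surd>E\<close> shows that only the triples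
  containing both leaves of \<open>W\<^sub>2\<close> have poles.  Their sum contributes \<open>(m/2) d(\<phi> \<omega>\<^sub>0 / h)\<close> up to a holomorphic
  summand, where \<open>\<omega>\<^sub>0\<close> defines the foliation of slope \<open>u\<close>.  On \<open>h = 0\<close> the function \<open>\<phi>\<close> vanishes where the
  barycenter is tangent to the curve.  The polar part of order two is \<open>- (m/2) \<phi> g / h\<^sup>2\<close> with \<open>g\<close> the
  derivative of \<open>h\<close> along the direction of slope \<open>u\<close>, so holomorphy forces \<open>g = 0\<close> or \<open>\<phi> = 0\<close> on the curve; conversely either one makes
  the pole disappear.\<close>

section \<open>Holomorphic functions of two variables\<close>

text \<open>The curvature is a definite description over all local factorizations at a point off the
  discriminant, so it first has to be made explicit. Multiplying three forms by units changes \<eta>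
  by a logarithmic differential, which is closed, and two factorizations with distinct slopes differ
  by units and a permutation; hence the curvature depends on the slopes alone. Near the discriminant
  \<surd>E exists only locally and off the curve, so sums of \<eta> over both leaves of the 2-web
  are rewritten in E and dE. The one singular term is the value of \<eta> on the third leaf, where
  dE / (2 E) appears; for E = h^m c0 it is (m/2) dh / h plus a holomorphic form, which is the origin
  of m/2. Instead of changing coordinates, a constant vector (c, 1), transverse to all leaves at the
  origin, replaces the vertical one. Derivatives along (1, 0) and (c, 1) commute, so formulas keep
  their usual shape. Product formulas for resultants of formal degree are proved for absolute values
  only: signs are lost, but vanishing and limits are all that is needed.\<close>

definition hasd :: "(point \<Rightarrow> complex) \<Rightarrow> complex \<Rightarrow> complex \<Rightarrow> point \<Rightarrow> bool" where
  "hasd f a b p \<longleftrightarrow> (f has_derivative (\<lambda>v. a * fst v + b * snd v)) (at p)"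

lemma holo2_at_hasd: "holo2_at f p \<longleftrightarrow> (\<forall>\<^sub>F q in nhds p. \<exists>a b. hasd f a b q)"
  by (simp add: holo2_at_def hasd_def)

lemma hasd_slices:
  assumes "hasd f a b p"
  shows "((\<lambda>z. f (z, snd p)) has_field_derivative a) (at (fst p))"
    and "((\<lambda>z. f (fst p, z)) has_field_derivative b) (at (snd p))"
proof -
  have f: "(f has_derivative (\<lambda>v. a * fst v + b * snd v)) (at (fst p, snd p))"
    using assms by (simp add: hasd_def)
  have "((\<lambda>z. f (z, snd p)) has_derivative (\<lambda>z. a * fst (z, 0::complex) + b * snd (z, 0::complex))) (at (fst p))"
    by (rule has_derivative_compose[OF has_derivative_Pair[OF has_derivative_ident has_derivative_const] f])
  then show "((\<lambda>z. f (z, snd p)) has_field_derivative a) (at (fst p))"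
    by (simp add: has_field_derivative_def)
  have "((\<lambda>z. f (fst p, z)) has_derivative (\<lambda>z. a * fst (0::complex, z) + b * snd (0::complex, z))) (at (snd p))"
    by (rule has_derivative_compose[OF has_derivative_Pair[OF has_derivative_const has_derivative_ident] f])
  then show "((\<lambda>z. f (fst p, z)) has_field_derivative b) (at (snd p))"
    by (simp add: has_field_derivative_def)
qed

lemma hasd_partial:
  assumes "hasd f a b p" shows "partial_x f p = a" "partial_y f p = b"
  using hasd_slices[OF assms] by (simp_all add: partial_x_def partial_y_def DERIV_imp_deriv)

lemma holo2_hasd:
  assumes "holo2_at f p" shows "hasd f (partial_x f p) (partial_y f p) p"
proof -
  obtain a b where "hasd f a b p"
    using eventually_nhds_x_imp_x[OF assms[unfolded holo2_at_hasd]] by blast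
  with hasd_partial[OF this] show ?thesis by simp
qed

lemma holo2_eventually: "holo2_at f p \<Longrightarrow> \<forall>\<^sub>F q in nhds p. holo2_at f q"
  unfolding holo2_at_def by (simp add: eventually_eventually)

lemma hasd_cong_imp:
  assumes "\<forall>\<^sub>F q in nhds p. f q = g q" "hasd f a b p" shows "hasd g a b p"
proof -
  have "\<forall>\<^sub>F q in at p. f q = g q" "f p = g p"
    using assms(1) eventually_nhds_x_imp_x eventually_nhds_conv_at by blast+
  then show ?thesis using assms(2) unfolding hasd_def
    using has_derivative_transform_eventually by blast
qed

lemma holo2_cong:
  assumes "\<forall>\<^sub>F q in nhds p. f q = g q" "holo2_at f p" shows "holo2_at g p"
proof -
  have *: "\<forall>\<^sub>F q in nhds p. \<forall>\<^sub>F r in nhds q. f r = g r" using assms by (simp add: eventually_eventually)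
  show ?thesis using * assms(2) unfolding holo2_at_hasd
    by eventually_elim (elim exE, intro exI, rule hasd_cong_imp)
qed

lemma partial_cong:
  assumes "\<forall>\<^sub>F q in nhds p. f q = g q"
  shows "partial_x f p = partial_x g p" "partial_y f p = partial_y g p"
proof -
  have x: "filterlim (\<lambda>z. (z, snd p)) (nhds (fst p, snd p)) (nhds (fst p))"
    and y: "filterlim (\<lambda>z. (fst p, z)) (nhds (fst p, snd p)) (nhds (snd p))"
    by (intro tendsto_Pair filterlim_ident tendsto_const)+
  have p: "\<forall>\<^sub>F q in nhds (fst p, snd p). f q = g q" using assms by simp
  show "partial_x f p = partial_x g p" "partial_y f p = partial_y g p"
    unfolding partial_x_def partial_y_def
    using filterlim_iff[THEN iffD1, OF x, rule_format, OF p]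
      filterlim_iff[THEN iffD1, OF y, rule_format, OF p]
    by (auto intro!: deriv_cong_ev)
qed

lemma hasd_const: "hasd (\<lambda>_. k) 0 0 p"
  unfolding hasd_def by simp

lemma hasd_fst: "hasd fst 1 0 p" and hasd_snd: "hasd snd 0 1 p"
  unfolding hasd_def
  using has_derivative_fst[OF has_derivative_ident, of "at p"]
    has_derivative_snd[OF has_derivative_ident, of "at p"] by simp_all

lemma hasd_add:
  assumes "hasd f a b p" "hasd g a' b' p"
  shows "hasd (\<lambda>q. f q + g q) (a + a') (b + b') p"
  unfolding hasd_def
  by (rule has_derivative_eq_rhs[OF has_derivative_add[OF assms[unfolded hasd_def]]])
    (simp add: algebra_simps)

lemma hasd_diff:
  assumes "hasd f a b p" "hasd g a' b' p"
  shows "hasd (\<lambda>q. f q - g q) (a - a') (b - b') p"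
  unfolding hasd_def
  by (rule has_derivative_eq_rhs[OF has_derivative_diff[OF assms[unfolded hasd_def]]])
    (simp add: algebra_simps)

lemma hasd_mult:
  assumes "hasd f a b p" "hasd g a' b' p"
  shows "hasd (\<lambda>q. f q * g q) (a * g p + f p * a') (b * g p + f p * b') p"
  unfolding hasd_def
  by (rule has_derivative_eq_rhs[OF has_derivative_mult[OF assms[unfolded hasd_def]]])
    (simp add: algebra_simps)

lemma hasd_compose:
  assumes "hasd f a b p" "(\<phi> has_field_derivative d) (at (f p))"
  shows "hasd (\<lambda>q. \<phi> (f q)) (d * a) (d * b) p"
  unfolding hasd_def
  by (rule has_derivative_eq_rhs[OF has_derivative_compose[OF assms(1)[unfolded hasd_def]
        assms(2)[unfolded has_field_derivative_def]]]) (simp add: algebra_simps)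

lemma hasd_inverse:
  assumes "hasd f a b p" "f p \<noteq> 0"
  shows "hasd (\<lambda>q. inverse (f q)) (- a / (f p)\<^sup>2) (- b / (f p)\<^sup>2) p"
proof -
  have "(inverse has_field_derivative - (1 / (f p)\<^sup>2)) (at (f p))"
    using assms(2) by (auto intro!: derivative_eq_intros simp: power2_eq_square divide_simps)
  from hasd_compose[OF assms(1) this] show ?thesis by simp
qed

lemma hasd_divide:
  assumes "hasd f a b p" "hasd g a' b' p" "g p \<noteq> 0"
  shows "hasd (\<lambda>q. f q / g q) ((a * g p - f p * a') / (g p)\<^sup>2) ((b * g p - f p * b') / (g p)\<^sup>2) p"
proof -
  have "a * inverse (g p) + f p * (- a' / (g p)\<^sup>2) = (a * g p - f p * a') / (g p)\<^sup>2" for a a'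
    using assms(3) by (simp add: field_simps power2_eq_square)
  then show ?thesis using hasd_mult[OF assms(1) hasd_inverse[OF assms(2,3)]]
    by (simp add: divide_inverse)
qed

lemma hasd_sum:
  "(\<And>i. i \<in> A \<Longrightarrow> hasd (f i) (a i) (b i) p) \<Longrightarrow>
    hasd (\<lambda>q. \<Sum>i\<in>A. f i q) (\<Sum>i\<in>A. a i) (\<Sum>i\<in>A. b i) p"
  by (induction A rule: infinite_finite_induct) (simp_all add: hasd_add hasd_const)

lemma hasd_chain:
  assumes "hasd F A B (g p, h p)" "hasd g a b p" "hasd h a' b' p"
  shows "hasd (\<lambda>q. F (g q, h q)) (A * a + B * a') (A * b + B * b') p"
proof -
  have "((\<lambda>q. (g q, h q)) has_derivative (\<lambda>v. (a * fst v + b * snd v, a' * fst v + b' * snd v))) (at p)"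
    using assms(2,3) unfolding hasd_def by (rule has_derivative_Pair)
  from has_derivative_compose[OF this assms(1)[unfolded hasd_def]] show ?thesis
    unfolding hasd_def by (simp add: algebra_simps)
qed

lemma hasd_continuous: "hasd f a b p \<Longrightarrow> isCont f p"
  unfolding hasd_def by (rule has_derivative_continuous)

lemma holo2_isCont: "holo2_at f p \<Longrightarrow> isCont f p"
  by (rule hasd_continuous[OF holo2_hasd])

lemma holo2_tendsto: "holo2_at f p \<Longrightarrow> (f \<longlongrightarrow> f p) (nhds p)"
  using holo2_isCont[of f p] unfolding isCont_def tendsto_at_iff_tendsto_nhds .

lemma holo2_eventually_ne: "holo2_at f p \<Longrightarrow> f p \<noteq> z \<Longrightarrow> \<forall>\<^sub>F q in nhds p. f q \<noteq> z"
  using tendsto_imp_eventually_ne[OF holo2_tendsto] .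

lemma holo2_const: "holo2_at (\<lambda>_. k) p" and holo2_fst: "holo2_at fst p" and holo2_snd: "holo2_at snd p"
  unfolding holo2_at_hasd by ((rule always_eventually, intro allI exI)[1], rule hasd_const hasd_fst hasd_snd)+

lemma holo2_add:
  assumes "holo2_at f p" "holo2_at g p" shows "holo2_at (\<lambda>q. f q + g q) p"
  using assms unfolding holo2_at_hasd
  by eventually_elim (elim exE, intro exI, erule hasd_add, assumption)

lemma holo2_diff:
  assumes "holo2_at f p" "holo2_at g p" shows "holo2_at (\<lambda>q. f q - g q) p"
  using assms unfolding holo2_at_hasd
  by eventually_elim (elim exE, intro exI, erule hasd_diff, assumption)

lemma holo2_mult:
  assumes "holo2_at f p" "holo2_at g p" shows "holo2_at (\<lambda>q. f q * g q) p"
  using assms unfolding holo2_at_hasd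
  by eventually_elim (elim exE, intro exI, erule hasd_mult, assumption)

lemma holo2_uminus: "holo2_at f p \<Longrightarrow> holo2_at (\<lambda>q. - f q) p"
  using holo2_diff[OF holo2_const, of f p 0] by simp

lemma holo2_divide:
  assumes "holo2_at f p" "holo2_at g p" "g p \<noteq> 0" shows "holo2_at (\<lambda>q. f q / g q) p"
  using assms(1,2) holo2_eventually_ne[OF assms(2,3)] unfolding holo2_at_hasd
  by eventually_elim (elim exE, intro exI, rule hasd_divide, assumption+)

lemma holo2_sum: "(\<And>i. i \<in> A \<Longrightarrow> holo2_at (f i) p) \<Longrightarrow> holo2_at (\<lambda>q. \<Sum>i\<in>A. f i q) p"
  by (induction A rule: infinite_finite_induct) (simp_all add: holo2_add holo2_mult holo2_const)

lemma holo2_power: "holo2_at f p \<Longrightarrow> holo2_at (\<lambda>q. f q ^ n) p"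
  by (induction n) (simp_all add: holo2_mult holo2_const)

lemma holo2_compose:
  assumes "holo2_at f p" "open U" "\<phi> holomorphic_on U" "f p \<in> U"
  shows "holo2_at (\<lambda>q. \<phi> (f q)) p"
proof -
  have "\<forall>\<^sub>F q in nhds p. f q \<in> U"
    using topological_tendstoD[OF holo2_tendsto[OF assms(1)] assms(2,4)] .
  with assms(1) show ?thesis unfolding holo2_at_hasd
    by eventually_elim (elim exE, intro exI, erule hasd_compose, erule holomorphic_derivI[OF assms(3,2)])
qed

lemma holo2_chain:
  assumes F: "holo2_at F (g p, h p)" and g: "holo2_at g p" and h: "holo2_at h p"
  shows "holo2_at (\<lambda>q. F (g q, h q)) p"
proof -
  have "((\<lambda>q. (g q, h q)) \<longlongrightarrow> (g p, h p)) (nhds p)"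
    by (intro tendsto_Pair holo2_tendsto g h)
  then have "\<forall>\<^sub>F q in nhds p. \<exists>a b. hasd F a b (g q, h q)"
    using F unfolding filterlim_iff holo2_at_hasd by auto
  then show ?thesis using g h unfolding holo2_at_hasd
    by eventually_elim (elim exE, intro exI, rule hasd_chain, assumption+)
qed

section \<open>Coordinate slices, Cauchy's formula and partial derivatives\<close>

lemma holo2_slices:
  assumes "holo2_at f p"
  shows "\<exists>r>0. (\<lambda>z. f (z, snd p)) holomorphic_on ball (fst p) r \<and> (\<lambda>z. f (fst p, z)) holomorphic_on ball (snd p) r"
proof -
  obtain r where r: "r > 0" "\<And>q. dist q p < r \<Longrightarrow> \<exists>a b. hasd f a b q"
    using assms unfolding holo2_at_hasd eventually_nhds_metric by blast
  have "(\<lambda>z. f (z, snd p)) field_differentiable at z" if "z \<in> ball (fst p) r" for z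
  proof -
    have "dist (z, snd p) p < r" using that by (cases p) (simp add: dist_Pair_Pair dist_commute)
    then obtain a b where "hasd f a b (z, snd p)" using r(2) by blast
    from hasd_slices(1)[OF this] show ?thesis unfolding field_differentiable_def by auto
  qed
  then have "(\<lambda>z. f (z, snd p)) holomorphic_on ball (fst p) r"
    unfolding holomorphic_on_def by (blast intro: field_differentiable_at_within)
  moreover have "(\<lambda>w. f (fst p, w)) field_differentiable at z" if "z \<in> ball (snd p) r" for z
  proof -
    have "dist (fst p, z) p < r" using that by (cases p) (simp add: dist_Pair_Pair dist_commute)
    then obtain a b where "hasd f a b (fst p, z)" using r(2) by blast
    from hasd_slices(2)[OF this] show ?thesis unfolding field_differentiable_def by auto
  qed
  then have "(\<lambda>z. f (fst p, z)) holomorphic_on ball (snd p) r"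
    unfolding holomorphic_on_def by (blast intro: field_differentiable_at_within)
  ultimately show ?thesis using r(1) by blast
qed

lemma holo2_swap: "holo2_at f p \<Longrightarrow> holo2_at (\<lambda>q. f (snd q, fst q)) (snd p, fst p)"
  using holo2_chain[of f snd "(snd p, fst p)" fst, OF _ holo2_snd holo2_fst] by simp

lemma partial_swap:
  "partial_x (\<lambda>q. f (snd q, fst q)) p = partial_y f (snd p, fst p)"
  "partial_y (\<lambda>q. f (snd q, fst q)) p = partial_x f (snd p, fst p)"
  by (simp_all add: partial_x_def partial_y_def)

text \<open>Cauchy's formula for the first derivative, with the circle parametrized by [0, 1]. As an
  integral over a fixed interval it can be treated as a parameter integral in the centre and in the
  other variable.\<close>

lemma deriv_circle_mean:
  fixes g :: "complex \<Rightarrow> complex"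
  assumes "continuous_on (cball y r) g" "g holomorphic_on ball y r" "r > 0"
  shows "deriv g y = integral {0..1} (\<lambda>t. g (y + of_real r * cis (2 * pi * t)) / (of_real r * cis (2 * pi * t)))"
proof -
  have e: "exp (2 * of_real pi * \<i> * of_real t) = cis (2 * pi * t)" for t
    by (simp add: cis_conv_exp mult_ac)
  have "((\<lambda>u. g u / (u - y) ^ Suc 1) has_contour_integral (2 * pi * \<i> / fact 1 * (deriv ^^ 1) g y)) (circlepath y r)"
    by (rule Cauchy_has_contour_integral_higher_derivative_circlepath[OF assms(1,2)]) (use assms in auto)
  then have "((\<lambda>u. g u / (u - y)\<^sup>2) has_contour_integral (2 * pi * \<i> * deriv g y)) (circlepath y r)"
    by (simp add: power2_eq_square)
  then have "((\<lambda>t. g (circlepath y r t) / (circlepath y r t - y)\<^sup>2 * (2 * pi * \<i> * r * exp (2 * of_real pi * \<i> * t)))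
      has_integral (2 * pi * \<i> * deriv g y)) {0..1}"
    by (simp add: has_contour_integral vector_derivative_circlepath mult_ac)
  from has_integral_divide[OF this, of "2 * pi * \<i>"]
  have "((\<lambda>t. g (circlepath y r t) / (circlepath y r t - y)\<^sup>2 * (2 * pi * \<i> * r * exp (2 * of_real pi * \<i> * t)) / (2 * pi * \<i>))
      has_integral deriv g y) {0..1}" by simp
  moreover have "g (circlepath y r t) / (circlepath y r t - y)\<^sup>2 * (2 * pi * \<i> * r * exp (2 * of_real pi * \<i> * t)) / (2 * pi * \<i>)
      = g (y + of_real r * cis (2 * pi * t)) / (of_real r * cis (2 * pi * t))" for t
    unfolding circlepath e by (simp add: divide_simps power2_eq_square) 
  ultimately show ?thesis by (simp add: integral_unique)
qed

text \<open>Integration over circles needs a domain, which the germ notion \<open>holo2_at\<close>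
  does not name.\<close>

definition holo_on2 :: "point set \<Rightarrow> (point \<Rightarrow> complex) \<Rightarrow> bool" where
  "holo_on2 U f \<longleftrightarrow> open U \<and> (\<forall>q\<in>U. \<exists>a b. hasd f a b q)"

lemma holo_on2_continuous: "holo_on2 U f \<Longrightarrow> continuous_on U f"
  unfolding holo_on2_def using hasd_continuous by (meson continuous_at_imp_continuous_on)

lemma holo_on2_slices:
  assumes "holo_on2 U f" "(x, y) \<in> U"
  shows "((\<lambda>z. f (z, y)) has_field_derivative partial_x f (x, y)) (at x)"
    and "((\<lambda>z. f (x, z)) has_field_derivative partial_y f (x, y)) (at y)"
proof -
  obtain a b where "hasd f a b (x, y)" using assms unfolding holo_on2_def by blast
  from hasd_slices[OF this] hasd_partial[OF this]
  show "((\<lambda>z. f (z, y)) has_field_derivative partial_x f (x, y)) (at x)"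
    "((\<lambda>z. f (x, z)) has_field_derivative partial_y f (x, y)) (at y)" by simp_all
qed

lemma holo2_at_on2: "holo2_at f p \<longleftrightarrow> (\<exists>U. p \<in> U \<and> holo_on2 U f)"
  unfolding holo2_at_hasd eventually_nhds holo_on2_def by blast

lemma holo_on2_at: "holo_on2 U f \<Longrightarrow> q \<in> U \<Longrightarrow> holo2_at f q"
  unfolding holo2_at_on2 by blast

lemma holo_on2_swap:
  assumes "holo_on2 U f" shows "holo_on2 (prod.swap -` U) (\<lambda>q. f (snd q, fst q))"
  unfolding holo_on2_def
proof (intro conjI ballI)
  show "open (prod.swap -` U)"
    using assms unfolding holo_on2_def
    by (intro open_vimage continuous_on_swap) auto
  fix q assume "q \<in> prod.swap -` U"
  then have "holo2_at f (snd q, fst q)" using holo_on2_at[OF assms] by (cases q) simp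
  from holo2_hasd[OF holo2_swap[OF this]]
  show "\<exists>a b. hasd (\<lambda>q. f (snd q, fst q)) a b q" by auto
qed

text \<open>One radius r serves all centres near (x0, y0), so \<open>partial_y f\<close> is a
  parameter integral there and therefore continuous. Only joint continuity and differentiability in
  the second variable are assumed, because \<open>osgood\<close> uses the result before joint
  differentiability is known.\<close>

lemma partial_y_circle_mean:
  fixes f :: "point \<Rightarrow> complex"
  assumes U: "open U" and f: "continuous_on U f"
    and y: "\<And>x y. (x, y) \<in> U \<Longrightarrow> (\<lambda>z. f (x, z)) field_differentiable at y"
    and p: "(x0, y0) \<in> U"
  shows "\<exists>r>0. continuous_on (ball x0 r \<times> ball y0 r) (partial_y f) \<and>
    (\<forall>x\<in>ball x0 r. \<forall>y\<in>ball y0 r. cball y r \<subseteq> {z. (x, z) \<in> U} \<and>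
       (\<forall>t. (x, y + of_real r * cis (2 * pi * t)) \<in> U) \<and>
       partial_y f (x, y) = integral {0..1} (\<lambda>t. f (x, y + of_real r * cis (2 * pi * t)) / (of_real r * cis (2 * pi * t))))"
proof -
  obtain A B where AB: "open A" "open B" "x0 \<in> A" "y0 \<in> B" "A \<times> B \<subseteq> U"
    using open_prod_elim[OF U p] by (metis mem_Times_iff fst_conv snd_conv)
  obtain d1 d2 where d: "d1 > 0" "ball x0 d1 \<subseteq> A" "d2 > 0" "ball y0 d2 \<subseteq> B"
    using AB open_contains_ball by meson
  \<comment> \<open>A centre at distance less than r from y0 and a circle of radius r around it stay
    within distance 2 r < d2.\<close>
  define r where "r = min d1 (d2 / 4)"
  have r: "r > 0" "r \<le> d1" "4 * r \<le> d2" using d by (auto simp: r_def)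
  have sub: "cball y r \<subseteq> {z. (x, z) \<in> U}" if "x \<in> ball x0 r" "y \<in> ball y0 r" for x y
  proof
    fix z assume "z \<in> cball y r"
    then have "dist y0 z < d2" using that r dist_triangle[of y0 z y] by simp
    then have "x \<in> A" "z \<in> B" using that(1) d(2,4) r(2) by (auto simp: subset_iff)
    then show "z \<in> {z. (x, z) \<in> U}" using AB(5) by blast
  qed
  have c: "y + of_real r * cis (2 * pi * t) \<in> cball y r" for y t
    using r(1) by (simp add: dist_norm norm_mult)
  have inU: "(x, y + of_real r * cis (2 * pi * t)) \<in> U" if "x \<in> ball x0 r" "y \<in> ball y0 r" for x y t
    using sub[OF that] c by blast
  have mean: "partial_y f (x, y) = integral {0..1} (\<lambda>t. f (x, y + of_real r * cis (2 * pi * t)) / (of_real r * cis (2 * pi * t)))"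
    if "x \<in> ball x0 r" "y \<in> ball y0 r" for x y
  proof -
    have "(\<lambda>z. f (x, z)) field_differentiable at z" if "z \<in> cball y r" for z
      using sub[OF \<open>x \<in> ball x0 r\<close> \<open>y \<in> ball y0 r\<close>] that y by blast
    then have "(\<lambda>z. f (x, z)) holomorphic_on cball y r"
      unfolding holomorphic_on_def by (blast intro: field_differentiable_at_within)
    then have "continuous_on (cball y r) (\<lambda>z. f (x, z))" "(\<lambda>z. f (x, z)) holomorphic_on ball y r"
      by (auto intro: holomorphic_on_imp_continuous_on holomorphic_on_subset)
    from deriv_circle_mean[OF this r(1)] show ?thesis by (simp add: partial_y_def)
  qed
  have "continuous_on ((ball x0 r \<times> ball y0 r) \<times> cbox 0 1)
      (\<lambda>(q, t). f (fst q, snd q + of_real r * cis (2 * pi * t)) / (of_real r * cis (2 * pi * t)))"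
    unfolding case_prod_beta
    by (intro continuous_on_divide continuous_on_compose2[OF f] continuous_intros)
      (use r inU in auto)
  from integral_continuous_on_param[OF this]
  have "continuous_on (ball x0 r \<times> ball y0 r) (partial_y f)"
    by (rule continuous_on_eq) (use mean in auto)
  with r(1) inU sub mean show ?thesis by (intro exI[of _ r] conjI ballI allI) simp_all
qed

text \<open>Cauchy's formula makes \<open>partial_y f\<close> continuous, and a function with one
  continuous partial derivative is differentiable wherever the other one exists.\<close>

lemma osgood:
  assumes U: "open U" and f: "continuous_on U f"
    and x: "\<And>x y. (x, y) \<in> U \<Longrightarrow> (\<lambda>z. f (z, y)) field_differentiable at x"
    and y: "\<And>x y. (x, y) \<in> U \<Longrightarrow> (\<lambda>z. f (x, z)) field_differentiable at y"
  shows "holo_on2 U f"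
  unfolding holo_on2_def
proof (intro conjI ballI U)
  fix p assume "p \<in> U"
  then obtain x0 y0 where p: "p = (x0, y0)" "(x0, y0) \<in> U" by (cases p) auto
  obtain r where r: "r > 0" "continuous_on (ball x0 r \<times> ball y0 r) (partial_y f)"
    "\<forall>x\<in>ball x0 r. \<forall>y\<in>ball y0 r. cball y r \<subseteq> {z. (x, z) \<in> U}"
    using partial_y_circle_mean[OF U f y p(2)] by auto
  define V where "V = ball x0 r \<times> ball y0 r"
  have V: "open V" "(x0, y0) \<in> V" using r(1) by (auto simp: V_def open_Times)
  have VU: "(x, y) \<in> U" if "x \<in> ball x0 r" "y \<in> ball y0 r" for x y
  proof -
    have "y \<in> cball y r" using r(1) by simp
    then show ?thesis using bspec[OF bspec[OF r(3) that(1)] that(2)] by blast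
  qed
  obtain a where a: "((\<lambda>z. f (z, y0)) has_field_derivative a) (at x0)"
    using x[OF p(2)] unfolding field_differentiable_def by blast
  have "((\<lambda>(x, y). f (x, y)) has_derivative
      (\<lambda>(tx, ty). a * tx + blinfun_apply (blinfun_mult_right (partial_y f (x0, y0))) ty))
      (at (x0, y0) within ball x0 r \<times> ball y0 r)"
  proof (rule has_derivative_partialsI[where f = "\<lambda>x y. f (x, y)" and fy = "\<lambda>x y. blinfun_mult_right (partial_y f (x, y))"])
    show "((\<lambda>x. f (x, y0)) has_derivative (\<lambda>z. a * z)) (at x0 within ball x0 r)"
      using a unfolding has_field_derivative_def by (rule has_derivative_at_withinI)
    fix x' y' assume xy: "x' \<in> ball x0 r" "y' \<in> ball y0 r"
    have "((\<lambda>z. f (x', z)) has_field_derivative partial_y f (x', y')) (at y')"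
      using y[OF VU[OF xy]] unfolding partial_y_def by (simp add: field_differentiable_derivI)
    then show "((\<lambda>y. f (x', y)) has_derivative blinfun_apply (blinfun_mult_right (partial_y f (x', y')))) (at y' within ball y0 r)"
      unfolding has_field_derivative_def by (simp add: has_derivative_at_withinI)
  next
    have "continuous_on V (\<lambda>q. blinfun_mult_right (partial_y f q))"
      using r(2) unfolding V_def
      by (rule bounded_linear.continuous_on[OF bounded_linear_blinfun_mult_right])
    then show "continuous (at (x0, y0) within ball x0 r \<times> ball y0 r) (\<lambda>(x, y). blinfun_mult_right (partial_y f (x, y)))"
      using bspec[OF _ V(2)] unfolding continuous_on_eq_continuous_within V_def case_prod_beta' by auto
  qed (use r(1) in auto)
  then have "(f has_derivative (\<lambda>(tx, ty). a * tx + partial_y f (x0, y0) * ty)) (at (x0, y0) within V)"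
    by (simp add: V_def)
  then have "(f has_derivative (\<lambda>(tx, ty). a * tx + partial_y f (x0, y0) * ty)) (at p)"
    using at_within_open[OF V(2,1)] p by simp
  then have "hasd f a (partial_y f (x0, y0)) p" unfolding hasd_def case_prod_beta' by simp
  then show "\<exists>a b. hasd f a b p" by blast
qed

lemma holo_on2_partial_y_continuous:
  assumes "holo_on2 U f" shows "continuous_on U (partial_y f)"
proof -
  have U: "open U" using assms unfolding holo_on2_def by blast
  have "isCont (partial_y f) (x, y)" if "(x, y) \<in> U" for x y
  proof -
    have "(\<lambda>z. f (x, z)) field_differentiable at y" if "(x, y) \<in> U" for x y
      using holo_on2_slices(2)[OF assms that] unfolding field_differentiable_def by blast
    from partial_y_circle_mean[OF U holo_on2_continuous[OF assms] this \<open>(x, y) \<in> U\<close>]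
    obtain r where "r > 0" "continuous_on (ball x r \<times> ball y r) (partial_y f)" by auto
    then show ?thesis
      using continuous_on_eq_continuous_at[of "ball x r \<times> ball y r" "partial_y f"] by (auto simp: open_Times)
  qed
  then show ?thesis by (auto intro!: continuous_at_imp_continuous_on)
qed

lemma holo_on2_partial_x_continuous:
  assumes "holo_on2 U f" shows "continuous_on U (partial_x f)"
proof -
  have "continuous_on (prod.swap -` U) (partial_y (\<lambda>q. f (snd q, fst q)))"
    by (rule holo_on2_partial_y_continuous[OF holo_on2_swap[OF assms]])
  then have "continuous_on (prod.swap -` U) (\<lambda>q. partial_x f (prod.swap q))"
    by (rule continuous_on_eq) (simp add: partial_swap case_prod_beta prod.swap_def)
  from continuous_on_compose2[OF this continuous_on_swap, of U]
  show ?thesis by (auto simp: image_subset_iff)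
qed

text \<open>Differentiation under the integral sign in Cauchy's formula. The integral is kept in the
  conclusion because it is also Cauchy's formula for \<open>partial_y (partial_x f)\<close>, which
  gives \<open>partial_commute\<close>.\<close>

lemma holo_on2_partial_y_slice:
  assumes "holo_on2 U f" "(x0, y0) \<in> U"
  shows "\<exists>r>0. ((\<lambda>x. partial_y f (x, y0)) has_field_derivative
      integral {0..1} (\<lambda>t. partial_x f (x0, y0 + of_real r * cis (2 * pi * t)) / (of_real r * cis (2 * pi * t)))) (at x0)
    \<and> cball y0 r \<subseteq> {z. (x0, z) \<in> U}"
proof -
  have U: "open U" using assms(1) unfolding holo_on2_def by blast
  have fd: "(\<lambda>z. f (x, z)) field_differentiable at y" if "(x, y) \<in> U" for x y
    using holo_on2_slices(2)[OF assms(1) that] unfolding field_differentiable_def by blast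
  obtain r where r: "r > 0" and all: "\<forall>x\<in>ball x0 r. \<forall>y\<in>ball y0 r. cball y r \<subseteq> {z. (x, z) \<in> U} \<and>
       (\<forall>t. (x, y + of_real r * cis (2 * pi * t)) \<in> U) \<and>
       partial_y f (x, y) = integral {0..1} (\<lambda>t. f (x, y + of_real r * cis (2 * pi * t)) / (of_real r * cis (2 * pi * t)))"
    using partial_y_circle_mean[OF U holo_on2_continuous[OF assms(1)] fd assms(2)] by auto
  have y0: "y0 \<in> ball y0 r" using r(1) by simp
  note all' = bspec[OF bspec[OF all] y0]
  let ?e = "\<lambda>t::real. of_real r * cis (2 * pi * t)"
  have "((\<lambda>x. integral (cbox 0 1) (\<lambda>t. f (x, y0 + ?e t) / ?e t)) has_field_derivative
      integral (cbox 0 1) (\<lambda>t. partial_x f (x0, y0 + ?e t) / ?e t)) (at x0 within ball x0 r)"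
  proof (rule leibniz_rule_field_derivative)
    fix x t assume "x \<in> ball x0 r" "t \<in> cbox (0::real) 1"
    from DERIV_cdivide[OF holo_on2_slices(1)[OF assms(1) all'[OF this(1), THEN conjunct2, THEN conjunct1, rule_format]], where c = "?e t"]
    show "((\<lambda>x. f (x, y0 + ?e t) / ?e t) has_field_derivative partial_x f (x, y0 + ?e t) / ?e t) (at x within ball x0 r)"
      by (rule has_field_derivative_at_within)
  next
    fix x assume x: "x \<in> ball x0 r"
    have "continuous_on (cbox 0 1) (\<lambda>t. f (x, y0 + ?e t) / ?e t)"
      by (intro continuous_on_divide continuous_on_compose2[OF holo_on2_continuous[OF assms(1)]] continuous_intros)
        (use r all'[OF x] in auto)
    then show "(\<lambda>t. f (x, y0 + ?e t) / ?e t) integrable_on cbox 0 1" by (rule integrable_continuous)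
  next
    show "continuous_on (ball x0 r \<times> cbox 0 1) (\<lambda>(x, t). partial_x f (x, y0 + ?e t) / ?e t)"
      unfolding case_prod_beta
      by (intro continuous_on_divide continuous_on_compose2[OF holo_on2_partial_x_continuous[OF assms(1)]] continuous_intros)
        (use r all' in auto)
  qed (use r in auto)
  then have d: "((\<lambda>x. integral (cbox 0 1) (\<lambda>t. f (x, y0 + ?e t) / ?e t)) has_field_derivative
      integral (cbox 0 1) (\<lambda>t. partial_x f (x0, y0 + ?e t) / ?e t)) (at x0)"
    using at_within_open[of x0 "ball x0 r"] r by simp
  have "((\<lambda>x. partial_y f (x, y0)) has_field_derivative
      integral (cbox 0 1) (\<lambda>t. partial_x f (x0, y0 + ?e t) / ?e t)) (at x0)"
    by (rule has_field_derivative_transform_within_open[OF d, of "ball x0 r"]) (use r all' in auto)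
  moreover have "cball y0 r \<subseteq> {z. (x0, z) \<in> U}" using all'[of x0] r by simp
  ultimately show ?thesis using r by auto
qed

lemma holo_on2_partial_x_slice:
  assumes "holo_on2 U f" "(x0, y0) \<in> U"
  shows "(\<lambda>y. partial_x f (x0, y)) field_differentiable at y0"
proof -
  have "(y0, x0) \<in> prod.swap -` U" using assms(2) by simp
  from holo_on2_partial_y_slice[OF holo_on2_swap[OF assms(1)] this]
  show ?thesis unfolding field_differentiable_def by (auto simp: partial_swap)
qed

text \<open>By \<open>osgood\<close>: in x the derivative passes under the integral, in y it is the
  derivative of a holomorphic function of one variable.\<close>

lemma holo_on2_partial_y:
  assumes "holo_on2 U f" shows "holo_on2 U (partial_y f)"
proof (rule osgood)
  show "open U" using assms unfolding holo_on2_def by blast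
  show "continuous_on U (partial_y f)" by (rule holo_on2_partial_y_continuous[OF assms])
  fix x y assume xy: "(x, y) \<in> U"
  show "(\<lambda>z. partial_y f (z, y)) field_differentiable at x"
    using holo_on2_partial_y_slice[OF assms xy] unfolding field_differentiable_def by blast
  have o: "open {z. (x, z) \<in> U}"
    using open_vimage[OF \<open>open U\<close>, of "\<lambda>z. (x, z)"] by (simp add: vimage_def continuous_on_Pair)
  have "(\<lambda>z. f (x, z)) holomorphic_on {z. (x, z) \<in> U}"
    unfolding holomorphic_on_def field_differentiable_def
    using holo_on2_slices(2)[OF assms] by (blast intro: has_field_derivative_at_within)
  then have "deriv (\<lambda>z. f (x, z)) holomorphic_on {z. (x, z) \<in> U}" using o by (rule holomorphic_deriv)
  then have "deriv (\<lambda>z. f (x, z)) field_differentiable at y"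
    using o xy holomorphic_on_imp_differentiable_at by blast
  moreover have "deriv (\<lambda>z. f (x, z)) = (\<lambda>z. partial_y f (x, z))" by (simp add: partial_y_def fun_eq_iff)
  ultimately show "(\<lambda>z. partial_y f (x, z)) field_differentiable at y" by simp
qed

lemma holo2_partial_y: "holo2_at f p \<Longrightarrow> holo2_at (partial_y f) p"
  unfolding holo2_at_on2 using holo_on2_partial_y by blast

lemma holo2_partial_x:
  assumes "holo2_at f p" shows "holo2_at (partial_x f) p"
proof -
  have "holo2_at (partial_y (\<lambda>q. f (snd q, fst q))) (snd p, fst p)"
    by (rule holo2_partial_y[OF holo2_swap[OF assms]])
  from holo2_swap[OF this] show ?thesis by (simp add: partial_swap)
qed

lemma partial_commute:
  assumes "holo2_at f p" shows "partial_x (partial_y f) p = partial_y (partial_x f) p"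
proof -
  obtain U where U: "p \<in> U" "holo_on2 U f" using assms unfolding holo2_at_on2 by blast
  obtain x0 y0 where p: "p = (x0, y0)" by (cases p)
  obtain r where r: "r > 0" "((\<lambda>x. partial_y f (x, y0)) has_field_derivative
      integral {0..1} (\<lambda>t. partial_x f (x0, y0 + of_real r * cis (2 * pi * t)) / (of_real r * cis (2 * pi * t)))) (at x0)"
    "cball y0 r \<subseteq> {z. (x0, z) \<in> U}"
    using holo_on2_partial_y_slice[OF U(2)] U(1) p by blast
  have "(\<lambda>z. partial_x f (x0, z)) holomorphic_on cball y0 r"
    unfolding holomorphic_on_def
    using holo_on2_partial_x_slice[OF U(2)] r(3) by (blast intro: field_differentiable_at_within)
  then have "continuous_on (cball y0 r) (\<lambda>z. partial_x f (x0, z))" "(\<lambda>z. partial_x f (x0, z)) holomorphic_on ball y0 r"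
    by (auto intro: holomorphic_on_imp_continuous_on holomorphic_on_subset)
  from deriv_circle_mean[OF this r(1)] DERIV_imp_deriv[OF r(2)]
  show ?thesis unfolding p partial_x_def[of "partial_y f"] partial_y_def[of "partial_x f"] by simp
qed

section \<open>Smooth curves in the plane\<close>

text \<open>The inverse function theorem applied to the map that sends (p, t) to (p, F (p, t)); g is
  the last component of the inverse at (p, 0). Its derivative is found by differentiating F (p, g p)
  = 0.\<close>

lemma implicit_function:
  fixes F :: "point \<times> complex \<Rightarrow> complex"
  assumes U: "open U" and p0: "(p0, t0) \<in> U"
    and F: "\<And>q. q \<in> U \<Longrightarrow> (F has_derivative (\<lambda>v. Fx q * fst (fst v) + Fy q * snd (fst v) + Ft q * snd v)) (at q)"
    and cont: "continuous_on U Fx" "continuous_on U Fy" "continuous_on U Ft"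
    and F0: "F (p0, t0) = 0" and Ft0: "Ft (p0, t0) \<noteq> 0"
  shows "\<exists>V W g. p0 \<in> V \<and> open W \<and> t0 \<in> W \<and> holo_on2 V g \<and>
     (\<forall>p\<in>V. g p \<in> W \<and> (\<forall>t\<in>W. F (p, t) = 0 \<longleftrightarrow> t = g p))"
proof -
  define f where "f q = (fst q, F q)" for q :: "point \<times> complex"
  define D where "D q v = (fst v, Fx q * fst (fst v) + Fy q * snd (fst v) + Ft q * snd v)"
    for q v :: "point \<times> complex"
  have blD: "bounded_linear (D q)" for q
    unfolding D_def linear_conv_bounded_linear[symmetric]
    by (rule linearI) (simp_all add: algebra_simps scaleR_prod_def)
  define f' where "f' q = Blinfun (D q)" for q
  have f': "blinfun_apply (f' q) = D q" for q
    unfolding f'_def by (rule bounded_linear_Blinfun_apply[OF blD])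
  \<comment> \<open>The inverse of \<open>D (p0, t0)\<close>: solve for the last coordinate, which
    needs \<open>Ft (p0, t0)\<close> nonzero.\<close>
  define J where "J v = (fst v, (snd v - Fx (p0, t0) * fst (fst v) - Fy (p0, t0) * snd (fst v)) / Ft (p0, t0))"
    for v :: "point \<times> complex"
  have blJ: "bounded_linear J"
    unfolding J_def linear_conv_bounded_linear[symmetric]
    by (rule linearI) (simp_all add: algebra_simps diff_divide_distrib add_divide_distrib scaleR_conv_of_real)
  have J: "blinfun_apply (Blinfun J) = J" by (rule bounded_linear_Blinfun_apply[OF blJ])
  have derf: "(f has_derivative blinfun_apply (f' q)) (at q)" if "q \<in> U" for q
    unfolding f_def f' D_def
    by (rule has_derivative_Pair[OF has_derivative_fst[OF has_derivative_ident] F[OF that]])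
  have contf: "continuous_on U f'"
    by (rule continuous_on_blinfun_componentwise)
      (unfold f' D_def, intro continuous_intros cont)
  have inv: "Blinfun J o\<^sub>L f' (p0, t0) = id_blinfun"
    by (rule blinfun_eqI) (use Ft0 in \<open>auto simp: J f' D_def J_def\<close>)
  obtain U' V' G G' where G: "open U'" "U' \<subseteq> U" "(p0, t0) \<in> U'" "open V'" "f (p0, t0) \<in> V'"
    "homeomorphism U' V' f G"
    "\<And>y. y \<in> V' \<Longrightarrow> (G has_derivative G' y) (at y)"
    "\<And>y. y \<in> V' \<Longrightarrow> bij (blinfun_apply (f' (G y)))"
    using inverse_function_theorem[OF U derf contf p0 inv] by metis
  have GV: "G y \<in> U'" "f (G y) = y" if "y \<in> V'" for y
    using G(6) that unfolding homeomorphism_def by auto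
  have Gf: "G (f q) = q" if "q \<in> U'" for q using G(6) that unfolding homeomorphism_def by auto
  have fV: "f q \<in> V'" if "q \<in> U'" for q using G(6) that unfolding homeomorphism_def by auto
  have contG: "continuous_on V' G" using G(6) unfolding homeomorphism_def by auto
  obtain A W where AW: "open A" "open W" "(p0, t0) \<in> A \<times> W" "A \<times> W \<subseteq> U'"
    using open_prod_elim[OF G(1,3)] by metis
  define g where "g p = snd (G (p, 0))" for p
  have oV: "open (V' \<inter> G -` (A \<times> W))"
    using continuous_on_open_vimage[OF G(4), of G] contG AW(1,2) by (metis open_Times Int_commute)
  define V where "V = A \<inter> (\<lambda>p. (p, 0)) -` (V' \<inter> G -` (A \<times> W))"
  have "open V" unfolding V_def
    by (rule open_Int[OF AW(1) open_vimage[OF oV]]) (intro continuous_intros)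
  have p0V: "p0 \<in> V" using AW(3) G(5) Gf[OF G(3)] F0 by (auto simp: V_def f_def)
  have V: "p \<in> A" "(p, 0) \<in> V'" "G (p, 0) \<in> A \<times> W" if "p \<in> V" for p using that by (auto simp: V_def)
  have Gp: "G (p, 0) = (p, g p)" "F (p, g p) = 0" if "p \<in> V" for p
  proof -
    have "f (G (p, 0)) = (p, 0)" using GV(2) V(2)[OF that] by blast
    then show "G (p, 0) = (p, g p)" unfolding g_def f_def by (metis Pair_inject prod.collapse)
    then show "F (p, g p) = 0" using \<open>f (G (p, 0)) = (p, 0)\<close> by (simp add: f_def)
  qed
  have uniq: "F (p, t) = 0 \<longleftrightarrow> t = g p" if "p \<in> V" "t \<in> W" for p t
  proof
    assume "F (p, t) = 0"
    then have "f (p, t) = (p, 0)" by (simp add: f_def)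
    moreover have "(p, t) \<in> U'" using V(1)[OF that(1)] that(2) AW(4) by blast
    ultimately have "G (p, 0) = (p, t)" using Gf by metis
    then show "t = g p" by (simp add: g_def)
  qed (use Gp that in simp)
  have gW: "g p \<in> W" if "p \<in> V" for p using V(3)[OF that] Gp(1)[OF that] by simp
  have "hasd g (- Fx (p, g p) / Ft (p, g p)) (- Fy (p, g p) / Ft (p, g p)) p" if p: "p \<in> V" for p
  proof -
    have inU: "(p, g p) \<in> U" using GV(1)[OF V(2)[OF p]] Gp(1)[OF p] G(2) by auto
    \<comment> \<open>At the other points \<open>Ft\<close> is nonzero because the inverse function
      theorem keeps the derivative bijective there, while \<open>Ft = 0\<close> would send (0, 1) to
      0.\<close>
    have "bij (D (p, g p))" using G(8)[OF V(2)[OF p]] Gp(1)[OF p] f' by simp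
    from inj_eq[OF bij_is_inj[OF this], of "(0, 1)" "(0, 0)"]
    have "D (p, g p) (0, 1) \<noteq> D (p, g p) (0, 0)" by simp
    then have Ft: "Ft (p, g p) \<noteq> 0" by (auto simp: D_def)
    define L where "L v = snd (G' (p, 0) (v, 0))" for v
    have "((\<lambda>p. (p, 0::complex)) has_derivative (\<lambda>v. (v, 0))) (at p)"
      by (rule has_derivative_Pair[OF has_derivative_ident has_derivative_const])
    from has_derivative_compose[OF this G(7)[OF V(2)[OF p]]]
    have "((\<lambda>p. G (p, 0)) has_derivative (\<lambda>v. G' (p, 0) (v, 0))) (at p)" .
    from has_derivative_snd[OF this]
    have g: "(g has_derivative L) (at p)" by (simp add: g_def[abs_def] L_def[abs_def])
    from has_derivative_compose[OF has_derivative_Pair[OF has_derivative_ident g] F[OF inU]]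
    have d: "((\<lambda>p. F (p, g p)) has_derivative (\<lambda>v. Fx (p, g p) * fst v + Fy (p, g p) * snd v + Ft (p, g p) * L v)) (at p)"
      by simp
    have "((\<lambda>p. F (p, g p)) has_derivative (\<lambda>v. 0)) (at p)"
      by (rule has_derivative_transform_within_open[OF has_derivative_const \<open>open V\<close> p]) (use Gp in auto)
    then have "(\<lambda>v. Fx (p, g p) * fst v + Fy (p, g p) * snd v + Ft (p, g p) * L v) = (\<lambda>v. 0)"
      using d has_derivative_unique by blast
    then have "Fx (p, g p) * fst v + Fy (p, g p) * snd v + Ft (p, g p) * L v = 0" for v by meson
    then have "L v = - Fx (p, g p) / Ft (p, g p) * fst v + - Fy (p, g p) / Ft (p, g p) * snd v" for v
    proof -
      have "Ft (p, g p) * L v = - (Fx (p, g p) * fst v + Fy (p, g p) * snd v)"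
        using \<open>\<And>v. Fx (p, g p) * fst v + Fy (p, g p) * snd v + Ft (p, g p) * L v = 0\<close>[of v] by (rule add_eq_0_iff[THEN iffD1])
      then show ?thesis using Ft by (simp add: field_simps)
    qed
    then show ?thesis using g unfolding hasd_def by (metis (no_types, lifting) ext)
  qed
  then have "holo_on2 V g" unfolding holo_on2_def using \<open>open V\<close> by blast
  then show ?thesis using p0V AW(2,3) gW uniq by blast
qed

text \<open>Solving h (x, y) = s for y gives coordinates in which the curve h = 0 is the axis s = 0;
  (X, Y) is the chart and (\<alpha>, h) its inverse.\<close>

lemma straighten_y:
  assumes h: "holo2_at h p" "h p = 0" "partial_y h p \<noteq> 0"
  shows "\<exists>X Y \<alpha>. holo2_at X 0 \<and> holo2_at Y 0 \<and> X 0 = fst p \<and> Y 0 = snd p \<and> holo2_at \<alpha> p \<and> \<alpha> p = 0 \<and>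
    (\<forall>\<^sub>F q in nhds 0. h (X q, Y q) = snd q) \<and>
    (\<forall>\<^sub>F q in nhds p. X (\<alpha> q, h q) = fst q \<and> Y (\<alpha> q, h q) = snd q)"
proof -
  obtain x0 y0 where p: "p = (x0, y0)" by (cases p)
  obtain U where U: "p \<in> U" "holo_on2 U h" using h(1) unfolding holo2_at_on2 by blast
  define c where "c q = (fst (fst q), snd q)" for q :: "point \<times> complex"
  define F where "F q = h (c q) - snd (fst q)" for q :: "point \<times> complex"
  have cc: "continuous_on A c" for A unfolding c_def by (intro continuous_intros)
  have oU: "open (c -` U)" using U(2) cc by (intro open_vimage) (auto simp: holo_on2_def)
  have dF: "(F has_derivative (\<lambda>v. partial_x h (c q) * fst (fst v) + (- 1) * snd (fst v) + partial_y h (c q) * snd v)) (at q)"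
    if "q \<in> c -` U" for q
  proof -
    have "(c has_derivative (\<lambda>v. (fst (fst v), snd v))) (at q)" unfolding c_def
      by (intro has_derivative_Pair has_derivative_fst has_derivative_snd has_derivative_ident)
    moreover have "(h has_derivative (\<lambda>v. partial_x h (c q) * fst v + partial_y h (c q) * snd v)) (at (c q))"
      using holo2_hasd[OF holo_on2_at[OF U(2)], of "c q"] that unfolding hasd_def by simp
    ultimately have "((\<lambda>q. h (c q)) has_derivative (\<lambda>v. partial_x h (c q) * fst (fst v) + partial_y h (c q) * snd v)) (at q)"
      using has_derivative_compose by fastforce
    from has_derivative_diff[OF this has_derivative_snd[OF has_derivative_fst[OF has_derivative_ident]]]
    show ?thesis unfolding F_def by (simp add: algebra_simps)
  qed
  have "\<exists>V W g. (x0, 0) \<in> V \<and> open W \<and> y0 \<in> W \<and> holo_on2 V g \<and>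
     (\<forall>p\<in>V. g p \<in> W \<and> (\<forall>t\<in>W. F (p, t) = 0 \<longleftrightarrow> t = g p))"
  proof (rule implicit_function[OF oU _ dF])
    show "continuous_on (c -` U) (\<lambda>q. partial_x h (c q))"
      by (rule continuous_on_compose2[OF holo_on2_partial_x_continuous[OF U(2)] cc]) auto
    show "continuous_on (c -` U) (\<lambda>q. partial_y h (c q))"
      by (rule continuous_on_compose2[OF holo_on2_partial_y_continuous[OF U(2)] cc]) auto
  qed (use U h p in \<open>auto simp: c_def F_def\<close>)
  then obtain V W g where g: "(x0, 0) \<in> V" "open W" "y0 \<in> W" "holo_on2 V g"
     "\<And>p. p \<in> V \<Longrightarrow> g p \<in> W" "\<And>p t. p \<in> V \<Longrightarrow> t \<in> W \<Longrightarrow> F (p, t) = 0 \<longleftrightarrow> t = g p" by blast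
  have Fe: "F ((x, s), y) = h (x, y) - s" for x y s by (simp add: F_def c_def)
  have oV: "open V" using g(4) unfolding holo_on2_def by blast
  define X where "X q = fst q + x0" for q :: point
  define Y where "Y q = g (X q, snd q)" for q
  define \<alpha> where "\<alpha> q = fst q - x0" for q :: point
  have X: "holo2_at X q" for q unfolding X_def by (intro holo2_add holo2_const holo2_fst)
  have Y: "holo2_at Y 0" unfolding Y_def
    by (rule holo2_chain[OF holo_on2_at[OF g(4)] X holo2_snd]) (use g(1) in \<open>simp add: X_def\<close>)
  have a: "holo2_at \<alpha> p" unfolding \<alpha>_def by (intro holo2_diff holo2_const holo2_fst)
  have e1: "\<forall>\<^sub>F q in nhds 0. (X q, snd q) \<in> V"
  proof -
    have "((\<lambda>q. (X q, snd q)) \<longlongrightarrow> (X 0, snd (0 :: point))) (nhds 0)"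
      by (rule tendsto_Pair[OF holo2_tendsto[OF X] holo2_tendsto[OF holo2_snd]])
    then show ?thesis by (rule topological_tendstoD[OF _ oV]) (use g(1) in \<open>simp add: X_def\<close>)
  qed
  have e2: "\<forall>\<^sub>F q in nhds p. (fst q, h q) \<in> V \<and> snd q \<in> W"
  proof (rule eventually_conj)
    have "((\<lambda>q. (fst q, h q)) \<longlongrightarrow> (fst p, h p)) (nhds p)"
      by (intro tendsto_Pair holo2_tendsto h holo2_fst)
    then show "\<forall>\<^sub>F q in nhds p. (fst q, h q) \<in> V"
      by (rule topological_tendstoD[OF _ oV]) (use g(1) p h in simp)
    show "\<forall>\<^sub>F q in nhds p. snd q \<in> W"
      by (rule topological_tendstoD[OF holo2_tendsto[OF holo2_snd] g(2)]) (use g(3) p in simp)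
  qed
  have "\<forall>\<^sub>F q in nhds 0. h (X q, Y q) = snd q"
    using e1
  proof eventually_elim
    case (elim q)
    then have "F ((X q, snd q), Y q) = 0" using g(5,6) unfolding Y_def by blast
    then show ?case unfolding Fe by simp
  qed
  moreover have "\<forall>\<^sub>F q in nhds p. X (\<alpha> q, h q) = fst q \<and> Y (\<alpha> q, h q) = snd q"
    using e2
  proof eventually_elim
    case (elim q)
    then have "snd q = g (fst q, h q)" using g(6)[of "(fst q, h q)" "snd q"] unfolding Fe by simp
    then show ?case by (simp add: X_def Y_def \<alpha>_def)
  qed
  moreover have "Y 0 = snd p"
    using g(6)[OF g(1,3)] h(2) unfolding Fe by (simp add: Y_def X_def p)
  ultimately show ?thesis using X Y a p
    by (intro exI[of _ X] exI[of _ Y] exI[of _ \<alpha>]) (simp add: X_def \<alpha>_def)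
qed

lemma straighten:
  assumes h: "holo2_at h p" "h p = 0" "(partial_x h p, partial_y h p) \<noteq> 0"
  shows "\<exists>X Y \<alpha>. holo2_at X 0 \<and> holo2_at Y 0 \<and> X 0 = fst p \<and> Y 0 = snd p \<and> holo2_at \<alpha> p \<and> \<alpha> p = 0 \<and>
    (\<forall>\<^sub>F q in nhds 0. h (X q, Y q) = snd q) \<and>
    (\<forall>\<^sub>F q in nhds p. X (\<alpha> q, h q) = fst q \<and> Y (\<alpha> q, h q) = snd q)"
proof (cases "partial_y h p = 0")
  case False then show ?thesis using straighten_y h by blast
next
  case True
  then have px: "partial_x h p \<noteq> 0" using h(3) by (simp add: zero_prod_def)
  let ?h = "\<lambda>q. h (snd q, fst q)" and ?p = "(snd p, fst p)"
  have "partial_y ?h ?p \<noteq> 0" using px by (simp add: partial_swap)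
  with straighten_y[OF holo2_swap[OF h(1)], OF _ this] h(2)
  obtain X Y \<alpha> where *: "holo2_at X 0" "holo2_at Y 0" "X 0 = snd p" "Y 0 = fst p" "holo2_at \<alpha> ?p" "\<alpha> ?p = 0"
    "\<forall>\<^sub>F q in nhds 0. h (Y q, X q) = snd q"
    "\<forall>\<^sub>F q in nhds ?p. X (\<alpha> q, h (snd q, fst q)) = fst q \<and> Y (\<alpha> q, h (snd q, fst q)) = snd q"
    by auto
  have "holo2_at (\<lambda>q. \<alpha> (snd q, fst q)) p" using holo2_swap[OF *(5)] by simp
  moreover have "\<forall>\<^sub>F q in nhds p. Y (\<alpha> (snd q, fst q), h q) = fst q \<and> X (\<alpha> (snd q, fst q), h q) = snd q"
  proof -
    have "filterlim (\<lambda>q. (snd q, fst q)) (nhds ?p) (nhds p)"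
      by (intro tendsto_Pair holo2_tendsto holo2_fst holo2_snd)
    from eventually_compose_filterlim[OF *(8) this] show ?thesis by (rule eventually_mono) simp
  qed
  ultimately show ?thesis using *(1-4,6,7)
    by (intro exI[of _ Y] exI[of _ X] exI[of _ "\<lambda>q. \<alpha> (snd q, fst q)"]) simp
qed

section \<open>Division and factorization along a smooth curve\<close>

lemma chart_filterlim:
  assumes "holo2_at X 0" "holo2_at Y 0" "X 0 = fst p" "Y 0 = snd p"
  shows "filterlim (\<lambda>q. (X q, Y q)) (nhds p) (nhds 0)"
  using tendsto_Pair[OF holo2_tendsto[OF assms(1)] holo2_tendsto[OF assms(2)]] assms(3,4) by simp

lemma chart_inv_filterlim:
  assumes "holo2_at \<alpha> p" "\<alpha> p = 0" "holo2_at h p" "h p = 0"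
  shows "filterlim (\<lambda>q. (\<alpha> q, h q)) (nhds 0) (nhds p)"
  using tendsto_Pair[OF holo2_tendsto[OF assms(1)] holo2_tendsto[OF assms(3)]] assms(2,4)
  by (simp add: zero_prod_def)


text \<open>The quotient G / s is completed on s = 0 by \<open>partial_y G\<close>. It is continuous
  by the mean value inequality and separately holomorphic, by removal of the singularity in the
  second variable, so that \<open>osgood\<close> applies.\<close>

lemma divide_snd:
  assumes G: "holo2_at G 0" and z: "\<forall>\<^sub>F q in nhds 0. snd q = 0 \<longrightarrow> G q = 0"
  shows "\<exists>c. holo2_at c 0 \<and> (\<forall>\<^sub>F q in nhds 0. G q = snd q * c q)"
proof -
  obtain U where U: "0 \<in> U" "holo_on2 U G" using G unfolding holo2_at_on2 by blast
  obtain V where V: "open V" "0 \<in> V" "\<And>q. q \<in> V \<Longrightarrow> snd q = 0 \<Longrightarrow> G q = 0"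
    using z unfolding eventually_nhds by blast
  have "open (U \<inter> V)" using U V unfolding holo_on2_def by blast
  then obtain A B where AB: "open A" "open B" "0 \<in> A \<times> B" "A \<times> B \<subseteq> U \<inter> V"
    using open_prod_elim[of "U \<inter> V" 0] U(1) V(2) by blast
  obtain r1 r2 where r12: "r1 > 0" "ball 0 r1 \<subseteq> A" "r2 > 0" "ball 0 r2 \<subseteq> B"
    using AB open_contains_ball by (metis mem_Times_iff fst_zero snd_zero)
  define N where "N = ball (0::complex) r1 \<times> ball (0::complex) r2"
  have N: "open N" "0 \<in> N" "N \<subseteq> U" "N \<subseteq> V"
    using AB(4) r12 by (auto simp: N_def open_Times zero_prod_def)
  have NG: "holo_on2 N G" using U(2) N unfolding holo_on2_def by blast
  note pyc = holo_on2_partial_y_continuous[OF NG]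
  have G0: "G (x, 0) = 0" if "(x, 0) \<in> N" for x using V(3)[of "(x, 0)"] N(4) that by auto
  define c where "c q = (if snd q = 0 then partial_y G q else G q / snd q)" for q
  have "holo_on2 N c"
  proof (rule osgood[OF N(1)])
    have lim: "isCont c (x0, 0)" if x0: "(x0, 0) \<in> N" for x0
      unfolding continuous_at_eps_delta
    proof (intro allI impI)
      fix e :: real assume e: "e > 0"
      have "isCont (partial_y G) (x0, 0)" using continuous_on_eq_continuous_at[OF N(1)] pyc x0 by blast
      then obtain d where d: "d > 0" "\<And>q. dist q (x0, 0) < d \<Longrightarrow> dist (partial_y G q) (partial_y G (x0, 0)) < e / 2"
        unfolding continuous_at_eps_delta using half_gt_zero[OF e] by (metis dist_commute)
      obtain d' where d': "d' > 0" "ball (x0, 0) d' \<subseteq> N" using N(1) x0 open_contains_ball by meson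
      have "dist (c q) (c (x0, 0)) < e" if q: "dist q (x0, 0) < min d d'" for q
      proof -
        obtain x s where xs: "q = (x, s)" by (cases q)
        show ?thesis
        proof (cases "s = 0")
          case True then show ?thesis using d(2)[of q] q e by (simp add: c_def xs)
        next
          case False
          let ?L = "partial_y G (x0, 0)"
          have near: "dist (x, z) (x0, 0) < min d d'" if "z \<in> closed_segment 0 s" for z
          proof -
            have "norm z \<le> norm s" using that segment_bound(1)[of z 0 s] by simp
            then have "dist (x, z) (x0, 0) \<le> dist (x, s) (x0, 0)"
              unfolding dist_Pair_Pair by (intro real_sqrt_le_mono add_left_mono power_mono) auto
            then show ?thesis using q xs by simp
          qed
          \<comment> \<open>Subtracting the linear function \<open>z * ?L\<close> leaves a
            derivative of size at most e / 2 along the segment. As G vanishes at its start, the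
            estimate can be divided by s.\<close>
          have "norm ((G (x, s) - s * ?L) - (G (x, 0) - 0 * ?L)) \<le> e / 2 * norm (s - 0)"
          proof (rule field_differentiable_bound[OF convex_closed_segment[of 0 s], where f = "\<lambda>z. G (x, z) - z * ?L" and f' = "\<lambda>z. partial_y G (x, z) - ?L"])
            fix z assume z: "z \<in> closed_segment 0 s"
            then have "(x, z) \<in> N" using near[OF z] d'(2) by (auto simp: dist_commute)
            from holo_on2_slices(2)[OF NG this]
            have "((\<lambda>z. G (x, z) - z * ?L) has_field_derivative partial_y G (x, z) - ?L) (at z)"
              by (auto intro!: derivative_eq_intros)
            then show "((\<lambda>z. G (x, z) - z * ?L) has_field_derivative partial_y G (x, z) - ?L) (at z within closed_segment 0 s)"
              by (rule has_field_derivative_at_within)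
            show "norm (partial_y G (x, z) - ?L) \<le> e / 2" using d(2)[of "(x, z)"] near[OF z] by (simp add: dist_norm)
          qed auto
          moreover have "(x, 0) \<in> N" using near[of 0] d'(2) by (auto simp: dist_commute)
          ultimately have "norm (G (x, s) - s * ?L) \<le> e / 2 * norm s" using G0 by simp
          moreover have "G (x, s) - s * ?L = s * (c q - c (x0, 0))" using False by (simp add: c_def xs algebra_simps)
          ultimately have "norm (c q - c (x0, 0)) \<le> e / 2" using False by (simp add: norm_mult mult.commute)
          then show ?thesis using e by (simp add: dist_norm)
        qed
      qed
      then show "\<exists>d>0. \<forall>x'. dist x' (x0, 0) < d \<longrightarrow> dist (c x') (c (x0, 0)) < e"
        using d(1) d'(1) by (intro exI[of _ "min d d'"]) auto
    qed
    have near: "\<forall>\<^sub>F q in nhds (x, s). c q = G q / snd q" if "s \<noteq> 0" for x s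
    proof -
      have "\<forall>\<^sub>F q in nhds (x, s). snd q \<noteq> 0" using holo2_eventually_ne[OF holo2_snd] that by simp
      then show ?thesis by eventually_elim (simp add: c_def)
    qed
    have holo: "holo2_at c (x, s)" if "(x, s) \<in> N" "s \<noteq> 0" for x s
    proof (rule holo2_cong[where f = "\<lambda>q. G q / snd q"])
      show "\<forall>\<^sub>F q in nhds (x, s). G q / snd q = c q" using near[OF that(2), of x] by eventually_elim simp
      show "holo2_at (\<lambda>q. G q / snd q) (x, s)"
        by (rule holo2_divide[OF holo_on2_at[OF NG that(1)] holo2_snd]) (use that in simp)
    qed
    show cont: "continuous_on N c"
    proof (rule continuous_at_imp_continuous_on, intro ballI)
      fix q assume "q \<in> N" then show "isCont c q"
        using lim holo2_isCont[OF holo] by (cases q; cases "snd q = 0") auto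
    qed
    fix x s assume xs: "(x, s) \<in> N"
    show "(\<lambda>z. c (z, s)) field_differentiable at x"
    proof (cases "s = 0")
      case True
      have "(\<lambda>z. partial_y G (z, s)) field_differentiable at x"
        using holo_on2_slices(1)[OF holo_on2_partial_y[OF NG] xs] unfolding field_differentiable_def by blast
      then show ?thesis using True by (simp add: c_def)
    next
      case False
      from hasd_slices(1)[OF holo2_hasd[OF holo[OF xs False]]] show ?thesis
        unfolding field_differentiable_def by auto
    qed
    have o: "open (ball 0 r2 :: complex set)" by simp
    have sl: "z \<in> ball 0 r2 \<Longrightarrow> (x, z) \<in> N" for z using xs by (simp add: N_def)
    have "(\<lambda>z. c (x, z)) holomorphic_on ball 0 r2"
    proof (rule no_isolated_singularity[where K = "{0}"])
      show "continuous_on (ball 0 r2) (\<lambda>z. c (x, z))"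
        by (rule continuous_on_compose2[OF cont]) (use sl in \<open>auto intro!: continuous_intros\<close>)
      have "(\<lambda>z. c (x, z)) field_differentiable at z" if "z \<in> ball 0 r2 - {0}" for z
        using hasd_slices(2)[OF holo2_hasd[OF holo[OF sl, of z]]] that
        unfolding field_differentiable_def by auto
      then show "(\<lambda>z. c (x, z)) holomorphic_on ball 0 r2 - {0}"
        unfolding holomorphic_on_def by (blast intro: field_differentiable_at_within)
    qed auto
    then show "(\<lambda>z. c (x, z)) field_differentiable at s"
      using xs holomorphic_on_imp_differentiable_at[OF _ o] by (simp add: N_def)
  qed
  then have "holo2_at c 0" using N(2) holo_on2_at by blast
  moreover have "\<forall>\<^sub>F q in nhds 0. G q = snd q * c q"
    using z by eventually_elim (auto simp: c_def)
  ultimately show ?thesis by blast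
qed

lemma divide_by_smooth:
  assumes h: "holo2_at h p" "h p = 0" "(partial_x h p, partial_y h p) \<noteq> 0"
    and g: "holo2_at g p" and z: "\<forall>\<^sub>F q in nhds p. h q = 0 \<longrightarrow> g q = 0"
  shows "\<exists>c. holo2_at c p \<and> (\<forall>\<^sub>F q in nhds p. g q = h q * c q)"
proof -
  obtain X Y \<alpha> where *: "holo2_at X 0" "holo2_at Y 0" "X 0 = fst p" "Y 0 = snd p" "holo2_at \<alpha> p" "\<alpha> p = 0"
    "\<forall>\<^sub>F q in nhds 0. h (X q, Y q) = snd q"
    "\<forall>\<^sub>F q in nhds p. X (\<alpha> q, h q) = fst q \<and> Y (\<alpha> q, h q) = snd q"
    using straighten[OF h] by blast
  note fl = chart_filterlim[OF *(1-4)] and fi = chart_inv_filterlim[OF *(5,6) h(1,2)]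
  have G: "holo2_at (\<lambda>q. g (X q, Y q)) 0"
    using holo2_chain[of g X 0 Y] g *(1-4) by simp
  have "\<forall>\<^sub>F q in nhds 0. snd q = 0 \<longrightarrow> g (X q, Y q) = 0"
    using eventually_compose_filterlim[OF z fl] *(7) by eventually_elim simp
  from divide_snd[OF G this] obtain c where c: "holo2_at c 0" "\<forall>\<^sub>F q in nhds 0. g (X q, Y q) = snd q * c q" by blast
  have "holo2_at (\<lambda>q. c (\<alpha> q, h q)) p"
    by (rule holo2_chain[OF _ *(5) h(1)]) (use c(1) *(6) h(2) in \<open>simp add: zero_prod_def\<close>)
  moreover have "\<forall>\<^sub>F q in nhds p. g q = h q * c (\<alpha> q, h q)"
    using eventually_compose_filterlim[OF c(2) fi] *(8) by eventually_elim simp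
  ultimately show ?thesis by blast
qed

text \<open>The complement of the curve is dense: in the straightened chart every point is a limit,
  along its vertical line, of points with nonzero second coordinate.\<close>

lemma zero_off_curve:
  assumes h: "holo2_at h p" "h p = 0" "(partial_x h p, partial_y h p) \<noteq> 0"
    and D: "holo2_at D p" and z: "\<forall>\<^sub>F q in nhds p. h q \<noteq> 0 \<longrightarrow> D q = 0"
  shows "\<forall>\<^sub>F q in nhds p. D q = 0"
proof -
  obtain X Y \<alpha> where *: "holo2_at X 0" "holo2_at Y 0" "X 0 = fst p" "Y 0 = snd p" "holo2_at \<alpha> p" "\<alpha> p = 0"
    "\<forall>\<^sub>F q in nhds 0. h (X q, Y q) = snd q"
    "\<forall>\<^sub>F q in nhds p. X (\<alpha> q, h q) = fst q \<and> Y (\<alpha> q, h q) = snd q"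
    using straighten[OF h] by blast
  note fl = chart_filterlim[OF *(1-4)] and fi = chart_inv_filterlim[OF *(5,6) h(1,2)]
  define G where "G q = D (X q, Y q)" for q
  have G: "holo2_at G 0" unfolding G_def
    using holo2_chain[of D X 0 Y] D *(1-4) by simp
  have "\<forall>\<^sub>F q in nhds 0. snd q \<noteq> 0 \<longrightarrow> G q = 0"
    unfolding G_def using eventually_compose_filterlim[OF z fl] *(7) by eventually_elim simp
  then have "\<forall>\<^sub>F q in nhds 0. \<forall>\<^sub>F q' in nhds q. snd q' \<noteq> 0 \<longrightarrow> G q' = 0" by (simp add: eventually_eventually)
  then have "\<forall>\<^sub>F q in nhds 0. G q = 0"
    using holo2_eventually[OF G]
  proof eventually_elim
    case (elim q)
    have "((\<lambda>s. (fst q, s)) \<longlongrightarrow> q) (at (snd q))"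
      using tendsto_Pair[OF tendsto_const tendsto_ident_at, of "fst q" "snd q" UNIV] by simp
    then have lim: "filterlim (\<lambda>s. (fst q, s)) (nhds q) (at (snd q))" .
    have "((\<lambda>s. G (fst q, s)) \<longlongrightarrow> G q) (at (snd q))"
      using filterlim_compose[OF holo2_tendsto[OF elim(2)] lim] .
    moreover have "\<forall>\<^sub>F s in at (snd q). G (fst q, s) = 0"
    proof -
      have "\<forall>\<^sub>F s in at (snd q). s \<noteq> 0"
        using tendsto_imp_eventually_ne[OF tendsto_ident_at, of "snd q" 0 UNIV] 
        by (cases "snd q = 0") (auto simp: eventually_at_filter)
      then show ?thesis using eventually_compose_filterlim[OF elim(1) lim] by eventually_elim simp
    qed
    then have "((\<lambda>s. G (fst q, s)) \<longlongrightarrow> 0) (at (snd q))" by (rule tendsto_eventually)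
    ultimately show ?case using LIM_unique by blast
  qed
  from eventually_compose_filterlim[OF this fi] show ?thesis
    using *(8) unfolding G_def by eventually_elim simp
qed

text \<open>A smooth curve germ is irreducible: in a chart the restrictions to it are holomorphic
  functions of one variable on a disc, where the identity theorem excludes zero divisors.\<close>

lemma product_zero_on_curve:
  assumes h: "holo2_at h p" "h p = 0" "(partial_x h p, partial_y h p) \<noteq> 0"
    and fg: "holo2_at f p" "holo2_at g p" and z: "\<forall>\<^sub>F q in nhds p. h q = 0 \<longrightarrow> f q * g q = 0"
  shows "(\<forall>\<^sub>F q in nhds p. h q = 0 \<longrightarrow> f q = 0) \<or> (\<forall>\<^sub>F q in nhds p. h q = 0 \<longrightarrow> g q = 0)"
proof -
  obtain X Y \<alpha> where *: "holo2_at X 0" "holo2_at Y 0" "X 0 = fst p" "Y 0 = snd p" "holo2_at \<alpha> p" "\<alpha> p = 0"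
    "\<forall>\<^sub>F q in nhds 0. h (X q, Y q) = snd q"
    "\<forall>\<^sub>F q in nhds p. X (\<alpha> q, h q) = fst q \<and> Y (\<alpha> q, h q) = snd q"
    using straighten[OF h] by blast
  note fl = chart_filterlim[OF *(1-4)]
  define S where "S f z = f (X (z, 0), Y (z, 0))" for f :: "point \<Rightarrow> complex" and z :: complex
  have hol: "\<exists>r>0. S f holomorphic_on ball 0 r" if "holo2_at f p" for f
  proof -
    have "holo2_at (\<lambda>q. f (X q, Y q)) 0" using holo2_chain[of f X 0 Y] that *(1-4) by simp
    from holo2_slices[OF this] show ?thesis unfolding S_def by auto
  qed
  have conv: "\<forall>\<^sub>F q in nhds p. h q = 0 \<longrightarrow> f q = 0" if ev: "\<forall>\<^sub>F z in nhds 0. S f z = 0" for f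
  proof -
    have "filterlim \<alpha> (nhds 0) (nhds p)" using holo2_tendsto[OF *(5)] *(6) by simp
    from eventually_compose_filterlim[OF ev this] show ?thesis
      using *(8) by eventually_elim (auto simp: S_def)
  qed
  have "filterlim (\<lambda>z. (z, 0::complex)) (nhds 0) (nhds (0::complex))"
    using tendsto_Pair[OF filterlim_ident tendsto_const, of "0::complex" "0::complex"] by (simp add: zero_prod_def)
  note lim0 = eventually_compose_filterlim[OF _ this]
  have "\<forall>\<^sub>F z in nhds 0. S f z * S g z = 0"
    using lim0[OF eventually_compose_filterlim[OF z fl]] lim0[OF *(7)]
    by eventually_elim (simp add: S_def)
  then obtain r0 where r0: "r0 > 0" "\<And>z. z \<in> ball 0 r0 \<Longrightarrow> S f z * S g z = 0"
    unfolding eventually_nhds_metric by (auto simp: dist_commute)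
  obtain r1 r2 where r12: "r1 > 0" "S f holomorphic_on ball 0 r1" "r2 > 0" "S g holomorphic_on ball 0 r2"
    using hol[OF fg(1)] hol[OF fg(2)] by blast
  define B where "B = ball (0::complex) (min r0 (min r1 r2))"
  have B: "open B" "connected B" "0 \<in> B" "S f holomorphic_on B" "S g holomorphic_on B"
    "\<And>z. z \<in> B \<Longrightarrow> S f z * S g z = 0"
    using r0 r12 by (auto simp: B_def elim: holomorphic_on_subset)
  have "(\<forall>z\<in>B. S f z = 0) \<or> (\<forall>z\<in>B. S g z = 0)"
  proof (rule disjCI)
    assume "\<not> (\<forall>z\<in>B. S g z = 0)"
    then obtain z0 where z0: "z0 \<in> B" "S g z0 \<noteq> 0" by blast
    have eq: "{z \<in> B. S g z \<noteq> 0} = B \<inter> S g -` (- {0})" by auto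
    have "open {z \<in> B. S g z \<noteq> 0}" unfolding eq
      using continuous_open_preimage[OF holomorphic_on_imp_continuous_on[OF B(5)] B(1) open_Compl[OF closed_singleton]] .
    have "S f z = 0" if "z \<in> B" for z
    proof (rule analytic_continuation_open[of "{z \<in> B. S g z \<noteq> 0}" B "S f" "\<lambda>_. 0" z])
      show "{z \<in> B. S g z \<noteq> 0} \<noteq> {}" "{z \<in> B. S g z \<noteq> 0} \<subseteq> B" using z0 by blast+
      show "S f w = 0" if "w \<in> {z \<in> B. S g z \<noteq> 0}" for w using B(6)[of w] that by simp
    qed (fact B that \<open>open {z \<in> B. S g z \<noteq> 0}\<close> | simp)+
    then show "\<forall>z\<in>B. S f z = 0" by blast
  qed
  moreover have "\<forall>\<^sub>F z in nhds 0. z \<in> B" using B(1,3) eventually_nhds by blast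
  ultimately have "(\<forall>\<^sub>F z in nhds 0. S f z = 0) \<or> (\<forall>\<^sub>F z in nhds 0. S g z = 0)"
    by (elim disjE) (blast intro: eventually_mono)+
  then show ?thesis using conv by blast
qed

text \<open>If E (x, 0) were not identically zero, then for small x \<noteq> 0 the function E (x, .)
  would have no zero in a disc. The maximum principle for its inverse would bound |E (x, 0)| from
  below by a constant independent of x, against continuity and E 0 = 0.\<close>

lemma no_isolated_zero:
  assumes E: "holo2_at E 0" "E 0 = 0" and z: "\<forall>\<^sub>F q in nhds 0. E q = 0 \<longrightarrow> snd q = 0"
  shows "\<forall>\<^sub>F q in nhds 0. snd q = 0 \<longrightarrow> E q = 0"
proof -
  obtain U where U: "0 \<in> U" "holo_on2 U E" using E(1) unfolding holo2_at_on2 by blast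
  obtain V where V: "open V" "0 \<in> V" "\<And>q. q \<in> V \<Longrightarrow> E q = 0 \<Longrightarrow> snd q = 0"
    using z unfolding eventually_nhds by blast
  have "open (U \<inter> V)" using U V unfolding holo_on2_def by blast
  then obtain A B where AB: "open A" "open B" "0 \<in> A \<times> B" "A \<times> B \<subseteq> U \<inter> V"
    using open_prod_elim[of "U \<inter> V" 0] U(1) V(2) by blast
  obtain r1 r2 where r12: "r1 > 0" "cball 0 r1 \<subseteq> A" "r2 > 0" "cball 0 r2 \<subseteq> B"
    using AB open_contains_cball by (metis mem_Times_iff fst_zero snd_zero)
  define R where "R = min r1 r2"
  have R: "R > 0" "\<And>x s. x \<in> cball 0 R \<Longrightarrow> s \<in> cball 0 R \<Longrightarrow> (x, s) \<in> U \<and> (x, s) \<in> V"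
    using AB(4) r12 by (auto simp: R_def subset_iff)
  let ?e = "\<lambda>z. E (z, 0)"
  have sx: "?e holomorphic_on ball 0 R"
  proof -
    have "?e field_differentiable at x" if "x \<in> ball 0 R" for x
      using holo_on2_slices(1)[OF U(2)] R(2)[of x 0] R(1) that unfolding field_differentiable_def by auto
    then show ?thesis unfolding holomorphic_on_def by (blast intro: field_differentiable_at_within)
  qed
  show ?thesis
  proof (cases "\<forall>x\<in>ball 0 R. ?e x = 0")
    case True
    have "\<forall>\<^sub>F q in nhds (0 :: point). fst q \<in> ball 0 R"
      by (rule topological_tendstoD[OF holo2_tendsto[OF holo2_fst]]) (use R(1) in auto)
    then show ?thesis
    proof eventually_elim
      case (elim q) then show ?case using True by (cases q) auto
    qed
  next
    case False
    then obtain b where b: "b \<in> ball 0 R" "?e b \<noteq> 0" by blast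
    have e0: "?e 0 = 0" using E(2) by (simp add: zero_prod_def)
    have "\<exists>r>0. \<forall>x\<in>ball 0 r - {0}. ?e x \<noteq> 0"
      by (rule isolated_zeros[OF sx open_ball connected_ball _ e0 b]) (use R(1) in auto)
    then obtain r where r: "r > 0" "\<And>x. x \<in> ball 0 r - {0} \<Longrightarrow> ?e x \<noteq> 0" by blast
    \<comment> \<open>On this compact set the second coordinate is nonzero, so E has no zero there
      and |E| has a positive minimum.\<close>
    have "continuous_on (cball 0 R \<times> sphere 0 R) (\<lambda>q. norm (E q))"
      by (intro continuous_on_norm continuous_on_subset[OF holo_on2_continuous[OF U(2)]]) (use R in auto)
    moreover have "compact (cball (0::complex) R \<times> sphere (0::complex) R)" by (intro compact_Times) auto
    moreover have "cball (0::complex) R \<times> sphere (0::complex) R \<noteq> {}"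
      using R(1) by (auto simp: not_less sphere_eq_empty)
    ultimately obtain q0 where q0: "q0 \<in> cball 0 R \<times> sphere 0 R"
      "\<And>q. q \<in> cball 0 R \<times> sphere 0 R \<Longrightarrow> norm (E q0) \<le> norm (E q)"
      using continuous_attains_inf by (metis (no_types, lifting))
    define \<delta> where "\<delta> = norm (E q0)"
    have \<delta>: "\<delta> > 0"
    proof -
      have "fst q0 \<in> cball 0 R" "snd q0 \<in> cball 0 R" "snd q0 \<noteq> 0" using q0(1) R(1) by auto
      then have "q0 \<in> V" "snd q0 \<noteq> 0" using R(2)[of "fst q0" "snd q0"] by simp_all
      then show ?thesis using V(3)[of q0] by (auto simp: \<delta>_def)
    qed
    have low: "norm (?e x) \<ge> \<delta>" if x: "x \<in> ball 0 (min r R) - {0}" for x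
    proof -
      have ne: "E (x, s) \<noteq> 0" if "s \<in> cball 0 R" for s
        using V(3)[of "(x, s)"] R(2)[OF _ that, of x] r(2)[of x] x by (cases "s = 0") auto
      have "(\<lambda>s. E (x, s)) field_differentiable at s" if "s \<in> cball 0 R" for s
        using holo_on2_slices(2)[OF U(2)] R(2)[OF _ that, of x] x unfolding field_differentiable_def by auto
      then have "(\<lambda>s. E (x, s)) holomorphic_on cball 0 R"
        unfolding holomorphic_on_def by (blast intro: field_differentiable_at_within)
      then have hol: "(\<lambda>s. inverse (E (x, s))) holomorphic_on cball 0 R"
        by (rule holomorphic_on_inverse) (use ne in auto)
      have "norm (inverse (E (x, 0))) \<le> inverse \<delta>"
      proof (rule maximum_modulus_frontier[of "\<lambda>s. inverse (E (x, s))" "cball 0 R"])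
        show "(\<lambda>s. inverse (E (x, s))) holomorphic_on interior (cball 0 R)"
          using hol by (rule holomorphic_on_subset) (simp add: interior_subset)
        show "continuous_on (closure (cball 0 R)) (\<lambda>s. inverse (E (x, s)))"
          using holomorphic_on_imp_continuous_on[OF hol] by simp
        fix s :: complex assume "s \<in> frontier (cball 0 R)"
        then have s: "s \<in> sphere 0 R" using R(1) by simp
        then have "\<delta> \<le> norm (E (x, s))" using q0(2)[of "(x, s)"] x by (simp add: \<delta>_def)
        then show "norm (inverse (E (x, s))) \<le> inverse \<delta>"
          unfolding norm_inverse by (rule le_imp_inverse_le) (rule \<delta>)
      qed (use R(1) in auto)
      then show ?thesis using \<delta> ne[of 0] R(1) unfolding norm_inverse by simp
    qed
    have "((\<lambda>x. norm (?e x)) \<longlongrightarrow> norm (E 0)) (at 0)"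
    proof (rule tendsto_norm)
      have "filterlim (\<lambda>z. (z, 0::complex)) (nhds 0) (at (0::complex))"
        unfolding zero_prod_def by (intro tendsto_Pair tendsto_ident_at tendsto_const)
      from filterlim_compose[OF holo2_tendsto[OF E(1)] this] show "(?e \<longlongrightarrow> E 0) (at 0)" .
    qed
    moreover have "\<forall>\<^sub>F x in at 0. \<delta> \<le> norm (?e x)"
      unfolding eventually_at using low r(1) R(1) by (intro exI[of _ "min r R"]) (auto simp: dist_norm)
    ultimately have "\<delta> \<le> norm (E 0)" using tendsto_lowerbound at_neq_bot by blast
    then show ?thesis using \<delta> E(2) by simp
  qed
qed

text \<open>The order n of E (0, s) at s = 0 bounds the number of divisions by \<open>snd\<close>:
  each lowers it by one, and at n = 0 the function is a unit.\<close>

lemma factor_snd_aux: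
  assumes "holo2_at E 0" "\<forall>\<^sub>F q in nhds 0. E q = 0 \<longrightarrow> snd q = 0"
    "isCont u 0" "u 0 \<noteq> 0" "\<forall>\<^sub>F s in at 0. E (0, s) = s ^ n * u s"
  shows "\<exists>m c. holo2_at c 0 \<and> c 0 \<noteq> 0 \<and> (\<forall>\<^sub>F q in nhds 0. E q = snd q ^ m * c q)"
  using assms
proof (induction n arbitrary: E)
  case E: (0 E)
  have lim: "filterlim (\<lambda>z. (0::complex, z)) (nhds 0) (at (0::complex))"
    using tendsto_Pair[OF tendsto_const tendsto_ident_at, of "0::complex" "0::complex" UNIV] by (simp add: zero_prod_def)
  have "((\<lambda>s. E (0, s)) \<longlongrightarrow> u 0) (at 0)"
    using isContD[OF E(3)] by (rule Lim_transform_eventually) (use E(5) in \<open>auto elim: eventually_mono\<close>)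
  moreover have "((\<lambda>s. E (0, s)) \<longlongrightarrow> E 0) (at 0)" using filterlim_compose[OF holo2_tendsto[OF E(1)] lim] .
  ultimately have "E 0 = u 0" using LIM_unique by blast
  then show ?case using E(1,4) by (intro exI[of _ 0] exI[of _ E]) simp
next
  case IH: (Suc n E)
  show ?case
  proof (cases "E 0 = 0")
    case False then show ?thesis using IH.prems(1) by (intro exI[of _ 0] exI[of _ E]) simp
  next
    case True
    obtain c where c: "holo2_at c 0" "\<forall>\<^sub>F q in nhds 0. E q = snd q * c q"
      using divide_snd[OF IH.prems(1) no_isolated_zero[OF IH.prems(1) True IH.prems(2)]] by blast
    have lim: "filterlim (\<lambda>z. (0::complex, z)) (nhds 0) (at (0::complex))"
      using tendsto_Pair[OF tendsto_const tendsto_ident_at, of "0::complex" "0::complex" UNIV] by (simp add: zero_prod_def)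
    have "\<exists>m d. holo2_at d 0 \<and> d 0 \<noteq> 0 \<and> (\<forall>\<^sub>F q in nhds 0. c q = snd q ^ m * d q)"
    proof (rule IH.IH[OF c(1) _ IH.prems(3,4)])
      show "\<forall>\<^sub>F q in nhds 0. c q = 0 \<longrightarrow> snd q = 0" using c(2) IH.prems(2) by eventually_elim simp
      have "\<forall>\<^sub>F s in at (0::complex). s \<noteq> 0" by (simp add: eventually_at_filter)
      then show "\<forall>\<^sub>F s in at 0. c (0, s) = s ^ n * u s"
        using IH.prems(5) eventually_compose_filterlim[OF c(2) lim] by eventually_elim simp
    qed
    then obtain m d where d: "holo2_at d 0" "d 0 \<noteq> 0" "\<forall>\<^sub>F q in nhds 0. c q = snd q ^ m * d q" by blast
    have "\<forall>\<^sub>F q in nhds 0. E q = snd q ^ Suc m * d q" using c(2) d(3) by eventually_elim simp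
    then show ?thesis using d by blast
  qed
qed

lemma factor_snd:
  assumes E: "holo2_at E 0" and z: "\<forall>\<^sub>F q in nhds 0. E q = 0 \<longrightarrow> snd q = 0"
  shows "\<exists>m c. holo2_at c 0 \<and> c 0 \<noteq> 0 \<and> (\<forall>\<^sub>F q in nhds 0. E q = snd q ^ m * c q)"
proof (cases "E 0 = 0")
  case False then show ?thesis using E by (intro exI[of _ 0] exI[of _ E]) simp
next
  case True
  obtain r where r: "r > 0" "(\<lambda>s. E (0, s)) holomorphic_on ball 0 r" using holo2_slices[OF E] by auto
  have lim: "filterlim (\<lambda>z. (0::complex, z)) (nhds 0) (nhds (0::complex))"
    using tendsto_Pair[OF tendsto_const filterlim_ident, of "0::complex" "0::complex"] by (simp add: zero_prod_def)
  obtain e where e: "e > 0" "\<And>s. dist s 0 < e \<Longrightarrow> E (0, s) = 0 \<longrightarrow> s = 0"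
    using eventually_compose_filterlim[OF z lim] unfolding eventually_nhds_metric by auto
  \<comment> \<open>A constant would have to be E 0 = 0, while E (0, s) vanishes only for s = 0 near
    the origin. So the factorization theorem in one variable applies.\<close>
  have nc: "\<not> (\<lambda>s. E (0, s)) constant_on ball 0 r"
  proof
    assume "(\<lambda>s. E (0, s)) constant_on ball 0 r"
    then obtain k where k: "\<And>s. s \<in> ball 0 r \<Longrightarrow> E (0, s) = k" unfolding constant_on_def by blast
    have "k = 0" using k[of 0] r(1) True by (simp add: zero_prod_def)
    obtain d where d: "0 < d" "d < min r e" using dense[of 0 "min r e"] r(1) e(1) by auto
    then have "E (0, of_real d) = 0" using k[of "of_real d"] \<open>k = 0\<close> by auto
    then show False using e(2)[of "of_real d"] d by auto
  qed
  have e0: "E (0, 0) = 0" using True by (simp add: zero_prod_def)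
  obtain g r' n where g: "0 < r'" "g holomorphic_on ball 0 r'"
    "\<And>w. w \<in> ball 0 r' \<Longrightarrow> E (0, w) = (w - 0) ^ n * g w" "\<And>w. w \<in> ball 0 r' \<Longrightarrow> g w \<noteq> 0"
    by (rule holomorphic_factor_zero_nonconstant[OF r(2) open_ball connected_ball _ e0 nc]) (use r(1) in auto)
  show ?thesis
  proof (rule factor_snd_aux[OF E z])
    show "isCont g 0" using holomorphic_on_imp_continuous_on[OF g(2)] g(1)
      by (simp add: continuous_on_eq_continuous_at)
    show "g 0 \<noteq> 0" using g by simp
    show "\<forall>\<^sub>F s in at 0. E (0, s) = s ^ n * g s"
      unfolding eventually_at using g by (intro exI[of _ r']) auto
  qed
qed

lemma factor_along_curve:
  assumes h: "holo2_at h p" "h p = 0" "(partial_x h p, partial_y h p) \<noteq> 0"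
    and E: "holo2_at E p" "E p = 0" and z: "\<forall>\<^sub>F q in nhds p. E q = 0 \<longrightarrow> h q = 0"
  shows "\<exists>m c. m \<ge> 1 \<and> holo2_at c p \<and> c p \<noteq> 0 \<and> (\<forall>\<^sub>F q in nhds p. E q = h q ^ m * c q)"
proof -
  obtain X Y \<alpha> where *: "holo2_at X 0" "holo2_at Y 0" "X 0 = fst p" "Y 0 = snd p" "holo2_at \<alpha> p" "\<alpha> p = 0"
    "\<forall>\<^sub>F q in nhds 0. h (X q, Y q) = snd q"
    "\<forall>\<^sub>F q in nhds p. X (\<alpha> q, h q) = fst q \<and> Y (\<alpha> q, h q) = snd q"
    using straighten[OF h] by blast
  note fl = chart_filterlim[OF *(1-4)] and fi = chart_inv_filterlim[OF *(5,6) h(1,2)]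
  have G: "holo2_at (\<lambda>q. E (X q, Y q)) 0"
    using holo2_chain[of E X 0 Y] E *(1-4) by simp
  have "\<forall>\<^sub>F q in nhds 0. E (X q, Y q) = 0 \<longrightarrow> snd q = 0"
    using eventually_compose_filterlim[OF z fl] *(7) by eventually_elim simp
  from factor_snd[OF G this] obtain m c where c: "holo2_at c 0" "c 0 \<noteq> 0"
    "\<forall>\<^sub>F q in nhds 0. E (X q, Y q) = snd q ^ m * c q" by blast
  have c0: "c (\<alpha> p, h p) = c 0" using *(6) h(2) by (simp add: zero_prod_def)
  have 1: "holo2_at (\<lambda>q. c (\<alpha> q, h q)) p"
    by (rule holo2_chain[OF _ *(5) h(1)]) (use c(1) *(6) h(2) in \<open>simp add: zero_prod_def\<close>)
  have 2: "\<forall>\<^sub>F q in nhds p. E q = h q ^ m * c (\<alpha> q, h q)"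
    using eventually_compose_filterlim[OF c(3) fi] *(8) by eventually_elim simp
  have "m \<noteq> 0"
    using eventually_nhds_x_imp_x[OF 2] E(2) c(2) c0 by (cases m) auto
  then show ?thesis using 1 2 c(2) c0 by (intro exI[of _ m] exI[of _ "\<lambda>q. c (\<alpha> q, h q)"]) auto
qed

section \<open>Resultants and discriminants of binary forms\<close>

definition monic_prod :: "nat \<Rightarrow> (nat \<Rightarrow> complex) \<Rightarrow> complex poly" where
  "monic_prod n \<alpha> = (\<Prod>i<n. [:- \<alpha> i, 1:])"

text \<open>Roots at infinity, that is vertical lines, are the factors with \<open>b i = 0\<close>;
  thus every binary form of degree n \<ge> 1 has this shape, also when its polynomial has smaller
  degree.\<close>

definition linear_prod :: "nat \<Rightarrow> (nat \<Rightarrow> complex) \<Rightarrow> (nat \<Rightarrow> complex) \<Rightarrow> complex poly" where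
  "linear_prod n a b = (\<Prod>i<n. [:a i, b i:])"

lemma monic_prod_0 [simp]: "monic_prod 0 \<alpha> = 1"
  and monic_prod_Suc: "monic_prod (Suc n) \<alpha> = monic_prod n \<alpha> * [:- \<alpha> n, 1:]"
  by (simp_all only: monic_prod_def prod.lessThan_Suc lessThan_0 prod.empty)

lemma linear_prod_0 [simp]: "linear_prod 0 a b = 1"
  and linear_prod_Suc: "linear_prod (Suc n) a b = linear_prod n a b * [:a n, b n:]"
  by (simp_all only: linear_prod_def prod.lessThan_Suc lessThan_0 prod.empty)

lemma poly_monic_prod: "poly (monic_prod n \<alpha>) x = (\<Prod>i<n. x - \<alpha> i)"
  by (induction n) (simp_all add: monic_prod_Suc algebra_simps)

lemma prod_linear_decompose:
  fixes f :: "complex poly"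
  assumes "f \<noteq> 0"
  obtains a \<alpha> where "a \<noteq> 0" "f = Polynomial.smult a (monic_prod (Polynomial.degree f) \<alpha>)"
  using complex_poly_decompose'[of f] assms unfolding monic_prod_def by (metis leading_coeff_0_iff)

lemma degree_prod_linear:
  assumes "a \<noteq> 0"
  shows "Polynomial.degree (Polynomial.smult a (monic_prod n \<alpha>)) = n"
    and "lead_coeff (Polynomial.smult a (monic_prod n \<alpha>)) = a"
    and "Polynomial.smult a (monic_prod n \<alpha>) \<noteq> 0"
proof -
  show d: "Polynomial.degree (Polynomial.smult a (monic_prod n \<alpha>)) = n"
    using assms unfolding monic_prod_def by (simp add: degree_prod_sum_eq)
  have "lead_coeff (monic_prod n \<alpha>) = 1" unfolding monic_prod_def by (simp add: lead_coeff_prod)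
  then show "lead_coeff (Polynomial.smult a (monic_prod n \<alpha>)) = a"
    unfolding lead_coeff_smult by simp
  show "Polynomial.smult a (monic_prod n \<alpha>) \<noteq> 0" using assms unfolding monic_prod_def by (simp add: prod_zero_iff)
qed

lemma poly_prod_linear:
  "poly (Polynomial.smult a (monic_prod n \<alpha>)) x = a * (\<Prod>i<n. x - \<alpha> i)"
  by (simp add: poly_monic_prod)

text \<open>Euclidean algorithm: replacing f by f mod g leaves the values of f at the roots of g
  unchanged, and the Brown-Traub lemmas tell how the resultant changes. If g has the larger degree,
  f and g are exchanged first. Absolute values dispose of all signs.\<close>

lemma norm_resultant_roots:
  fixes \<alpha> \<beta> :: "nat \<Rightarrow> complex"
  assumes "a \<noteq> 0" "b \<noteq> 0"
  shows "norm (resultant (Polynomial.smult a (monic_prod m \<alpha>)) (Polynomial.smult b (monic_prod n \<beta>))) =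
    norm a ^ n * norm b ^ m * (\<Prod>j<n. \<Prod>i<m. norm (\<beta> j - \<alpha> i))"
  using assms
proof (induction n arbitrary: a b m \<alpha> \<beta> rule: less_induct)
  case (less n)
  define f where f_def: "f = Polynomial.smult a (monic_prod m \<alpha>)"
  define g where g_def: "g = Polynomial.smult b (monic_prod n \<beta>)"
  note f = degree_prod_linear[OF less.prems(1), where \<alpha> = \<alpha> and n = m, folded f_def]
  note g = degree_prod_linear[OF less.prems(2), where \<alpha> = \<beta> and n = n, folded g_def]
  have "norm (resultant f g) = norm a ^ n * norm b ^ m * (\<Prod>j<n. \<Prod>i<m. norm (\<beta> j - \<alpha> i))"
  proof (cases "n = 0")
    case True
    have "g = [:b:]" using True by (simp add: g_def)
    then show ?thesis using True f(1) by (simp add: norm_power)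
  next
    case n: False
    show ?thesis
    proof (cases "m < n")
      case True
      have "norm (resultant f g) = norm (resultant g f)"
        by (subst resultant_swap) (simp add: norm_mult norm_power)
      also have "\<dots> = norm b ^ m * norm a ^ n * (\<Prod>j<m. \<Prod>i<n. norm (\<alpha> j - \<beta> i))"
        unfolding f_def g_def by (rule less.IH[OF True less.prems(2,1)])
      also have "(\<Prod>j<m. \<Prod>i<n. norm (\<alpha> j - \<beta> i)) = (\<Prod>j<n. \<Prod>i<m. norm (\<beta> j - \<alpha> i))"
        by (subst prod.swap) (simp add: norm_minus_commute)
      finally show ?thesis by simp
    next
      case False
      define h where "h = f mod g"
      have eq: "f + (- (f div g)) * g = h"
        unfolding h_def by (simp only: minus_mult_left[symmetric] diff_conv_add_uminus[symmetric] minus_div_mult_eq_mod)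
      have fh: "poly f (\<beta> j) = poly h (\<beta> j)" if "j < n" for j
      proof -
        have "poly g (\<beta> j) = 0" using that by (auto simp: g_def poly_monic_prod)
        then show ?thesis unfolding eq[symmetric] by simp
      qed
      have dg: "Polynomial.degree g \<le> Polynomial.degree f" using f(1) g(1) False by simp
      show ?thesis
      proof (cases "h = 0")
        \<comment> \<open>Now g divides f, and both sides vanish because a root of g is a root of
          f.\<close>
        case True
        have "f = (f div g) * g" using eq True by (simp add: add_eq_0_iff)
        from subresultant_product[OF this dg, of 0] have "resultant f g = 0"
          using n g(1) by (simp add: subresultant_resultant)
        moreover have "poly f (\<beta> 0) = 0" using fh[of 0] n True by simp
        then obtain i where "i < m" "\<beta> 0 = \<alpha> i" using less.prems(1) by (auto simp: f_def poly_monic_prod)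
        then have "(\<Prod>j<n. \<Prod>i<m. norm (\<beta> j - \<alpha> i)) = 0"
          by (intro prod_zero bexI[of _ 0] bexI[of _ i]) (use n in auto)
        ultimately show ?thesis by simp
      next
        case h0: False
        define d where "d = Polynomial.degree h"
        obtain c \<gamma> where c: "c \<noteq> 0" and h: "h = Polynomial.smult c (monic_prod d \<gamma>)"
          unfolding d_def by (rule prod_linear_decompose[OF h0])
        have dn: "d < n" using degree_mod_less[of g f] h0 g unfolding d_def h_def by auto
        have lt: "Polynomial.degree h < Polynomial.degree g" using dn g(1) by (simp add: d_def)
        have lch: "lead_coeff h = c" using degree_prod_linear(2)[OF c, where \<alpha> = \<gamma> and n = d] h by simp
        have "norm (resultant f g) = norm b ^ (m - d) * norm (resultant g h)"
        \<comment> \<open>The reduction of \<open>subresultant 0\<close> to the remainder holds only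
          if the remainder has positive degree; for a constant remainder that subresultant is
          computed directly.\<close>
        proof (cases "d = 0")
          case True
          have hc: "h = [:c:]" using h True by simp
          have "subresultant (Polynomial.degree h) f g = Polynomial.smult
             ((- 1) ^ ((Polynomial.degree f - Polynomial.degree h) * (Polynomial.degree g - Polynomial.degree h)) *
              lead_coeff g ^ (Polynomial.degree f - Polynomial.degree h) *
              lead_coeff h ^ (Polynomial.degree g - Polynomial.degree h - 1)) h"
            by (rule BT_lemma_1_13[OF eq dg]) (use lt in auto)
          then have "[:resultant f g:] = Polynomial.smult ((- 1) ^ (m * n) * b ^ m * c ^ (n - 1)) [:c:]"
            unfolding g(2) lch unfolding g(1) f(1) unfolding hc by (simp add: subresultant_resultant)
          then have "resultant f g = (- 1) ^ (m * n) * b ^ m * c ^ (n - 1) * c" by simp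
          then have "norm (resultant f g) = norm b ^ m * (norm c ^ (n - 1) * norm c)"
            by (simp add: norm_mult norm_power)
          also have "norm c ^ (n - 1) * norm c = norm c ^ n" using n by (cases n) auto
          finally show ?thesis using True g(1) unfolding hc by (simp add: norm_power)
        next
          case False
          have "subresultant 0 f g = Polynomial.smult
             ((- 1) ^ ((Polynomial.degree f - 0) * (Polynomial.degree g - 0)) *
              lead_coeff g ^ (Polynomial.degree f - Polynomial.degree h)) (subresultant 0 g h)"
            by (rule BT_lemma_1_12[OF eq dg]) (use lt False in \<open>auto simp: d_def\<close>)
          then have "[:resultant f g:] = Polynomial.smult ((- 1) ^ (m * n) * b ^ (m - d)) [:resultant g h:]"
            unfolding subresultant_resultant g(2) unfolding g(1) f(1) d_def[symmetric] by simp
          then have "resultant f g = (- 1) ^ (m * n) * b ^ (m - d) * resultant g h" by simp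
          then show ?thesis by (simp add: norm_mult norm_power)
        qed
        also have "norm (resultant g h) = norm b ^ d * norm c ^ n * (\<Prod>i<d. \<Prod>j<n. norm (\<gamma> i - \<beta> j))"
          unfolding h g_def by (rule less.IH[OF dn less.prems(2) c])
        also have "(\<Prod>i<d. \<Prod>j<n. norm (\<gamma> i - \<beta> j)) = (\<Prod>j<n. \<Prod>i<d. norm (\<beta> j - \<gamma> i))"
          by (subst prod.swap) (simp add: norm_minus_commute)
        also have "norm b ^ (m - d) * (norm b ^ d * norm c ^ n * (\<Prod>j<n. \<Prod>i<d. norm (\<beta> j - \<gamma> i)))
          = norm b ^ m * (\<Prod>j<n. norm c * (\<Prod>i<d. norm (\<beta> j - \<gamma> i)))"
        proof -
          have "norm b ^ (m - d) * norm b ^ d = norm b ^ m" using dn False by (simp flip: power_add)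
          then show ?thesis by (simp add: prod.distrib mult.assoc[symmetric])
        qed
        also have "(\<Prod>j<n. norm c * (\<Prod>i<d. norm (\<beta> j - \<gamma> i))) = (\<Prod>j<n. norm a * (\<Prod>i<m. norm (\<beta> j - \<alpha> i)))"
        proof (rule prod.cong[OF refl])
          fix j assume "j \<in> {..<n}"
          then have "norm (poly h (\<beta> j)) = norm (poly f (\<beta> j))" using fh by simp
          then show "norm c * (\<Prod>i<d. norm (\<beta> j - \<gamma> i)) = norm a * (\<Prod>i<m. norm (\<beta> j - \<alpha> i))"
            unfolding h f_def poly_prod_linear by (simp add: norm_mult prod_norm)
        qed
        finally show ?thesis by (simp add: prod.distrib)
      qed
    qed
  qed
  then show ?case unfolding f_def g_def .
qed

lemma norm_resultant_eval:
  fixes f :: "complex poly" and \<beta> :: "nat \<Rightarrow> complex"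
  assumes "f \<noteq> 0" "b \<noteq> 0"
  shows "norm (resultant f (Polynomial.smult b (monic_prod n \<beta>))) = norm b ^ Polynomial.degree f * (\<Prod>j<n. norm (poly f (\<beta> j)))"
    and "norm (resultant (Polynomial.smult b (monic_prod n \<beta>)) f) = norm b ^ Polynomial.degree f * (\<Prod>j<n. norm (poly f (\<beta> j)))"
proof -
  obtain a \<alpha> where a: "a \<noteq> 0" "f = Polynomial.smult a (monic_prod (Polynomial.degree f) \<alpha>)"
    by (rule prod_linear_decompose[OF assms(1)])
  have ev: "norm (poly f x) = norm a * (\<Prod>i<Polynomial.degree f. norm (x - \<alpha> i))" for x
    by (subst a(2), subst poly_prod_linear) (simp add: norm_mult prod_norm)
  show 1: "norm (resultant f (Polynomial.smult b (monic_prod n \<beta>))) = norm b ^ Polynomial.degree f * (\<Prod>j<n. norm (poly f (\<beta> j)))"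
    unfolding ev prod.distrib
    by (subst a(2), subst norm_resultant_roots[OF a(1) assms(2)]) simp
  show "norm (resultant (Polynomial.smult b (monic_prod n \<beta>)) f) = norm b ^ Polynomial.degree f * (\<Prod>j<n. norm (poly f (\<beta> j)))"
    unfolding 1[symmetric] by (subst resultant_swap) (simp add: norm_mult norm_power)
qed

text \<open>For fixed formal degrees the resultant is a polynomial in the coefficients, hence
  continuous even where the true degrees drop. This lets formulas proved for generic polynomials be
  extended by limits.\<close>

lemma tendsto_resultant_sub:
  fixes P Q :: "'a \<Rightarrow> complex poly"
  assumes "\<And>i. ((\<lambda>x. Polynomial.coeff (P x) i) \<longlongrightarrow> Polynomial.coeff P0 i) F"
    "\<And>i. ((\<lambda>x. Polynomial.coeff (Q x) i) \<longlongrightarrow> Polynomial.coeff Q0 i) F"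
  shows "((\<lambda>x. resultant_sub m n (P x) (Q x)) \<longlongrightarrow> resultant_sub m n P0 Q0) F"
proof -
  let ?N = "m + n"
  have det: "resultant_sub m n p q = (\<Sum>\<pi>\<in>{\<pi>. \<pi> permutes {0..<?N}}. signof \<pi> * (\<Prod>i = 0..<?N. sylvester_mat_sub m n p q $$ (i, \<pi> i)))"
    for p q :: "complex poly"
    unfolding resultant_sub_def by (simp add: det_def)
  show ?thesis unfolding det
  proof (intro tendsto_sum tendsto_mult tendsto_const tendsto_prod)
    fix \<pi> i assume "\<pi> \<in> {\<pi>. \<pi> permutes {0..<?N}}" "i \<in> {0..<?N}"
    then have i: "i < ?N" "\<pi> i < ?N" using permutes_in_image[of \<pi> "{0..<?N}" i] by auto
    show "((\<lambda>x. sylvester_mat_sub m n (P x) (Q x) $$ (i, \<pi> i)) \<longlongrightarrow> sylvester_mat_sub m n P0 Q0 $$ (i, \<pi> i)) F"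
      unfolding sylvester_mat_sub_index[OF i] using assms by auto
  qed
qed

lemma tendsto_coeff_mult:
  fixes P Q :: "'a \<Rightarrow> complex poly"
  assumes "\<And>i. ((\<lambda>x. Polynomial.coeff (P x) i) \<longlongrightarrow> Polynomial.coeff P0 i) F"
    "\<And>i. ((\<lambda>x. Polynomial.coeff (Q x) i) \<longlongrightarrow> Polynomial.coeff Q0 i) F"
  shows "((\<lambda>x. Polynomial.coeff (P x * Q x) i) \<longlongrightarrow> Polynomial.coeff (P0 * Q0) i) F"
  unfolding coeff_mult by (intro tendsto_sum tendsto_mult assms)

lemma tendsto_coeff_prod:
  fixes P :: "nat \<Rightarrow> 'a \<Rightarrow> complex poly"
  assumes "\<And>j i. j < n \<Longrightarrow> ((\<lambda>x. Polynomial.coeff (P j x) i) \<longlongrightarrow> Polynomial.coeff (P0 j) i) F"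
  shows "((\<lambda>x. Polynomial.coeff (\<Prod>j<n. P j x) i) \<longlongrightarrow> Polynomial.coeff (\<Prod>j<n. P0 j) i) F"
  using assms
proof (induction n arbitrary: i)
  case (Suc n)
  have "((\<lambda>x. Polynomial.coeff ((\<Prod>j<n. P j x) * P n x) i) \<longlongrightarrow> Polynomial.coeff ((\<Prod>j<n. P0 j) * P0 n) i) F"
    by (rule tendsto_coeff_mult) (use Suc in auto)
  then show ?case by simp
qed simp

lemma tendsto_coeff_linear:
  assumes "(a \<longlongrightarrow> (a0 :: complex)) F" "(b \<longlongrightarrow> b0) F"
  shows "((\<lambda>x. Polynomial.coeff [:a x, b x:] i) \<longlongrightarrow> Polynomial.coeff [:a0, b0:] i) F"
  using assms by (cases i; cases "i - 1") (auto simp: coeff_pCons split: nat.splits)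

lemma tendsto_form_disc:
  fixes P :: "'a \<Rightarrow> complex poly"
  assumes P: "\<And>i. ((\<lambda>x. Polynomial.coeff (P x) i) \<longlongrightarrow> Polynomial.coeff P0 i) F"
  shows "((\<lambda>x. form_disc n (P x)) \<longlongrightarrow> form_disc n P0) F"
proof -
  have d: "((\<lambda>x. Polynomial.coeff (pderiv (P x)) i) \<longlongrightarrow> Polynomial.coeff (pderiv P0) i) F" for i
    unfolding coeff_pderiv by (intro tendsto_mult tendsto_const P)
  show ?thesis unfolding form_disc_def
  proof (rule tendsto_resultant_sub)
    fix i
    have "((\<lambda>x. Polynomial.coeff ([:0, 1:] * pderiv (P x)) i) \<longlongrightarrow> Polynomial.coeff ([:0, 1:] * pderiv P0) i) F"
      by (rule tendsto_coeff_mult) (use d in auto)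
    then show "((\<lambda>x. Polynomial.coeff (Polynomial.smult (of_nat n) (P x) - [:0, 1:] * pderiv (P x)) i) \<longlongrightarrow>
        Polynomial.coeff (Polynomial.smult (of_nat n) P0 - [:0, 1:] * pderiv P0) i) F"
      unfolding coeff_diff coeff_smult by (intro tendsto_diff tendsto_mult tendsto_const P)
  qed (rule d)
qed

lemma linear_prod_scale:
  assumes "\<And>i. i < n \<Longrightarrow> b i \<noteq> 0"
  shows "linear_prod n a b = Polynomial.smult (\<Prod>i<n. b i) (monic_prod n (\<lambda>i. - a i / b i))"
  using assms
proof (induction n)
  case (Suc n)
  have l: "[:a n, b n:] = Polynomial.smult (b n) [:- (- a n / b n), 1:]" using Suc.prems[of n] by simp
  have "linear_prod n a b = Polynomial.smult (\<Prod>i<n. b i) (monic_prod n (\<lambda>i. - a i / b i))" using Suc by simp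
  then show ?case unfolding linear_prod_Suc monic_prod_Suc l
    by (simp only: mult_smult_left mult_smult_right smult_smult prod.lessThan_Suc mult.commute)
qed simp

lemma eventually_perturb_nonzero:
  fixes b :: "nat \<Rightarrow> complex"
  shows "\<forall>\<^sub>F e in at 0. \<forall>i<n. b i + e \<noteq> 0"
proof -
  have "\<forall>\<^sub>F e in at 0. b i + e \<noteq> 0" for i
  proof (cases "b i = 0")
    case False
    have "((\<lambda>e. b i + e) \<longlongrightarrow> b i + 0) (at 0)" by (intro tendsto_add tendsto_const tendsto_ident_at)
    then show ?thesis using tendsto_imp_eventually_ne[of _ "b i" "at 0" 0] False by simp
  qed (simp add: eventually_at_filter)
  then have "\<forall>\<^sub>F e in at 0. \<forall>i\<in>{..<n}. b i + e \<noteq> 0" by (intro eventually_ball_finite) auto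
  then show ?thesis by (rule eventually_mono) auto
qed

text \<open>If no \<open>b i\<close> or \<open>d j\<close> vanishes, formal and true degrees agree
  and the roots are - a i / b i and - c j / d j. Adding a small e to all \<open>b i\<close> and
  \<open>d j\<close> reduces the general case to this one.\<close>

lemma norm_resultant_sub_linear:
  fixes a b c d :: "nat \<Rightarrow> complex"
  shows "norm (resultant_sub m n (linear_prod m a b) (linear_prod n c d)) =
    (\<Prod>i<m. \<Prod>j<n. norm (a i * d j - b i * c j))"
proof -
  have gen: "norm (resultant_sub m n (linear_prod m a b) (linear_prod n c d)) =
    (\<Prod>i<m. \<Prod>j<n. norm (a i * d j - b i * c j))"
    if b: "\<And>i. i < m \<Longrightarrow> b i \<noteq> 0" and d: "\<And>j. j < n \<Longrightarrow> d j \<noteq> 0" for a b c d :: "nat \<Rightarrow> complex"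
  proof -
    have b0: "(\<Prod>i<m. b i) \<noteq> 0" and d0: "(\<Prod>j<n. d j) \<noteq> 0" using b d by auto
    have lb: "linear_prod m a b = Polynomial.smult (\<Prod>i<m. b i) (monic_prod m (\<lambda>i. - a i / b i))"
      by (rule linear_prod_scale) (rule b)
    have ld: "linear_prod n c d = Polynomial.smult (\<Prod>i<n. d i) (monic_prod n (\<lambda>i. - c i / d i))"
      by (rule linear_prod_scale) (rule d)
    have deg: "Polynomial.degree (linear_prod m a b) = m" "Polynomial.degree (linear_prod n c d) = n"
      unfolding lb ld using degree_prod_linear(1)[OF b0] degree_prod_linear(1)[OF d0] by blast+
    have "norm (resultant_sub m n (linear_prod m a b) (linear_prod n c d)) =
        norm (resultant (linear_prod m a b) (linear_prod n c d))"
      using resultant_sub[of "linear_prod m a b" "linear_prod n c d"] deg by simp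
    also have "\<dots> = norm (\<Prod>i<m. b i) ^ n * norm (\<Prod>j<n. d j) ^ m * (\<Prod>j<n. \<Prod>i<m. norm (- c j / d j - (- a i / b i)))"
      unfolding lb ld by (rule norm_resultant_roots[OF b0 d0])
    also have "(\<Prod>j<n. \<Prod>i<m. norm (- c j / d j - (- a i / b i))) = (\<Prod>i<m. \<Prod>j<n. norm (- c j / d j - (- a i / b i)))"
      by (rule prod.swap)
    also have "norm (\<Prod>i<m. b i) ^ n = (\<Prod>i<m. \<Prod>j<n. norm (b i))"
      by (simp add: prod_norm[symmetric] prod_power_distrib)
    also have "norm (\<Prod>j<n. d j) ^ m = (\<Prod>i<m. \<Prod>j<n. norm (d j))"
      by (simp add: prod_norm[symmetric])
    also have "(\<Prod>i<m. \<Prod>j<n. norm (b i)) * (\<Prod>i<m. \<Prod>j<n. norm (d j)) * (\<Prod>i<m. \<Prod>j<n. norm (- c j / d j - (- a i / b i)))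
       = (\<Prod>i<m. \<Prod>j<n. norm (a i * d j - b i * c j))"
      unfolding prod.distrib[symmetric]
    proof (intro prod.cong refl)
      fix i j assume "i \<in> {..<m}" "j \<in> {..<n}"
      then have "b i * d j * (- c j / d j - (- a i / b i)) = a i * d j - b i * c j"
        using b d by (simp add: field_simps)
      then show "norm (b i) * norm (d j) * norm (- c j / d j - (- a i / b i)) = norm (a i * d j - b i * c j)"
        unfolding norm_mult[symmetric] by simp
    qed
    finally show ?thesis .
  qed
  let ?R = "\<lambda>e. norm (resultant_sub m n (linear_prod m a (\<lambda>i. b i + e)) (linear_prod n c (\<lambda>j. d j + e)))"
  have lim: "((\<lambda>e. f + e) \<longlongrightarrow> f) (at 0)" for f :: complex
    using tendsto_add[OF tendsto_const tendsto_ident_at, of f 0 UNIV] by simp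
  have 1: "(?R \<longlongrightarrow> norm (resultant_sub m n (linear_prod m a b) (linear_prod n c d))) (at 0)"
    unfolding linear_prod_def
    by (intro tendsto_norm tendsto_resultant_sub tendsto_coeff_prod tendsto_coeff_linear tendsto_const lim)
  have "\<forall>\<^sub>F e in at 0. ?R e = (\<Prod>i<m. \<Prod>j<n. norm (a i * (d j + e) - (b i + e) * c j))"
    using eventually_perturb_nonzero[of m b] eventually_perturb_nonzero[of n d]
    by eventually_elim (rule gen; simp)
  moreover have "((\<lambda>e. \<Prod>i<m. \<Prod>j<n. norm (a i * (d j + e) - (b i + e) * c j)) \<longlongrightarrow>
      (\<Prod>i<m. \<Prod>j<n. norm (a i * d j - b i * c j))) (at 0)"
    by (intro tendsto_prod tendsto_norm tendsto_diff tendsto_mult tendsto_const lim)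
  ultimately have "(?R \<longlongrightarrow> (\<Prod>i<m. \<Prod>j<n. norm (a i * d j - b i * c j))) (at 0)"
    using tendsto_cong by fast
  then show ?thesis using LIM_unique[OF 1] by blast
qed

section \<open>Discriminants of binary forms\<close>

lemma coeff_monic_prod:
  shows "Polynomial.coeff (monic_prod n \<alpha>) n = 1"
    and "Polynomial.coeff (monic_prod (Suc n) \<alpha>) n = - (\<Sum>i<Suc n. \<alpha> i)"
proof -
  have m: "Polynomial.coeff (p * [:c, 1:]) (Suc k) = c * Polynomial.coeff p (Suc k) + Polynomial.coeff p k"
    for p :: "complex poly" and c k by simp
  have deg: "Polynomial.degree (monic_prod n \<alpha>) = n" for n
    using degree_prod_linear(1)[of 1 n \<alpha>] by simp
  show top: "Polynomial.coeff (monic_prod n \<alpha>) n = 1" for n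
    using degree_prod_linear(2)[of 1 n \<alpha>] deg[of n] by simp
  show "Polynomial.coeff (monic_prod (Suc n) \<alpha>) n = - (\<Sum>i<Suc n. \<alpha> i)"
  proof (induction n)
    case (Suc n)
    then show ?case unfolding monic_prod_Suc[of "Suc n"] m top by simp
  qed (simp add: monic_prod_Suc)
qed

lemma poly_pderiv_root:
  assumes "i < n"
  shows "poly (pderiv (Polynomial.smult a (monic_prod n \<alpha>))) (\<alpha> i) = a * (\<Prod>j\<in>{..<n} - {i}. \<alpha> i - \<alpha> j)"
proof -
  define R where "R = (\<Prod>j\<in>{..<n} - {i}. [:- \<alpha> j, 1:])"
  have "monic_prod n \<alpha> = [:- \<alpha> i, 1:] * R"
    unfolding monic_prod_def R_def by (rule prod.remove) (use assms in auto)
  moreover have "poly (pderiv ([:- \<alpha> i, 1:] * R)) (\<alpha> i) = poly R (\<alpha> i)"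
    by (subst pderiv_mult) (simp add: pderiv_pCons)
  moreover have "poly R (\<alpha> i) = (\<Prod>j\<in>{..<n} - {i}. poly [:- \<alpha> j, 1:] (\<alpha> i))"
    unfolding R_def by (rule poly_prod)
  ultimately show ?thesis by (simp add: pderiv_smult)
qed

text \<open>Write F = n P - t P'. A nonzero sum of the roots gives F the exact degree n - 1, so its
  formal resultant with P' is the true one. At the roots of P' one has F = n P, which reduces it to
  the resultant of P and P'; evaluated at the roots of P instead, the latter is a product of
  differences of roots. The constant collects n^(n-1) from F = n P at the n - 1 roots of P', and 1/n
  from the leading coefficient n B of P'.\<close>

lemma norm_form_disc_generic:
  fixes \<alpha> :: "nat \<Rightarrow> complex"
  assumes n: "n \<ge> 1" and B: "B \<noteq> 0" and s: "(\<Sum>i<n. \<alpha> i) \<noteq> 0"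
  shows "norm (form_disc n (Polynomial.smult B (monic_prod n \<alpha>))) =
    real n ^ (n - 1) / real n * norm B ^ (2 * (n - 1)) * (\<Prod>i<n. \<Prod>j\<in>{..<n} - {i}. norm (\<alpha> i - \<alpha> j))"
proof -
  define P where "P = Polynomial.smult B (monic_prod n \<alpha>)"
  note P = degree_prod_linear[OF B, where \<alpha> = \<alpha> and n = n, folded P_def]
  define F where "F = Polynomial.smult (of_nat n) P - [:0, 1:] * pderiv P"
  have dG: "Polynomial.degree (pderiv P) = n - 1" by (simp add: degree_pderiv P(1))
  have lG: "lead_coeff (pderiv P) = of_nat n * B"
    using n P(2) unfolding dG by (simp add: coeff_pderiv P(1))
  have G0: "pderiv P \<noteq> 0" using lG n B by auto
  obtain m where m: "n = Suc m" using n by (cases n) auto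
  \<comment> \<open>The coefficient of t^n cancels, and that of t^(n-1) is the one of P, namely - B
    times the sum of the roots.\<close>
  have cF: "Polynomial.coeff F i = (of_nat n - of_nat i) * Polynomial.coeff P i" for i
    by (cases i) (simp_all add: F_def coeff_pderiv algebra_simps)
  have top: "Polynomial.coeff F (n - 1) \<noteq> 0"
    unfolding cF unfolding P_def coeff_smult using B s unfolding m by (simp add: coeff_monic_prod(2) add_eq_0_iff)
  have dF: "Polynomial.degree F = n - 1"
  proof (rule antisym)
    show "Polynomial.degree F \<le> n - 1"
    proof (rule degree_le, intro allI impI)
      fix i assume "n - 1 < i"
      then show "Polynomial.coeff F i = 0" unfolding cF using P(1) coeff_eq_0[of P i] by (cases "i = n") auto
    qed
    show "n - 1 \<le> Polynomial.degree F" by (rule le_degree[OF top])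
  qed
  have F0: "F \<noteq> 0" using top by auto
  obtain b \<beta> where b: "b \<noteq> 0" "pderiv P = Polynomial.smult b (monic_prod (n - 1) \<beta>)"
    using prod_linear_decompose[OF G0] dG by metis
  have "lead_coeff (pderiv P) = b" unfolding b(2) by (rule degree_prod_linear(2)[OF b(1)])
  then have bn: "b = of_nat n * B" using lG by metis
  have Fb: "norm (poly F (\<beta> j)) = real n * norm (poly P (\<beta> j))" if "j < n - 1" for j
  proof -
    have "poly (pderiv P) (\<beta> j) = 0" using that unfolding b(2) poly_prod_linear by auto
    then show ?thesis by (simp add: F_def norm_mult)
  qed
  let ?K = "\<Prod>j<n - 1. norm (poly P (\<beta> j))"
  have "norm (form_disc n P) = norm (resultant F (pderiv P))"
    unfolding form_disc_def F_def[symmetric] resultant_sub dF dG ..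
  also have "\<dots> = norm b ^ (n - 1) * (\<Prod>j<n - 1. norm (poly F (\<beta> j)))"
    unfolding b(2) norm_resultant_eval(1)[OF F0 b(1)] dF ..
  also have "(\<Prod>j<n - 1. norm (poly F (\<beta> j))) = (\<Prod>j<n - 1. real n * norm (poly P (\<beta> j)))"
    by (rule prod.cong) (use Fb in auto)
  also have "\<dots> = real n ^ (n - 1) * ?K" by (simp add: prod.distrib)
  finally have 1: "norm (form_disc n P) = norm b ^ (n - 1) * (real n ^ (n - 1) * ?K)" .
  have "norm (resultant P (pderiv P)) = norm b ^ n * ?K"
    unfolding b(2) norm_resultant_eval(1)[OF P(3) b(1)] P(1) ..
  moreover have "norm (resultant P (pderiv P)) = norm B ^ (n - 1) * (\<Prod>i<n. norm (poly (pderiv P) (\<alpha> i)))"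
    using norm_resultant_eval(2)[OF G0 B, where n = n and \<beta> = \<alpha>] unfolding P_def[symmetric] dG .
  moreover have "(\<Prod>i<n. norm (poly (pderiv P) (\<alpha> i))) = (\<Prod>i<n. norm B * (\<Prod>j\<in>{..<n} - {i}. norm (\<alpha> i - \<alpha> j)))"
    by (rule prod.cong) (simp_all add: P_def poly_pderiv_root norm_mult prod_norm del: pderiv_smult)
  ultimately have 2: "norm b ^ n * ?K = norm B ^ (n - 1) * (norm B ^ n * (\<Prod>i<n. \<Prod>j\<in>{..<n} - {i}. norm (\<alpha> i - \<alpha> j)))"
    by (simp add: prod.distrib)
  have "norm b * norm (form_disc n P) = real n ^ (n - 1) * (norm b ^ n * ?K)"
  proof -
    have "norm b ^ n = norm b * norm b ^ (n - 1)" unfolding m by simp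
    then show ?thesis unfolding 1 by (simp only: mult_ac)
  qed
  also have "\<dots> = real n ^ (n - 1) * norm B * (norm B ^ (2 * (n - 1)) * (\<Prod>i<n. \<Prod>j\<in>{..<n} - {i}. norm (\<alpha> i - \<alpha> j)))"
  proof -
    have "norm B ^ (n - 1) * norm B ^ n = norm B * norm B ^ (2 * (n - 1))"
      unfolding m by (simp add: power_add mult_2)
    then show ?thesis unfolding 2 by (simp add: mult.assoc)
  qed
  finally show ?thesis unfolding bn P_def[symmetric] using n B by (simp add: norm_mult field_simps)
qed

text \<open>Two limits remove the genericity: a translation of all roots makes their sum nonzero,
  and a perturbation of the \<open>b i\<close> makes all roots finite.\<close>

lemma norm_form_disc_linear:
  fixes a b :: "nat \<Rightarrow> complex"
  assumes n: "n \<ge> 1"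
  shows "norm (form_disc n (linear_prod n a b)) =
    real n ^ (n - 1) / real n * (\<Prod>i<n. \<Prod>j\<in>{..<n} - {i}. norm (a i * b j - b i * a j))"
proof -
  let ?C = "real n ^ (n - 1) / real n"
  have lim: "((\<lambda>e. f + e) \<longlongrightarrow> f) (at 0)" for f :: complex
    using tendsto_add[OF tendsto_const tendsto_ident_at, of f 0 UNIV] by simp
  have gen: "norm (form_disc n (Polynomial.smult B (monic_prod n \<alpha>))) =
    ?C * norm B ^ (2 * (n - 1)) * (\<Prod>i<n. \<Prod>j\<in>{..<n} - {i}. norm (\<alpha> i - \<alpha> j))"
    if B: "B \<noteq> 0" for B and \<alpha> :: "nat \<Rightarrow> complex"
  proof (cases "(\<Sum>i<n. \<alpha> i) = 0")
    case False then show ?thesis by (rule norm_form_disc_generic[OF n B])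
  next
    case True
    let ?R = "\<lambda>e. norm (form_disc n (Polynomial.smult B (monic_prod n (\<lambda>i. \<alpha> i + e))))"
    have 1: "(?R \<longlongrightarrow> norm (form_disc n (Polynomial.smult B (monic_prod n \<alpha>)))) (at 0)"
      unfolding monic_prod_def
    proof (intro tendsto_norm tendsto_form_disc)
      show "((\<lambda>e. Polynomial.coeff (Polynomial.smult B (\<Prod>i<n. [:- (\<alpha> i + e), 1:])) k) \<longlongrightarrow>
          Polynomial.coeff (Polynomial.smult B (\<Prod>i<n. [:- \<alpha> i, 1:])) k) (at 0)" for k
        unfolding coeff_smult
        by (intro tendsto_mult tendsto_const tendsto_coeff_prod tendsto_coeff_linear tendsto_minus lim)
    qed
    \<comment> \<open>A translation does not change the differences of the roots, so
      \<open>?R\<close> is constant for e \<noteq> 0.\<close>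
    have "?R e = ?C * norm B ^ (2 * (n - 1)) * (\<Prod>i<n. \<Prod>j\<in>{..<n} - {i}. norm (\<alpha> i - \<alpha> j))" if "e \<noteq> 0" for e
    proof -
      have "(\<Sum>i<n. \<alpha> i + e) \<noteq> 0" using True that n by (simp add: sum.distrib)
      from norm_form_disc_generic[OF n B this] show ?thesis by simp
    qed
    then have "\<forall>\<^sub>F e in at 0. ?R e = ?C * norm B ^ (2 * (n - 1)) * (\<Prod>i<n. \<Prod>j\<in>{..<n} - {i}. norm (\<alpha> i - \<alpha> j))"
      by (simp add: eventually_at_filter)
    from LIM_unique[OF 1 tendsto_eventually[OF this]] show ?thesis .
  qed
  have gen2: "norm (form_disc n (linear_prod n a b)) =
    ?C * (\<Prod>i<n. \<Prod>j\<in>{..<n} - {i}. norm (a i * b j - b i * a j))"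
    if b: "\<And>i. i < n \<Longrightarrow> b i \<noteq> 0" for b :: "nat \<Rightarrow> complex"
  proof -
    have B: "(\<Prod>i<n. b i) \<noteq> 0" using b by auto
    have lb: "linear_prod n a b = Polynomial.smult (\<Prod>i<n. b i) (monic_prod n (\<lambda>i. - a i / b i))"
      by (rule linear_prod_scale) (rule b)
    let ?w = "\<lambda>i j. norm (- a i / b i - (- a j / b j))"
    \<comment> \<open>Clearing denominators: every ordered pair takes one \<open>b i\<close> and one
      \<open>b j\<close>, so each \<open>b i\<close> is used 2 (n - 1) times, the degree of the
      discriminant in the coefficients.\<close>
    have p1: "norm (\<Prod>i<n. b i) ^ (n - 1) = (\<Prod>i<n. \<Prod>j\<in>{..<n} - {i}. norm (b i))"
      by (simp add: prod_norm[symmetric] prod_power_distrib)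
    have p2: "norm (\<Prod>i<n. b i) ^ (n - 1) = (\<Prod>i<n. \<Prod>j\<in>{..<n} - {i}. norm (b j))"
    proof -
      have "(\<Prod>i<n. \<Prod>j\<in>{..<n} - {i}. norm (b j)) = (\<Prod>i<n. \<Prod>j\<in>{j \<in> {..<n}. j \<noteq> i}. norm (b j))"
        by (intro prod.cong) auto
      also have "\<dots> = (\<Prod>j<n. \<Prod>i\<in>{i \<in> {..<n}. j \<noteq> i}. norm (b j))"
        by (rule prod.swap_restrict) auto
      also have "\<dots> = (\<Prod>j<n. \<Prod>i\<in>{..<n} - {j}. norm (b j))"
        by (intro prod.cong) auto
      finally show ?thesis using p1 by simp
    qed
    have "norm (\<Prod>i<n. b i) ^ (2 * (n - 1)) * (\<Prod>i<n. \<Prod>j\<in>{..<n} - {i}. ?w i j)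
       = (\<Prod>i<n. \<Prod>j\<in>{..<n} - {i}. norm (b i)) * (\<Prod>i<n. \<Prod>j\<in>{..<n} - {i}. norm (b j)) * (\<Prod>i<n. \<Prod>j\<in>{..<n} - {i}. ?w i j)"
      unfolding p1[symmetric] p2[symmetric] by (simp add: mult_2 power_add)
    also have "\<dots> = (\<Prod>i<n. \<Prod>j\<in>{..<n} - {i}. norm (a i * b j - b i * a j))"
      unfolding prod.distrib[symmetric]
    proof (intro prod.cong refl)
      fix i j assume "i \<in> {..<n}" "j \<in> {..<n} - {i}"
      then have "b i * b j * (- a i / b i - (- a j / b j)) = - (a i * b j - b i * a j)"
        using b by (simp add: field_simps)
      then show "norm (b i) * norm (b j) * ?w i j = norm (a i * b j - b i * a j)"
        unfolding norm_mult[symmetric] by (simp only: norm_minus_cancel)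
    qed
    finally show ?thesis unfolding lb gen[OF B] mult.assoc by simp
  qed
  let ?R = "\<lambda>e. norm (form_disc n (linear_prod n a (\<lambda>i. b i + e)))"
  have 1: "(?R \<longlongrightarrow> norm (form_disc n (linear_prod n a b))) (at 0)"
    unfolding linear_prod_def
    by (intro tendsto_norm tendsto_form_disc tendsto_coeff_prod tendsto_coeff_linear tendsto_const lim)
  have ev: "\<forall>\<^sub>F e in at 0. ?R e = ?C * (\<Prod>i<n. \<Prod>j\<in>{..<n} - {i}. norm (a i * (b j + e) - (b i + e) * a j))"
    using eventually_perturb_nonzero[of n b] by eventually_elim (rule gen2; simp)
  have "((\<lambda>e. ?C * (\<Prod>i<n. \<Prod>j\<in>{..<n} - {i}. norm (a i * (b j + e) - (b i + e) * a j))) \<longlongrightarrow>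
      ?C * (\<Prod>i<n. \<Prod>j\<in>{..<n} - {i}. norm (a i * b j - b i * a j))) (at 0)"
    by (intro tendsto_prod tendsto_norm tendsto_diff tendsto_mult tendsto_const lim)
  with ev have "(?R \<longlongrightarrow> ?C * (\<Prod>i<n. \<Prod>j\<in>{..<n} - {i}. norm (a i * b j - b i * a j))) (at 0)"
    using tendsto_cong by fast
  then show ?thesis using LIM_unique[OF 1] by blast
qed

text \<open>A drop of the degree is filled up with constant factors, the roots at infinity, and the
  leading coefficient goes into the last factor.\<close>

lemma linear_factors:
  fixes P :: "complex poly"
  assumes "Polynomial.degree P \<le> n" "n \<ge> 1"
  obtains a b where "P = (linear_prod n a b)"
proof -
  have "\<exists>a b. P = (linear_prod n a b)"
  proof (cases "P = 0")
    case True
    then show ?thesis using assms(2) by (intro exI[of _ "\<lambda>_. 0"]) (auto simp: linear_prod_def prod_zero_iff intro!: bexI[of _ 0])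
  next
    case False
    define d where "d = Polynomial.degree P"
    obtain c \<alpha> where c: "P = Polynomial.smult c (monic_prod d \<alpha>)"
      using prod_linear_decompose[OF False] unfolding d_def by metis
    define a b :: "nat \<Rightarrow> complex" where "a i = (if i < d then - \<alpha> i else 1)" and "b i = (if i < d then 1 else 0)" for i :: nat
    have "(linear_prod n a b) = (linear_prod (d) a b)"
      by (unfold linear_prod_def, rule prod.mono_neutral_right) (use assms(1) in \<open>auto simp: a_def b_def d_def\<close>)
    also have "\<dots> = (monic_prod d \<alpha>)" by (unfold linear_prod_def monic_prod_def, rule prod.cong) (auto simp: a_def b_def)
    finally have P: "P = [:c:] * (linear_prod n a b)" using c by simp
    obtain m where m: "n = Suc m" using assms(2) by (cases n) auto
    have "P = linear_prod n (\<lambda>i. if i = m then c * a i else a i) (\<lambda>i. if i = m then c * b i else b i)"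
      unfolding P m linear_prod_def by (simp add: algebra_simps)
    then show ?thesis by blast
  qed
  then show thesis using that by blast
qed

lemma prod_lessThan_add:
  fixes f :: "nat \<Rightarrow> 'a :: comm_monoid_mult"
  shows "(\<Prod>i<m + n. f i) = (\<Prod>i<m. f i) * (\<Prod>i<n. f (m + i))"
  by (induction n) (simp_all add: mult.assoc)

text \<open>The product over ordered pairs of distinct factors of P Q splits into four blocks. Those
  within P and within Q give the two discriminants, and each of the two mixed blocks gives the
  resultant.\<close>

lemma norm_form_disc_mult:
  fixes P Q :: "complex poly"
  assumes "Polynomial.degree P \<le> m" "Polynomial.degree Q \<le> n" "m \<ge> 1" "n \<ge> 1"
  shows "real m ^ (m - 1) / real m * (real n ^ (n - 1) / real n) * norm (form_disc (m + n) (P * Q)) =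
    real (m + n) ^ (m + n - 1) / real (m + n) * norm (form_disc m P) * norm (form_disc n Q) * (norm (resultant_sub m n P Q))\<^sup>2"
proof -
  obtain a b where P: "P = (linear_prod m a b)" using linear_factors assms(1,3) by blast
  obtain c d where Q: "Q = (linear_prod n c d)" using linear_factors assms(2,4) by blast
  define A where "A i = (if i < m then a i else c (i - m))" for i
  define B where "B i = (if i < m then b i else d (i - m))" for i
  have PQ: "P * Q = (linear_prod (m + n) A B)"
    unfolding linear_prod_def prod_lessThan_add P Q by (simp add: A_def B_def)
  \<comment> \<open>The value 1 on the diagonal turns products over distinct pairs into products
    over full squares, which split along m + n.\<close>
  let ?w = "\<lambda>i j. if i = j then 1 else norm (A i * B j - B i * A j)"
  have off: "(\<Prod>i<N. \<Prod>j\<in>{..<N} - {i}. f i j) = (\<Prod>i<N. \<Prod>j<N. if i = j then 1 else f i j)"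
    for N and f :: "nat \<Rightarrow> nat \<Rightarrow> real"
    by (intro prod.cong refl prod.mono_neutral_cong_left) auto
  have "(\<Prod>i<m + n. \<Prod>j<m + n. ?w i j) =
     (\<Prod>i<m. \<Prod>j<m. ?w i j) * (\<Prod>i<m. \<Prod>j<n. ?w i (m + j)) * ((\<Prod>i<n. \<Prod>j<m. ?w (m + i) j) * (\<Prod>i<n. \<Prod>j<n. ?w (m + i) (m + j)))"
    by (simp only: prod_lessThan_add prod.distrib mult_ac)
  also have "(\<Prod>i<m. \<Prod>j<m. ?w i j) = (\<Prod>i<m. \<Prod>j<m. if i = j then 1 else norm (a i * b j - b i * a j))"
    by (intro prod.cong) (auto simp: A_def B_def)
  also have "(\<Prod>i<m. \<Prod>j<n. ?w i (m + j)) = norm (resultant_sub m n P Q)"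
    unfolding P Q norm_resultant_sub_linear by (intro prod.cong) (auto simp: A_def B_def)
  also have "(\<Prod>i<n. \<Prod>j<m. ?w (m + i) j) = norm (resultant_sub m n P Q)"
    unfolding P Q norm_resultant_sub_linear
    by (subst prod.swap, intro prod.cong) (auto simp: A_def B_def norm_minus_commute mult.commute)
  also have "(\<Prod>i<n. \<Prod>j<n. ?w (m + i) (m + j)) = (\<Prod>i<n. \<Prod>j<n. if i = j then 1 else norm (c i * d j - d i * c j))"
    by (intro prod.cong) (auto simp: A_def B_def)
  finally have "(\<Prod>i<m + n. \<Prod>j<m + n. ?w i j) = (\<Prod>i<m. \<Prod>j<m. if i = j then 1 else norm (a i * b j - b i * a j)) *
    (\<Prod>i<n. \<Prod>j<n. if i = j then 1 else norm (c i * d j - d i * c j)) * (norm (resultant_sub m n P Q))\<^sup>2"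
    by (simp add: power2_eq_square mult_ac)
  moreover have "norm (form_disc (m + n) (P * Q)) = real (m + n) ^ (m + n - 1) / real (m + n) * (\<Prod>i<m + n. \<Prod>j<m + n. ?w i j)"
    unfolding PQ using norm_form_disc_linear[of "m + n" A B] assms(3) unfolding off by simp
  moreover have "norm (form_disc m P) = real m ^ (m - 1) / real m * (\<Prod>i<m. \<Prod>j<m. if i = j then 1 else norm (a i * b j - b i * a j))"
    unfolding P norm_form_disc_linear[OF assms(3)] off ..
  moreover have "norm (form_disc n Q) = real n ^ (n - 1) / real n * (\<Prod>i<n. \<Prod>j<n. if i = j then 1 else norm (c i * d j - d i * c j))"
    unfolding Q norm_form_disc_linear[OF assms(4)] off ..
  ultimately show ?thesis by (simp add: field_simps)
qed

section \<open>Normal form of the web\<close>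

lemma form_eval_nonvertical:
  assumes "Polynomial.degree P \<le> n" "fst v \<noteq> 0"
  shows "form_eval n P v = fst v ^ n * poly P (snd v / fst v)"
proof -
  have "v = cscale (fst v) (1, snd v / fst v)" using assms(2) by (simp add: cscale_def prod_eq_iff)
  then show ?thesis using form_eval_scale[of n P "fst v"] form_eval_1[OF assms(1)] by metis
qed

lemma form_eval_vertical: "fst v = 0 \<Longrightarrow> form_eval n P v = Polynomial.coeff P n * snd v ^ n"
proof -
  assume v: "fst v = 0"
  have "(\<Sum>j\<le>n. Polynomial.coeff P j * fst v ^ (n - j) * snd v ^ j) = (\<Sum>j\<in>{n}. Polynomial.coeff P j * fst v ^ (n - j) * snd v ^ j)"
    by (rule sum.mono_neutral_right) (use v in auto)
  then show ?thesis by (simp add: form_eval_def)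
qed

lemma form_eval_mult_linear:
  assumes "Polynomial.degree P \<le> n"
  shows "form_eval (Suc n) (P * [:a, b:]) v = form_eval n P v * (a * fst v + b * snd v)"
proof (cases "fst v = 0")
  case True
  have "Polynomial.coeff (P * [:a, b:]) (Suc n) = b * Polynomial.coeff P n"
    using coeff_eq_0[of P "Suc n"] assms by simp
  then show ?thesis using True by (simp add: form_eval_vertical del: mult_pCons_right)
next
  case False
  have "Polynomial.degree (P * [:a, b:]) \<le> Suc n"
    using degree_mult_le[of P "[:a, b:]"] assms degree_pCons_le[of a "[:b:]"] by simp
  then show ?thesis using False assms
    by (simp add: form_eval_nonvertical field_simps del: mult_pCons_right)
qed

lemma degree_linear_prod: "Polynomial.degree (linear_prod n a b) \<le> n"
proof (induction n)
  case (Suc n)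
  then show ?case unfolding linear_prod_Suc
    using degree_mult_le[of "linear_prod n a b" "[:a n, b n:]"] degree_pCons_le[of "a n" "[:b n:]"] by simp
qed simp

lemma form_eval_linear_prod: "form_eval n (linear_prod n a b) v = (\<Prod>i<n. a i * fst v + b i * snd v)"
proof (induction n)
  case (Suc n)
  show ?case using form_eval_mult_linear[OF degree_linear_prod[of n a b], of "a n" "b n" v]
    by (simp only: linear_prod_Suc Suc prod.lessThan_Suc)
qed (simp add: form_eval_def)

lemma form_eval_smult: "form_eval n (Polynomial.smult c P) v = c * form_eval n P v"
  by (simp add: form_eval_def sum_distrib_left mult.assoc)

lemma form_eval_diff: "form_eval n (P - Q) v = form_eval n P v - form_eval n Q v"
  by (simp add: form_eval_def sum_subtractf left_diff_distrib)

lemma wedge_zero_of_common_zero: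
  assumes "(a, b) \<noteq> (0, 0)" "a * fst v + b * snd v = 0" "a * fst w + b * snd w = (0 :: complex)"
  shows "wedge v w = 0"
proof -
  have "a * wedge v w = (a * fst v + b * snd v) * snd w - (a * fst w + b * snd w) * snd v"
    "b * wedge v w = (a * fst w + b * snd w) * fst v - (a * fst v + b * snd v) * fst w"
    by (simp_all add: wedge_def algebra_simps)
  then show ?thesis using assms by auto
qed

text \<open>Pigeonhole: a nonzero linear factor vanishes on a single line, so n factors cannot
  account for n + 1 distinct lines.\<close>

lemma form_zero_of_many_zeros:
  assumes deg: "Polynomial.degree G \<le> n" and n: "n \<ge> 1"
    and v: "\<And>j. j \<le> n \<Longrightarrow> form_eval n G (v j) = 0"
    and w: "\<And>i j. i \<le> n \<Longrightarrow> j \<le> n \<Longrightarrow> i \<noteq> j \<Longrightarrow> wedge (v i) (v j) \<noteq> 0"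
  shows "G = 0"
proof (rule ccontr)
  assume G0: "G \<noteq> 0"
  obtain a b where G: "G = linear_prod n a b" using linear_factors[OF deg n] by blast
  have ab: "(a i, b i) \<noteq> (0, 0)" if "i < n" for i
    using G0 that unfolding G linear_prod_def by (auto simp: prod_zero_iff)
  have "\<exists>i<n. a i * fst (v j) + b i * snd (v j) = 0" if "j \<le> n" for j
    using v[OF that] unfolding G form_eval_linear_prod by auto
  then obtain f where f: "\<And>j. j \<le> n \<Longrightarrow> f j < n" "\<And>j. j \<le> n \<Longrightarrow> a (f j) * fst (v j) + b (f j) * snd (v j) = 0"
    by metis
  have "inj_on f {..n}"
  proof (rule inj_onI, rule ccontr)
    fix i j assume ij: "i \<in> {..n}" "j \<in> {..n}" "f i = f j" "i \<noteq> j"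
    then have "wedge (v i) (v j) = 0"
      using wedge_zero_of_common_zero[OF ab[OF f(1)] f(2)] f(2)[of j] by auto
    then show False using w ij by auto
  qed
  then have "card {..n} \<le> card {..<n}" by (rule card_inj_on_le) (use f in auto)
  then show False by simp
qed

text \<open>The form of slope \<open>q\<close> in the frame \<open>(1, 0)\<close>, \<open>(c, 1)\<close>: it kills \<open>(1, 0) + q (c, 1)\<close> and is \<open>1\<close>
  on \<open>(c, 1)\<close>.\<close>

definition slope_form :: "complex \<Rightarrow> complex \<Rightarrow> complex poly" where
  "slope_form c q = [:- q, 1 + c * q:]"

text \<open>The functions \<open>m i\<close> are general because they will be the values of the
  monomials on (1, 0) + t (c, 1), so that the root t is a slope in the frame and not the usual
  one.\<close>

lemma implicit_root:
  fixes a :: "nat \<Rightarrow> point \<Rightarrow> complex"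
  assumes a: "\<And>i. i \<le> n \<Longrightarrow> holo2_at (a i) p0"
    and m: "\<And>i t. (m i has_field_derivative m' i t) (at t)" and m': "\<And>i. continuous_on UNIV (m' i)"
    and z: "(\<Sum>i\<le>n. a i p0 * m i t0) = 0" and nz: "(\<Sum>i\<le>n. a i p0 * m' i t0) \<noteq> 0"
  shows "\<exists>g. holo2_at g p0 \<and> g p0 = t0 \<and> (\<forall>\<^sub>F p in nhds p0. (\<Sum>i\<le>n. a i p * m i (g p)) = 0)"
proof -
  have "\<forall>i. \<exists>V. i \<le> n \<longrightarrow> p0 \<in> V \<and> holo_on2 V (a i)" using a unfolding holo2_at_on2 by blast
  then obtain V where V: "\<And>i. i \<le> n \<Longrightarrow> p0 \<in> V i \<and> holo_on2 (V i) (a i)" by metis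
  define W where "W = (\<Inter>i\<in>{..n}. V i)"
  have oW: "open W" unfolding W_def using V by (intro open_INT) (auto simp: holo_on2_def)
  have W: "p0 \<in> W" "\<And>i. i \<le> n \<Longrightarrow> holo_on2 W (a i)"
    using V oW by (auto simp: W_def holo_on2_def)
  let ?U = "W \<times> (UNIV :: complex set)"
  let ?F = "\<lambda>q. \<Sum>i\<le>n. a i (fst q) * m i (snd q)"
  have mc: "continuous_on A (m i)" for A i
    by (intro continuous_at_imp_continuous_on ballI DERIV_isCont[OF m])
  have m'c: "continuous_on A (m' i)" for A i using m' continuous_on_subset by blast
  have "\<exists>V W g. p0 \<in> V \<and> open W \<and> t0 \<in> W \<and> holo_on2 V g \<and>
     (\<forall>p\<in>V. g p \<in> W \<and> (\<forall>t\<in>W. ?F (p, t) = 0 \<longleftrightarrow> t = g p))"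
  proof (rule implicit_function[where U = ?U
        and Fx = "\<lambda>q. \<Sum>i\<le>n. partial_x (a i) (fst q) * m i (snd q)"
        and Fy = "\<lambda>q. \<Sum>i\<le>n. partial_y (a i) (fst q) * m i (snd q)"
        and Ft = "\<lambda>q. \<Sum>i\<le>n. a i (fst q) * m' i (snd q)"])
    show "open ?U" using oW by (simp add: open_Times)
    show "(p0, t0) \<in> ?U" using W by simp
    show "continuous_on ?U (\<lambda>q. \<Sum>i\<le>n. partial_x (a i) (fst q) * m i (snd q))"
      "continuous_on ?U (\<lambda>q. \<Sum>i\<le>n. partial_y (a i) (fst q) * m i (snd q))"
      "continuous_on ?U (\<lambda>q. \<Sum>i\<le>n. a i (fst q) * m' i (snd q))"
      by (intro continuous_on_sum continuous_on_mult
          continuous_on_compose2[OF holo_on2_partial_x_continuous[OF W(2)]]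
          continuous_on_compose2[OF holo_on2_partial_y_continuous[OF W(2)]]
          continuous_on_compose2[OF holo_on2_continuous[OF W(2)]]
          continuous_on_compose2[OF mc[of UNIV]] continuous_on_compose2[OF m'c[of UNIV]]
          continuous_on_fst continuous_on_snd continuous_on_id; auto)+
    show "?F (p0, t0) = 0" using z by simp
    show "(\<Sum>i\<le>n. a i (fst (p0, t0)) * m' i (snd (p0, t0))) \<noteq> 0" using nz by simp
    fix q assume q: "q \<in> ?U"
    have "((\<lambda>q. a i (fst q) * m i (snd q)) has_derivative
        (\<lambda>v. a i (fst q) * (m' i (snd q) * snd v) + (partial_x (a i) (fst q) * fst (fst v) + partial_y (a i) (fst q) * snd (fst v)) * m i (snd q))) (at q)"
      if i: "i \<le> n" for i
    proof -
      have "hasd (a i) (partial_x (a i) (fst q)) (partial_y (a i) (fst q)) (fst q)"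
        using q by (intro holo2_hasd holo_on2_at[OF W(2)[OF i]]) auto
      from has_derivative_compose[OF has_derivative_fst[OF has_derivative_ident] this[unfolded hasd_def]]
        has_derivative_compose[OF has_derivative_snd[OF has_derivative_ident] m[of i "snd q", unfolded has_field_derivative_def]]
      show ?thesis by (rule has_derivative_mult)
    qed
    then have "(?F has_derivative (\<lambda>v. \<Sum>i\<le>n. a i (fst q) * (m' i (snd q) * snd v) + (partial_x (a i) (fst q) * fst (fst v) + partial_y (a i) (fst q) * snd (fst v)) * m i (snd q))) (at q)"
      by (intro has_derivative_sum) auto
    then show "(?F has_derivative (\<lambda>v. (\<Sum>i\<le>n. partial_x (a i) (fst q) * m i (snd q)) * fst (fst v) +
        (\<Sum>i\<le>n. partial_y (a i) (fst q) * m i (snd q)) * snd (fst v) + (\<Sum>i\<le>n. a i (fst q) * m' i (snd q)) * snd v)) (at q)"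
      by (rule has_derivative_eq_rhs) (simp add: sum_distrib_left sum_distrib_right sum.distrib[symmetric] algebra_simps)
  qed
  then obtain V' W' g where g: "p0 \<in> V'" "t0 \<in> W'" "holo_on2 V' g"
     "\<And>p. p \<in> V' \<Longrightarrow> g p \<in> W'" "\<And>p t. p \<in> V' \<Longrightarrow> t \<in> W' \<Longrightarrow> ?F (p, t) = 0 \<longleftrightarrow> t = g p" by blast
  have "g p0 = t0" using g(5)[OF g(1,2)] z by simp
  moreover have "holo2_at g p0" by (rule holo_on2_at[OF g(3,1)])
  moreover have "\<forall>\<^sub>F p in nhds p0. (\<Sum>i\<le>n. a i p * m i (g p)) = 0"
  proof -
    have "\<forall>\<^sub>F p in nhds p0. p \<in> V'" using g(1,3) unfolding holo_on2_def eventually_nhds by blast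
    then show ?thesis by eventually_elim (use g(4,5) in force)
  qed
  ultimately show ?thesis by blast
qed

lemma pairwise_transverse_of_form_disc:
  assumes "form_disc n (linear_prod n a b) \<noteq> 0" "n \<ge> 1" "i < n" "j < n" "i \<noteq> j"
  shows "a i * b j - b i * a j \<noteq> 0"
proof
  assume z: "a i * b j - b i * a j = 0"
  have z0: "(\<Prod>i<n. \<Prod>j\<in>{..<n} - {i}. norm (a i * b j - b i * a j)) = 0"
    by (intro prod_zero bexI[of _ i] bexI[of _ j]) (use assms z in auto)
  show False using norm_form_disc_linear[OF assms(2), of a b] assms(1) unfolding z0 by simp
qed

text \<open>For a product of two linear forms the absolute value of the discriminant is that of the
  squared determinant of their coefficients, and this square is the usual b^2 - 4 a c.\<close>

lemma form_disc_quadratic_zero_iff: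
  assumes "Polynomial.degree P \<le> 2"
  shows "form_disc 2 P = 0 \<longleftrightarrow> (Polynomial.coeff P 1)\<^sup>2 = 4 * Polynomial.coeff P 0 * Polynomial.coeff P 2"
proof -
  obtain a b where P: "P = linear_prod 2 a b" using linear_factors[OF assms] by auto
  have P': "P = [:a 0, b 0:] * [:a 1, b 1:]" unfolding P by (simp add: linear_prod_def numeral_2_eq_2)
  have "norm (form_disc 2 P) = norm (a 0 * b 1 - b 0 * a 1) * norm (a 1 * b 0 - b 1 * a 0)"
  proof -
    have "{..<2::nat} - {0} = {1}" "{..<2::nat} - {1} = {0}" by auto
    then show ?thesis unfolding P using norm_form_disc_linear[of 2 a b]
      by (simp add: numeral_2_eq_2 lessThan_Suc)
  qed
  moreover have "norm (a 1 * b 0 - b 1 * a 0) = norm (a 0 * b 1 - b 0 * a 1)"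
    using norm_minus_commute[of "a 1 * b 0" "b 1 * a 0"] by (simp add: mult.commute)
  ultimately have "form_disc 2 P = 0 \<longleftrightarrow> a 0 * b 1 - b 0 * a 1 = 0" by (metis mult_eq_0_iff norm_eq_zero)
  also have "\<dots> \<longleftrightarrow> (a 0 * b 1 - b 0 * a 1)\<^sup>2 = 0" by simp
  also have "(a 0 * b 1 - b 0 * a 1)\<^sup>2 = (Polynomial.coeff P 1)\<^sup>2 - 4 * Polynomial.coeff P 0 * Polynomial.coeff P 2"
    unfolding P' by (simp add: numeral_2_eq_2 power2_eq_square algebra_simps)
  finally show ?thesis by simp
qed

text \<open>Multiplicativity of the discriminant turns \<open>\<Delta>(W\<^sub>2) = \<Delta>(W)\<close> into: \<open>W\<^sub>k\<close> is smooth and transverse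
  to \<open>W\<^sub>2\<close> at the origin.\<close>

lemma transverse_at_origin:
  fixes \<omega> \<omega>2 \<omega>k :: symform
  assumes k: "k \<ge> 1" and w: "web_germ (k + 2) \<omega>" and w2: "web_germ 2 \<omega>2" and wk: "web_germ k \<omega>k"
    and s: "same_web \<omega> (superpose \<omega>2 \<omega>k)" and d: "same_divisor (web_disc 2 \<omega>2) (web_disc (k + 2) \<omega>)"
  shows "\<exists>r. r \<noteq> 0 \<and> form_disc k (Polynomial.smult r (\<omega>k 0)) \<noteq> 0 \<and>
    resultant_sub 2 k (\<omega>2 0) (Polynomial.smult r (\<omega>k 0)) \<noteq> 0"
proof -
  obtain r where r: "holo2_at r 0" "r 0 \<noteq> 0" "\<forall>\<^sub>F p in nhds 0. \<omega> p = Polynomial.smult (r p) (\<omega>2 p * \<omega>k p)"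
    using s unfolding same_web_def superpose_def by blast
  obtain u where u: "holo2_at u 0" "u 0 \<noteq> 0" "\<forall>\<^sub>F p in nhds 0. web_disc 2 \<omega>2 p = u p * web_disc (k + 2) \<omega> p"
    using d unfolding same_divisor_def by blast
  \<comment> \<open>The unit that relates \<omega> to the product of the two forms is absorbed into
    the second factor.\<close>
  define Q where "Q p = Polynomial.smult (r p) (\<omega>k p)" for p
  have deg2: "\<forall>\<^sub>F p in nhds 0. Polynomial.degree (\<omega>2 p) \<le> 2" and degk: "\<forall>\<^sub>F p in nhds 0. Polynomial.degree (\<omega>k p) \<le> k"
    using w2 wk unfolding web_germ_def by blast+
  have tend: "((\<lambda>p. Polynomial.coeff (\<eta> p) i) \<longlongrightarrow> Polynomial.coeff (\<eta> 0) i) (nhds 0)" if "web_germ n \<eta>" for n \<eta> i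
  proof (cases "i \<le> n")
    case True then show ?thesis using that holo2_tendsto unfolding web_germ_def by blast
  next
    case False
    have ev: "\<forall>\<^sub>F p in nhds 0. Polynomial.degree (\<eta> p) \<le> n" using that unfolding web_germ_def by blast
    have "\<forall>\<^sub>F p in nhds 0. Polynomial.coeff (\<eta> p) i = 0"
      using ev by eventually_elim (use False in \<open>auto intro: coeff_eq_0\<close>)
    moreover from eventually_nhds_x_imp_x[OF this] have "Polynomial.coeff (\<eta> 0) i = 0" .
    ultimately show ?thesis by (simp add: tendsto_eventually)
  qed
  have tQ: "((\<lambda>p. Polynomial.coeff (Q p) i) \<longlongrightarrow> Polynomial.coeff (Q 0) i) (nhds 0)" for i
    unfolding Q_def coeff_smult by (intro tendsto_mult holo2_tendsto r(1) tend[OF wk])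
  define C1 where "C1 = real 2 ^ (2 - 1) / real 2 * (real k ^ (k - 1) / real k)"
  define C2 where "C2 = real (2 + k) ^ (2 + k - 1) / real (2 + k)"
  have C: "C1 > 0" using k by (simp add: C1_def)
  \<comment> \<open>The product formula becomes C1 |disc| = R |disc|, so R = C1 > 0 off the
    discriminant. If R vanished at the origin, continuity would give R < C1 nearby, and the
    discriminant of \<omega> would be zero everywhere near 0.\<close>
  define R where "R p = C2 * norm (u p) * norm (form_disc k (Q p)) * (norm (resultant_sub 2 k (\<omega>2 p) (Q p)))\<^sup>2" for p
  have ev: "\<forall>\<^sub>F p in nhds 0. web_disc (k + 2) \<omega> p \<noteq> 0 \<longrightarrow> R p = C1"
    using r(3) u(3) deg2 degk
  proof eventually_elim
    case (elim p)
    have "Polynomial.degree (Q p) \<le> k" using elim(4) degree_smult_le[of "r p" "\<omega>k p"] by (simp add: Q_def)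
    from norm_form_disc_mult[OF elim(3) this _ k]
    have "C1 * norm (form_disc (2 + k) (\<omega>2 p * Q p)) =
      C2 * norm (form_disc 2 (\<omega>2 p)) * norm (form_disc k (Q p)) * (norm (resultant_sub 2 k (\<omega>2 p) (Q p)))\<^sup>2"
      by (simp add: C1_def C2_def)
    moreover have "\<omega>2 p * Q p = \<omega> p" using elim(1) by (simp add: Q_def)
    ultimately have eq: "C1 * norm (web_disc (k + 2) \<omega> p) =
      C2 * norm (web_disc 2 \<omega>2 p) * norm (form_disc k (Q p)) * (norm (resultant_sub 2 k (\<omega>2 p) (Q p)))\<^sup>2"
      by (simp add: web_disc_def add.commute)
    show ?case
    proof
      assume nz: "web_disc (k + 2) \<omega> p \<noteq> 0"
      have "C1 * norm (web_disc (k + 2) \<omega> p) = R p * norm (web_disc (k + 2) \<omega> p)"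
        unfolding eq elim(2) R_def by (simp add: norm_mult mult_ac)
      then show "R p = C1" using nz by simp
    qed
  qed
  have tR: "(R \<longlongrightarrow> R 0) (nhds 0)"
    unfolding R_def
    by (intro tendsto_mult tendsto_const tendsto_norm tendsto_power holo2_tendsto u(1) tendsto_form_disc tendsto_resultant_sub tQ tend[OF w2])
  have "R 0 \<noteq> 0"
  proof
    assume "R 0 = 0"
    then have "\<forall>\<^sub>F p in nhds 0. R p < C1" using order_tendstoD(2)[OF tR] C by simp
    with ev have "\<forall>\<^sub>F p in nhds 0. web_disc (k + 2) \<omega> p = 0" by eventually_elim auto
    then show False using w unfolding web_germ_def by blast
  qed
  then have "form_disc k (Q 0) \<noteq> 0" "resultant_sub 2 k (\<omega>2 0) (Q 0) \<noteq> 0" by (auto simp: R_def)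
  then show ?thesis using r(2) unfolding Q_def by blast
qed

text \<open>Slopes are measured in the frame (1, 0), (c, 1), with (c, 1) tangent to no leaf at the
  origin. The roots of \<omega>k are simple there, so the implicit function theorem gives its slopes
  \<open>q i\<close>. The form \<omega>2 need not split; its two slopes are recorded by their mean u
  and the square E of half their difference. The units Lk and L2 are the values of the forms on (c,
  1).\<close>

lemma normal_form:
  fixes \<omega> \<omega>2 \<omega>k :: symform
  assumes k: "k \<ge> 1" and w: "web_germ (k + 2) \<omega>" and w2: "web_germ 2 \<omega>2" and wk: "web_germ k \<omega>k"
    and s: "same_web \<omega> (superpose \<omega>2 \<omega>k)" and d: "same_divisor (web_disc 2 \<omega>2) (web_disc (k + 2) \<omega>)"
    and S: "0 \<in> disc_support (k + 2) \<omega>"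
  shows "\<exists>c q u E Lk L2. (\<forall>i<k. holo2_at (q i) 0) \<and> holo2_at u 0 \<and> holo2_at E 0 \<and> holo2_at Lk 0 \<and> holo2_at L2 0 \<and>
    Lk 0 \<noteq> 0 \<and> L2 0 \<noteq> 0 \<and> E 0 = 0 \<and>
    (\<forall>i<k. \<forall>j<k. i \<noteq> j \<longrightarrow> q i 0 \<noteq> q j 0) \<and> (\<forall>i<k. q i 0 \<noteq> u 0) \<and>
    (\<forall>\<^sub>F p in nhds 0. \<omega>k p = Polynomial.smult (Lk p) (\<Prod>i<k. slope_form c (q i p))) \<and>
    (\<forall>\<^sub>F p in nhds 0. \<omega>2 p = Polynomial.smult (L2 p) ((slope_form c (u p))\<^sup>2 - Polynomial.smult (E p) ([:1, - c:]\<^sup>2))) \<and>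
    (\<forall>\<^sub>F p in nhds 0. p \<in> disc_support (k + 2) \<omega> \<longleftrightarrow> E p = 0)"
proof -
  obtain r where r: "r \<noteq> 0" and rd: "form_disc k (Polynomial.smult r (\<omega>k 0)) \<noteq> 0"
    and rr: "resultant_sub 2 k (\<omega>2 0) (Polynomial.smult r (\<omega>k 0)) \<noteq> 0"
    using transverse_at_origin[OF k w w2 wk s d] by blast
  have deg2: "\<forall>\<^sub>F p in nhds 0. Polynomial.degree (\<omega>2 p) \<le> 2" and degk: "\<forall>\<^sub>F p in nhds 0. Polynomial.degree (\<omega>k p) \<le> k"
    and h2: "\<And>i. i \<le> 2 \<Longrightarrow> holo2_at (\<lambda>p. Polynomial.coeff (\<omega>2 p) i) 0"
    and hk: "\<And>i. i \<le> k \<Longrightarrow> holo2_at (\<lambda>p. Polynomial.coeff (\<omega>k p) i) 0"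
    using w2 wk unfolding web_germ_def by blast+
  have deg20: "Polynomial.degree (\<omega>2 0) \<le> 2" and degk0: "Polynomial.degree (\<omega>k 0) \<le> k"
    using eventually_nhds_x_imp_x[OF deg2] eventually_nhds_x_imp_x[OF degk] .
  obtain a2 b2 where P: "\<omega>2 0 = linear_prod 2 a2 b2" using linear_factors[OF deg20] by auto
  obtain ak bk where Q: "Polynomial.smult r (\<omega>k 0) = linear_prod k ak bk"
    using linear_factors[of "Polynomial.smult r (\<omega>k 0)" k] degk0 k degree_smult_le[of r "\<omega>k 0"] by auto
  have cross: "a2 i * bk j - b2 i * ak j \<noteq> 0" if "i < 2" "j < k" for i j
  proof
    assume z: "a2 i * bk j - b2 i * ak j = 0"
    have "(\<Prod>i<2. \<Prod>j<k. norm (a2 i * bk j - b2 i * ak j)) = 0"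
      by (intro prod_zero bexI[of _ i] bexI[of _ j]) (use that z in auto)
    then show False using rr unfolding P Q by (metis norm_resultant_sub_linear norm_eq_zero)
  qed
  have disj: "ak i * bk j - bk i * ak j \<noteq> 0" if "i < k" "j < k" "i \<noteq> j" for i j
    using pairwise_transverse_of_form_disc[of k ak bk i j] rd k that unfolding Q by blast
  have nz2: "(a2 i, b2 i) \<noteq> (0, 0)" if "i < 2" for i using cross[OF that, of 0] k by auto
  have nzk: "(ak j, bk j) \<noteq> (0, 0)" if "j < k" for j using cross[of 0 j] that by auto
  have fin: "finite {c. a * c + b = (0 :: complex)}" if "(a, b) \<noteq> (0, 0)" for a b
  proof (cases "a = 0")
    case False
    then have "{c. a * c + b = 0} \<subseteq> {- b / a}" by (auto simp: field_simps add_eq_0_iff)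
    then show ?thesis using finite_subset by blast
  qed (use that in simp)
  \<comment> \<open>Each tangent line at the origin excludes at most one value of c.\<close>
  have "finite ((\<Union>i<2. {c. a2 i * c + b2 i = 0}) \<union> (\<Union>j<k. {c. ak j * c + bk j = 0}))"
    using fin nz2 nzk by auto
  then obtain c where "c \<notin> (\<Union>i<2. {c. a2 i * c + b2 i = 0}) \<union> (\<Union>j<k. {c. ak j * c + bk j = 0})"
    using ex_new_if_finite[OF infinite_UNIV_char_0] by blast
  then have c2: "a2 i * c + b2 i \<noteq> 0" if "i < 2" for i using that by auto
  have ck: "ak j * c + bk j \<noteq> 0" if "j < k" for j
    using \<open>c \<notin> _\<close> that by auto
  define e where "e = (c, 1 :: complex)"
  define L2 where "L2 p = form_eval 2 (\<omega>2 p) e" for p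
  define Lk where "Lk p = form_eval k (\<omega>k p) e" for p
  have L2e: "L2 p = Polynomial.coeff (\<omega>2 p) 0 * c\<^sup>2 + Polynomial.coeff (\<omega>2 p) 1 * c + Polynomial.coeff (\<omega>2 p) 2" for p
    by (simp add: L2_def form_eval_def e_def numeral_2_eq_2)
  have hL2: "holo2_at L2 0" unfolding L2e
    by (intro holo2_add holo2_mult holo2_const h2) auto
  have hLk: "holo2_at Lk 0" unfolding Lk_def form_eval_def
    by (intro holo2_sum holo2_mult holo2_const hk) auto
  have L20: "L2 0 \<noteq> 0" unfolding L2_def P form_eval_linear_prod using c2 by (auto simp: e_def)
  have fk: "r * form_eval k (\<omega>k 0) v = (\<Prod>j<k. ak j * fst v + bk j * snd v)" for v
    unfolding form_eval_smult[symmetric] Q form_eval_linear_prod ..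
  have "r * Lk 0 \<noteq> 0" unfolding Lk_def fk using ck by (auto simp: e_def)
  then have Lk0: "Lk 0 \<noteq> 0" by simp
  \<comment> \<open>The t for which (1, 0) + t (c, 1) lies in the kernel of the linear factor of
    index j.\<close>
  define q0 where "q0 j = - ak j / (ak j * c + bk j)" for j
  have q0: "q0 i \<noteq> q0 j" if "i < k" "j < k" "i \<noteq> j" for i j
  proof
    assume "q0 i = q0 j"
    then have "ak i * bk j - bk i * ak j = 0" using ck[OF that(1)] ck[OF that(2)]
      unfolding q0_def by (simp add: field_simps)
    then show False using disj that by blast
  qed
  have fk0: "form_eval k (\<omega>k 0) (1 + c * t, t) = Lk 0 * (\<Prod>j<k. t - q0 j)" for t
  proof -
    have "r * form_eval k (\<omega>k 0) (1 + c * t, t) = (\<Prod>j<k. (ak j * c + bk j) * (t - q0 j))"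
      unfolding fk by (rule prod.cong) (use ck in \<open>auto simp: q0_def field_simps\<close>)
    also have "\<dots> = r * (Lk 0 * (\<Prod>j<k. t - q0 j))"
      unfolding prod.distrib using fk[of e] by (simp add: Lk_def e_def)
    finally show ?thesis using r by simp
  qed
  define m where "m i t = (1 + c * t) ^ (k - i) * t ^ i" for i :: nat and t
  define m' where "m' i t = (of_nat (k - i) * (1 + c * t) ^ (k - i - 1) * c) * t ^ i + (1 + c * t) ^ (k - i) * (of_nat i * t ^ (i - 1))" for i :: nat and t
  have dm: "(m i has_field_derivative m' i t) (at t)" for i t
    unfolding m_def m'_def by (auto intro!: derivative_eq_intros simp: algebra_simps)
  have cm: "continuous_on UNIV (m' i)" for i unfolding m'_def by (intro continuous_intros)
  have fm: "form_eval k P (1 + c * t, t) = (\<Sum>i\<le>k. Polynomial.coeff P i * m i t)" for P t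
    by (simp add: form_eval_def m_def mult.assoc)
  have "\<exists>g. holo2_at g 0 \<and> g 0 = q0 j \<and> (\<forall>\<^sub>F p in nhds 0. (\<Sum>i\<le>k. Polynomial.coeff (\<omega>k p) i * m i (g p)) = 0)"
    if j: "j < k" for j
  proof (rule implicit_root[OF hk dm cm])
    show "(\<Sum>i\<le>k. Polynomial.coeff (\<omega>k 0) i * m i (q0 j)) = 0"
      unfolding fm[symmetric] fk0 using j by auto
    have "((\<lambda>t. \<Sum>i\<le>k. Polynomial.coeff (\<omega>k 0) i * m i t) has_field_derivative (\<Sum>i\<le>k. Polynomial.coeff (\<omega>k 0) i * m' i (q0 j))) (at (q0 j))"
      by (intro DERIV_sum DERIV_cmult dm)
    then have 1: "((\<lambda>t. Lk 0 * (\<Prod>j<k. t - q0 j)) has_field_derivative (\<Sum>i\<le>k. Polynomial.coeff (\<omega>k 0) i * m' i (q0 j))) (at (q0 j))"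
      unfolding fm[symmetric] fk0 .
    \<comment> \<open>Up to the factor \<open>Lk 0\<close>, the derivative at a root is the product
      of its differences with the other roots, nonzero because the roots are simple.\<close>
    define R where "R t = (\<Prod>i\<in>{..<k} - {j}. t - q0 i)" for t
    have "(\<Prod>j<k. t - q0 j) = (t - q0 j) * R t" for t
      unfolding R_def by (rule prod.remove) (use j in auto)
    then have eq: "(\<lambda>t. Lk 0 * (\<Prod>j<k. t - q0 j)) = (\<lambda>t. Lk 0 * ((t - q0 j) * R t))" by simp
    have "(R has_field_derivative deriv R (q0 j)) (at (q0 j))"
      unfolding R_def by (intro field_differentiable_derivI holomorphic_on_imp_differentiable_at[OF _ open_UNIV] holomorphic_intros) auto
    then have "((\<lambda>t. Lk 0 * ((t - q0 j) * R t)) has_field_derivative Lk 0 * R (q0 j)) (at (q0 j))"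
      by (auto intro!: derivative_eq_intros)
    then have "(\<Sum>i\<le>k. Polynomial.coeff (\<omega>k 0) i * m' i (q0 j)) = Lk 0 * R (q0 j)"
      using 1 unfolding eq using DERIV_unique by blast
    moreover have "R (q0 j) \<noteq> 0" unfolding R_def using q0 j by auto
    ultimately show "(\<Sum>i\<le>k. Polynomial.coeff (\<omega>k 0) i * m' i (q0 j)) \<noteq> 0" using Lk0 by simp
  qed
  then have "\<forall>j. \<exists>g. j < k \<longrightarrow> holo2_at g 0 \<and> g 0 = q0 j \<and>
      (\<forall>\<^sub>F p in nhds 0. (\<Sum>i\<le>k. Polynomial.coeff (\<omega>k p) i * m i (g p)) = 0)" by blast
  from choice[OF this] obtain q where q: "\<And>j. j < k \<Longrightarrow> holo2_at (q j) 0" "\<And>j. j < k \<Longrightarrow> q j 0 = q0 j"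
    "\<And>j. j < k \<Longrightarrow> \<forall>\<^sub>F p in nhds 0. (\<Sum>i\<le>k. Polynomial.coeff (\<omega>k p) i * m i (q j p)) = 0"
    by blast
  have "\<forall>\<^sub>F p in nhds 0. \<forall>j\<in>{..<k}. form_eval k (\<omega>k p) (1 + c * q j p, q j p) = 0"
    using q(3) unfolding fm by (intro eventually_ball_finite) auto
  moreover have "\<forall>\<^sub>F p in nhds 0. \<forall>ij\<in>{..<k} \<times> {..<k}. fst ij \<noteq> snd ij \<longrightarrow> q (fst ij) p \<noteq> q (snd ij) p"
  proof (intro eventually_ball_finite ballI)
    fix ij assume ij: "ij \<in> {..<k} \<times> {..<k}"
    have "\<forall>\<^sub>F p in nhds 0. q (fst ij) p - q (snd ij) p \<noteq> 0" if "fst ij \<noteq> snd ij"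
      using ij that q q0 by (intro holo2_eventually_ne holo2_diff) auto
    then show "\<forall>\<^sub>F p in nhds 0. fst ij \<noteq> snd ij \<longrightarrow> q (fst ij) p \<noteq> q (snd ij) p"
      by (cases "fst ij = snd ij") (auto elim: eventually_mono)
  qed auto
  ultimately have evk: "\<forall>\<^sub>F p in nhds 0. \<omega>k p = Polynomial.smult (Lk p) (\<Prod>i<k. slope_form c (q i p))"
    using degk
  proof eventually_elim
    case (elim p)
    define R where "R = linear_prod k (\<lambda>i. - q i p) (\<lambda>i. 1 + c * q i p)"
    \<comment> \<open>The k tangent vectors together with e = (c, 1): a form of degree k that
      vanishes on all k + 1 of them is zero, and the factor \<open>Lk p\<close> is the one that
      makes the difference vanish on e.\<close>
    define v where "v j = (if j < k then (1 + c * q j p, q j p) else e)" for j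
    have fR: "form_eval k R w = (\<Prod>i<k. - q i p * fst w + (1 + c * q i p) * snd w)" for w
      unfolding R_def form_eval_linear_prod ..
    have Re: "form_eval k R e = 1" unfolding fR by (simp add: e_def algebra_simps)
    have Rq: "form_eval k R (1 + c * q j p, q j p) = 0" if "j < k" for j
      unfolding fR using that by (intro prod_zero bexI[of _ j]) (auto simp: algebra_simps)
    have "\<omega>k p - Polynomial.smult (Lk p) R = 0"
    proof (rule form_zero_of_many_zeros[OF _ k])
      show "Polynomial.degree (\<omega>k p - Polynomial.smult (Lk p) R) \<le> k"
        using elim(3) degree_linear_prod[of k] degree_smult_le[of "Lk p" R]
        by (intro degree_diff_le) (auto simp: R_def)
      show "form_eval k (\<omega>k p - Polynomial.smult (Lk p) R) (v j) = 0" if "j \<le> k" for j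
        unfolding form_eval_diff form_eval_smult
        using elim(1) Rq[of j] Re by (auto simp: v_def Lk_def)
      have wq: "wedge (1 + c * x, x) (1 + c * y, y) = y - x" "wedge (1 + c * x, x) e = 1" "wedge e (1 + c * x, x) = - 1" for x y
        by (simp_all add: wedge_def e_def algebra_simps)
      show "wedge (v i) (v j) \<noteq> 0" if "i \<le> k" "j \<le> k" "i \<noteq> j" for i j
        using that elim(2) wq by (auto simp: v_def)
    qed
    then show ?case by (simp add: R_def linear_prod_def slope_form_def)
  qed
  \<comment> \<open>Completing the square: on (1, 0) + t (c, 1) the form \<omega>2 takes the value
    L2 ((t - u)^2 - E). The change of frame has determinant 1, so E is the usual discriminant of
    \<omega>2 divided by 4 L2^2.\<close>
  define u where "u p = - (2 * Polynomial.coeff (\<omega>2 p) 0 * c + Polynomial.coeff (\<omega>2 p) 1) / (2 * L2 p)" for p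
  define E where "E p = ((Polynomial.coeff (\<omega>2 p) 1)\<^sup>2 - 4 * Polynomial.coeff (\<omega>2 p) 0 * Polynomial.coeff (\<omega>2 p) 2) / (4 * (L2 p)\<^sup>2)" for p
  have hu: "holo2_at u 0" unfolding u_def
    by (intro holo2_divide holo2_uminus holo2_add holo2_mult holo2_const h2 hL2) (use L20 in auto)
  have hE: "holo2_at E 0" unfolding E_def
    by (intro holo2_divide holo2_diff holo2_power holo2_mult holo2_const h2 hL2) (use L20 in auto)
  have evL: "\<forall>\<^sub>F p in nhds 0. L2 p \<noteq> 0" by (rule holo2_eventually_ne[OF hL2 L20])
  have ev2: "\<forall>\<^sub>F p in nhds 0. \<omega>2 p = Polynomial.smult (L2 p) ((slope_form c (u p))\<^sup>2 - Polynomial.smult (E p) ([:1, - c:]\<^sup>2))"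
    using evL deg2
  proof eventually_elim
    case (elim p)
    let ?a = "Polynomial.coeff (\<omega>2 p)"
    have cf: "\<omega>2 p = [:?a 0, ?a 1, ?a 2:]"
    proof (rule poly_eqI)
      fix n show "?a n = Polynomial.coeff [:?a 0, ?a 1, ?a 2:] n"
        using elim(2) coeff_eq_0[of "\<omega>2 p" n] by (auto simp: coeff_pCons numeral_2_eq_2 split: nat.splits)
    qed
    have 1: "2 * L2 p * u p = - (2 * ?a 0 * c + ?a 1)" using elim(1) by (simp add: u_def)
    have 2: "4 * (L2 p)\<^sup>2 * E p = (?a 1)\<^sup>2 - 4 * ?a 0 * ?a 2" using elim(1) by (simp add: E_def)
    have L: "L2 p = ?a 0 * c\<^sup>2 + ?a 1 * c + ?a 2" by (rule L2e)
    have K: "(2 * ?a 0 * c + ?a 1)\<^sup>2 - ((?a 1)\<^sup>2 - 4 * ?a 0 * ?a 2) = 4 * ?a 0 * L2 p"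
      unfolding L by (simp add: power2_eq_square algebra_simps)
    have A0: "L2 p * ((u p)\<^sup>2 - E p) = ?a 0"
    proof -
      have "4 * L2 p * (L2 p * ((u p)\<^sup>2 - E p)) = (2 * L2 p * u p)\<^sup>2 - 4 * (L2 p)\<^sup>2 * E p"
        by (simp add: power2_eq_square algebra_simps)
      also have "\<dots> = 4 * L2 p * ?a 0" unfolding 1 2 power2_minus K by (simp add: mult_ac)
      finally show ?thesis using elim(1) by simp
    qed
    have A1: "L2 p * (- 2 * u p * (1 + c * u p) + 2 * c * E p) = ?a 1"
    proof -
      have "4 * L2 p * (L2 p * (- 2 * u p * (1 + c * u p) + 2 * c * E p)) =
          - 4 * L2 p * (2 * L2 p * u p) - 2 * c * ((2 * L2 p * u p)\<^sup>2 - 4 * (L2 p)\<^sup>2 * E p)"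
        by (simp add: power2_eq_square algebra_simps)
      also have "\<dots> = 4 * L2 p * ?a 1" unfolding 1 2 power2_minus K by (simp add: algebra_simps)
      finally show ?thesis using elim(1) by simp
    qed
    have A2: "L2 p * ((1 + c * u p)\<^sup>2 - E p * c\<^sup>2) = ?a 2"
    proof -
      have "4 * L2 p * (L2 p * ((1 + c * u p)\<^sup>2 - E p * c\<^sup>2)) =
          4 * L2 p * L2 p + 4 * L2 p * c * (2 * L2 p * u p) + c\<^sup>2 * ((2 * L2 p * u p)\<^sup>2 - 4 * (L2 p)\<^sup>2 * E p)"
        by (simp add: power2_eq_square algebra_simps)
      also have "\<dots> = 4 * L2 p * (L2 p - c * (2 * ?a 0 * c + ?a 1) + c\<^sup>2 * ?a 0)"
        unfolding 1 2 power2_minus K by (simp add: algebra_simps)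
      also have "L2 p - c * (2 * ?a 0 * c + ?a 1) + c\<^sup>2 * ?a 0 = ?a 2"
        unfolding L by (simp add: power2_eq_square algebra_simps)
      finally show ?thesis using elim(1) by simp
    qed
    have "(slope_form c (u p))\<^sup>2 - Polynomial.smult (E p) ([:1, - c:]\<^sup>2) =
       [:(u p)\<^sup>2 - E p, - 2 * u p * (1 + c * u p) + 2 * c * E p, (1 + c * u p)\<^sup>2 - E p * c\<^sup>2:]"
      by (simp add: slope_form_def power2_eq_square algebra_simps)
    then show ?case using A0 A1 A2 by (subst cf) simp
  qed
  have "web_disc (k + 2) \<omega> 0 = 0" using S by (simp add: disc_support_def)
  obtain u1 where u1: "holo2_at u1 0" "u1 0 \<noteq> 0" "\<forall>\<^sub>F p in nhds 0. web_disc 2 \<omega>2 p = u1 p * web_disc (k + 2) \<omega> p"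
    using d unfolding same_divisor_def by blast
  have evS: "\<forall>\<^sub>F p in nhds 0. p \<in> disc_support (k + 2) \<omega> \<longleftrightarrow> E p = 0"
    using u1(3) holo2_eventually_ne[OF u1(1,2)] evL deg2
  proof eventually_elim
    case (elim p)
    have "p \<in> disc_support (k + 2) \<omega> \<longleftrightarrow> form_disc 2 (\<omega>2 p) = 0"
      using elim(1,2) by (simp add: disc_support_def web_disc_def)
    then show ?case using elim(3) unfolding form_disc_quadratic_zero_iff[OF elim(4)] by (simp add: E_def)
  qed
  have E0: "E 0 = 0" using eventually_nhds_x_imp_x[OF evS] S by simp
  have qu: "q i 0 \<noteq> u 0" if i: "i < k" for i
  proof
    assume "q i 0 = u 0"
    then have eq: "q0 i = u 0" using q(2)[OF i] by simp
    \<comment> \<open>At the origin E = 0, so u is the slope of a tangent of \<omega>2; sharing it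
      with \<omega>k contradicts the nonvanishing of the resultant.\<close>
    from eventually_nhds_x_imp_x[OF ev2] E0
    have w0: "\<omega>2 0 = Polynomial.smult (L2 0) (linear_prod 2 (\<lambda>i. - u 0) (\<lambda>i. 1 + c * u 0))"
      by (simp add: linear_prod_def slope_form_def numeral_2_eq_2)
    have "form_eval 2 (\<omega>2 0) (1 + c * q0 i, q0 i) = 0"
      unfolding w0 form_eval_smult form_eval_linear_prod eq by (simp add: algebra_simps)
    then obtain j where j: "j < 2" "a2 j * (1 + c * q0 i) + b2 j * q0 i = 0"
      unfolding P form_eval_linear_prod by auto
    have "ak i * (1 + c * q0 i) + bk i * q0 i = 0" using ck[OF i] by (simp add: q0_def field_simps)
    moreover have "(a2 j * bk i - b2 j * ak i) * (1 + c * q0 i) =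
        bk i * (a2 j * (1 + c * q0 i) + b2 j * q0 i) - b2 j * (ak i * (1 + c * q0 i) + bk i * q0 i)"
      "(a2 j * bk i - b2 j * ak i) * q0 i =
        a2 j * (ak i * (1 + c * q0 i) + bk i * q0 i) - ak i * (a2 j * (1 + c * q0 i) + b2 j * q0 i)"
      by (simp_all add: algebra_simps)
    ultimately have "(a2 j * bk i - b2 j * ak i) * (1 + c * q0 i) = 0" "(a2 j * bk i - b2 j * ak i) * q0 i = 0"
      using j(2) by simp_all
    then show False using cross[OF j(1) i] by (auto simp: add_eq_0_iff)
  qed
  have qq: "q i 0 \<noteq> q j 0" if "i < k" "j < k" "i \<noteq> j" for i j using q(2) q0 that by simp
  show ?thesis
    by (rule exI[of _ c], rule exI[of _ q], rule exI[of _ u], rule exI[of _ E], rule exI[of _ Lk], rule exI[of _ L2])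
      (use q(1) hu hE hLk hL2 Lk0 L20 E0 qq qu evk ev2 evS in blast)
qed

section \<open>Curvature in terms of slopes\<close>

text \<open>The derivative along (c, 1). As c is constant it commutes with \<open>partial_x\<close>,
  so 1-forms given by their values on (1, 0) and (c, 1) have an exterior derivative of the usual
  shape.\<close>

definition De :: "complex \<Rightarrow> (point \<Rightarrow> complex) \<Rightarrow> point \<Rightarrow> complex" where
  "De c f p = c * partial_x f p + partial_y f p"

lemma holo2_De: "holo2_at f p \<Longrightarrow> holo2_at (De c f) p"
  unfolding De_def by (intro holo2_add holo2_mult holo2_const holo2_partial_x holo2_partial_y)

lemma De_cong: "\<forall>\<^sub>F q in nhds p. f q = g q \<Longrightarrow> De c f p = De c g p"
  unfolding De_def using partial_cong by simp

lemma D_add: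
  assumes "holo2_at f p" "holo2_at g p"
  shows "partial_x (\<lambda>q. f q + g q) p = partial_x f p + partial_x g p"
    and "De c (\<lambda>q. f q + g q) p = De c f p + De c g p"
  using hasd_partial[OF hasd_add[OF assms[THEN holo2_hasd]]] by (simp_all add: De_def algebra_simps)

lemma D_diff:
  assumes "holo2_at f p" "holo2_at g p"
  shows "partial_x (\<lambda>q. f q - g q) p = partial_x f p - partial_x g p"
    and "De c (\<lambda>q. f q - g q) p = De c f p - De c g p"
  unfolding De_def hasd_partial[OF hasd_diff[OF assms[THEN holo2_hasd]]] by (simp_all add: algebra_simps)

lemma D_mult:
  assumes "holo2_at f p" "holo2_at g p"
  shows "partial_x (\<lambda>q. f q * g q) p = partial_x f p * g p + f p * partial_x g p"
    and "De c (\<lambda>q. f q * g q) p = De c f p * g p + f p * De c g p"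
  using hasd_partial[OF hasd_mult[OF assms[THEN holo2_hasd]]] by (simp_all add: De_def algebra_simps)

lemma D_divide:
  assumes "holo2_at f p" "holo2_at g p" "g p \<noteq> 0"
  shows "partial_x (\<lambda>q. f q / g q) p = (partial_x f p * g p - f p * partial_x g p) / (g p)\<^sup>2"
    and "De c (\<lambda>q. f q / g q) p = (De c f p * g p - f p * De c g p) / (g p)\<^sup>2"
  unfolding De_def hasd_partial[OF hasd_divide[OF assms(1,2)[THEN holo2_hasd] assms(3)]]
  using assms(3) by (simp_all add: field_simps)

lemma D_const: "partial_x (\<lambda>_. k) p = 0" "De c (\<lambda>_. k) p = 0"
  using hasd_partial[OF hasd_const[of k p]] by (simp_all add: De_def)

lemma D_uminus:
  assumes "holo2_at f p"
  shows "partial_x (\<lambda>q. - f q) p = - partial_x f p" and "De c (\<lambda>q. - f q) p = - De c f p"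
  using D_diff[OF holo2_const[of 0] assms] D_const by simp_all

lemma D_sum:
  assumes "\<And>i. i \<in> A \<Longrightarrow> holo2_at (f i) p"
  shows "partial_x (\<lambda>q. \<Sum>i\<in>A. f i q) p = (\<Sum>i\<in>A. partial_x (f i) p)"
    and "De c (\<lambda>q. \<Sum>i\<in>A. f i q) p = (\<Sum>i\<in>A. De c (f i) p)"
proof -
  have "hasd (\<lambda>q. \<Sum>i\<in>A. f i q) (\<Sum>i\<in>A. partial_x (f i) p) (\<Sum>i\<in>A. partial_y (f i) p) p"
    by (rule hasd_sum) (rule holo2_hasd[OF assms])
  from hasd_partial[OF this]
  show "partial_x (\<lambda>q. \<Sum>i\<in>A. f i q) p = (\<Sum>i\<in>A. partial_x (f i) p)"
    and "De c (\<lambda>q. \<Sum>i\<in>A. f i q) p = (\<Sum>i\<in>A. De c (f i) p)"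
    by (simp_all add: De_def sum.distrib sum_distrib_left)
qed

lemma D_commute:
  assumes "holo2_at f p" shows "partial_x (De c f) p = De c (partial_x f) p"
proof -
  note h = holo2_partial_x[OF assms] holo2_partial_y[OF assms]
  have "partial_x (\<lambda>q. c * partial_x f q + partial_y f q) p = c * partial_x (partial_x f) p + partial_x (partial_y f) p"
    using D_add(1)[OF holo2_mult[OF holo2_const h(1)] h(2)] D_mult(1)[OF holo2_const h(1)] by (simp add: D_const)
  then show ?thesis unfolding De_def[abs_def] using partial_commute[OF assms] by simp
qed

text \<open>The 1-form with values \<open>X\<close> on \<open>(1, 0)\<close> and \<open>E\<close> on \<open>(c, 1)\<close> has exterior derivative \<open>curl c X E\<close>.\<close>

definition curl :: "complex \<Rightarrow> (point \<Rightarrow> complex) \<Rightarrow> (point \<Rightarrow> complex) \<Rightarrow> point \<Rightarrow> complex" where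
  "curl c X E p = partial_x E p - De c X p"

lemma ext_deriv_curl:
  assumes "holo_form_at \<alpha> p"
  shows "ext_deriv \<alpha> p = curl c (\<lambda>q. fst (\<alpha> q)) (\<lambda>q. c * fst (\<alpha> q) + snd (\<alpha> q)) p"
proof -
  have h: "holo2_at (\<lambda>q. fst (\<alpha> q)) p" "holo2_at (\<lambda>q. snd (\<alpha> q)) p"
    using assms by (simp_all add: holo_form_at_def)
  have "partial_x (\<lambda>q. c * fst (\<alpha> q) + snd (\<alpha> q)) p = c * partial_x (\<lambda>q. fst (\<alpha> q)) p + partial_x (\<lambda>q. snd (\<alpha> q)) p"
    using D_add(1)[OF holo2_mult[OF holo2_const h(1)] h(2)] D_mult(1)[OF holo2_const h(1)] by (simp add: D_const)
  then show ?thesis by (simp add: ext_deriv_def curl_def De_def)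
qed

lemma curl_cong:
  assumes "\<forall>\<^sub>F q in nhds p. X q = X' q" "\<forall>\<^sub>F q in nhds p. E q = E' q"
  shows "curl c X E p = curl c X' E' p"
  unfolding curl_def using partial_cong(1)[OF assms(2)] De_cong[OF assms(1)] by simp

lemma curl_add:
  assumes "holo2_at X p" "holo2_at E p" "holo2_at X' p" "holo2_at E' p"
  shows "curl c (\<lambda>q. X q + X' q) (\<lambda>q. E q + E' q) p = curl c X E p + curl c X' E' p"
  unfolding curl_def using D_add(1)[OF assms(2,4)] D_add(2)[OF assms(1,3)] by simp

lemma curl_sum:
  assumes "\<And>i. i \<in> A \<Longrightarrow> holo2_at (X i) p" "\<And>i. i \<in> A \<Longrightarrow> holo2_at (E i) p"
  shows "curl c (\<lambda>q. \<Sum>i\<in>A. X i q) (\<lambda>q. \<Sum>i\<in>A. E i q) p = (\<Sum>i\<in>A. curl c (X i) (E i) p)"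
  unfolding curl_def using D_sum(1)[of A E, OF assms(2)] D_sum(2)[of A X, OF assms(1)] by (simp add: sum_subtractf)

text \<open>The form dF / F is closed; this is why rescaling the defining 1-forms by units does not
  change the curvature.\<close>

lemma curl_log_deriv:
  assumes "holo2_at F p" "F p \<noteq> 0"
  shows "curl c (\<lambda>q. partial_x F q / F q) (\<lambda>q. De c F q / F q) p = 0"
  unfolding curl_def
  using D_divide(1)[OF holo2_De[OF assms(1)] assms] D_divide(2)[OF holo2_partial_x[OF assms(1)] assms]
    D_commute[OF assms(1)]
  by (simp add: diff_divide_distrib mult.commute)

text \<open>For the foliations of slopes \<open>a\<close>, \<open>b\<close>, \<open>d\<close> (in the frame \<open>(1, 0)\<close>, \<open>(c, 1)\<close>) defined by forms that are
  \<open>1\<close> on \<open>(c, 1)\<close>, the value of \<open>\<eta>\<close> on the vector \<open>(1, 0) + a (c, 1)\<close> is \<open>eta_val c a b d\<close>.\<close>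

definition eta_val :: "complex \<Rightarrow> (point \<Rightarrow> complex) \<Rightarrow> (point \<Rightarrow> complex) \<Rightarrow> (point \<Rightarrow> complex) \<Rightarrow> point \<Rightarrow> complex" where
  "eta_val c a b d q = (partial_x b q - partial_x d q + a q * (De c b q - De c d q)) / (b q - d q) + De c a q"

text \<open>A 1-form with values X on (1, 0) and E on (c, 1) takes the value X + a E on (1, 0) + a
  (c, 1). Here \<open>eta_e\<close> and \<open>eta_x\<close> are the E and X interpolated from the
  values of \<eta> on the first two leaves.\<close>

definition eta_e :: "complex \<Rightarrow> (point \<Rightarrow> complex) \<Rightarrow> (point \<Rightarrow> complex) \<Rightarrow> (point \<Rightarrow> complex) \<Rightarrow> point \<Rightarrow> complex" where
  "eta_e c a b d q = (eta_val c a b d q - eta_val c b a d q) / (a q - b q)"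

definition eta_x :: "complex \<Rightarrow> (point \<Rightarrow> complex) \<Rightarrow> (point \<Rightarrow> complex) \<Rightarrow> (point \<Rightarrow> complex) \<Rightarrow> point \<Rightarrow> complex" where
  "eta_x c a b d q = eta_val c a b d q - a q * eta_e c a b d q"

definition slope_curv :: "complex \<Rightarrow> (point \<Rightarrow> complex) \<Rightarrow> (point \<Rightarrow> complex) \<Rightarrow> (point \<Rightarrow> complex) \<Rightarrow> point \<Rightarrow> complex" where
  "slope_curv c a b d = curl c (eta_x c a b d) (eta_e c a b d)"

section \<open>Symmetry and regularity of the form \<eta>\<close>

lemma eta_val_commute: "eta_val c a b d q = eta_val c a d b q"
proof -
  have "partial_x d q - partial_x b q + a q * (De c d q - De c b q) = - (partial_x b q - partial_x d q + a q * (De c b q - De c d q))"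
    "d q - b q = - (b q - d q)" by (simp_all add: algebra_simps)
  then show ?thesis unfolding eta_val_def by (simp only: minus_divide_divide)
qed

lemma two_point_affine:
  fixes a b X E A B :: complex
  assumes "a \<noteq> b"
  shows "X + a * E = A \<and> X + b * E = B \<longleftrightarrow> E = (A - B) / (a - b) \<and> X = A - a * ((A - B) / (a - b))"
proof -
  define k where "k = (A - B) / (a - b)"
  have k: "k * (a - b) = A - B" using assms by (simp add: k_def)
  have "E = k" if "X + a * E = A" "X + b * E = B"
  proof -
    have "E * (a - b) = k * (a - b)" unfolding k that[symmetric] by (simp add: algebra_simps)
    then show ?thesis using assms by simp
  qed
  moreover have "A - a * k + b * k = B" using k by (simp add: algebra_simps)
  ultimately have "X + a * E = A \<and> X + b * E = B \<longleftrightarrow> E = k \<and> X = A - a * k" by auto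
  then show ?thesis unfolding k_def .
qed

lemma eta_vals:
  assumes "a q \<noteq> b q"
  shows "eta_x c a b d q + a q * eta_e c a b d q = eta_val c a b d q"
    and "eta_x c a b d q + b q * eta_e c a b d q = eta_val c b a d q"
  using two_point_affine[OF assms, of "eta_x c a b d q" "eta_e c a b d q"]
  unfolding eta_x_def eta_e_def by blast+

text \<open>The three equations for \<eta> are dependent, because the forms \<delta>_st \<omega>_r,
  \<delta>_tr \<omega>_s, \<delta>_rs \<omega>_t add up to zero in dimension two. So the form fixed
  by two of them also satisfies the third.\<close>

lemma eta_val_third:
  assumes ab: "a q \<noteq> b q" and ad: "a q \<noteq> d q" and bd: "b q \<noteq> d q"
  shows "eta_x c a b d q + d q * eta_e c a b d q = eta_val c d a b q"
proof -
  have a: "eta_val c a b d q * (d q - b q) = - (partial_x b q - partial_x d q + a q * (De c b q - De c d q)) + De c a q * (d q - b q)"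
    using bd by (simp add: eta_val_def field_simps)
  have b: "eta_val c b a d q * (a q - d q) = partial_x a q - partial_x d q + b q * (De c a q - De c d q) + De c b q * (a q - d q)"
    using ad by (simp add: eta_val_def field_simps)
  have d: "eta_val c d a b q * (a q - b q) = partial_x a q - partial_x b q + d q * (De c a q - De c b q) + De c d q * (a q - b q)"
    using ab by (simp add: eta_val_def field_simps)
  have "(eta_x c a b d q + d q * eta_e c a b d q) * (a q - b q) =
      eta_val c a b d q * (d q - b q) + eta_val c b a d q * (a q - d q)"
  proof -
    have e: "eta_e c a b d q * (a q - b q) = eta_val c a b d q - eta_val c b a d q" using ab by (simp add: eta_e_def)
    have s: "(eta_x c a b d q + d q * eta_e c a b d q) * (a q - b q) =
        eta_val c a b d q * (a q - b q) + (d q - a q) * (eta_e c a b d q * (a q - b q))"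
      unfolding eta_x_def by (simp add: algebra_simps)
    show ?thesis unfolding s e by (simp add: algebra_simps)
  qed
  also have "\<dots> = eta_val c d a b q * (a q - b q)"
    unfolding a b d by (simp add: algebra_simps)
  finally show ?thesis using ab by simp
qed

lemma eta_unique:
  assumes "a q \<noteq> b q" "X + a q * E = eta_val c a b d q" "X + b q * E = eta_val c b a d q"
  shows "X = eta_x c a b d q" "E = eta_e c a b d q"
  using two_point_affine[OF assms(1), of X E] assms(2,3) unfolding eta_x_def eta_e_def by blast+

lemma eta_swap12:
  assumes "a q \<noteq> b q"
  shows "eta_x c a b d q = eta_x c b a d q" "eta_e c a b d q = eta_e c b a d q"
  using eta_unique[of b q a "eta_x c a b d q" "eta_e c a b d q" c d] eta_vals[of a q b, OF assms, of c d] assms by auto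

lemma eta_swap23:
  assumes "a q \<noteq> b q" "a q \<noteq> d q" "b q \<noteq> d q"
  shows "eta_x c a b d q = eta_x c a d b q" "eta_e c a b d q = eta_e c a d b q"
  using eta_unique[of a q d "eta_x c a b d q" "eta_e c a b d q" c b] eta_vals[of a q b, OF assms(1), of c d]
    eta_val_third[of a q b d, OF assms, of c] eta_val_commute assms by auto

lemma holo2_eta_val:
  assumes "holo2_at a p" "holo2_at b p" "holo2_at d p" "b p \<noteq> d p"
  shows "holo2_at (eta_val c a b d) p"
  unfolding eta_val_def
  by (intro holo2_add holo2_divide holo2_diff holo2_mult holo2_partial_x holo2_De assms) (use assms in simp)

lemma holo2_eta:
  assumes "holo2_at a p" "holo2_at b p" "holo2_at d p" "a p \<noteq> b p" "a p \<noteq> d p" "b p \<noteq> d p"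
  shows "holo2_at (eta_x c a b d) p" "holo2_at (eta_e c a b d) p"
proof -
  show e: "holo2_at (eta_e c a b d) p"
    unfolding eta_e_def by (intro holo2_divide holo2_diff holo2_eta_val assms) (use assms in auto)
  show "holo2_at (eta_x c a b d) p"
    unfolding eta_x_def by (intro holo2_diff holo2_mult holo2_eta_val e assms)
qed

lemma holo2_distinct_near:
  assumes "holo2_at a p" "holo2_at b p" "a p \<noteq> b p" shows "\<forall>\<^sub>F q in nhds p. a q \<noteq> b q"
  using holo2_eventually_ne[OF holo2_diff[OF assms(1,2)], of 0] assms(3) by (auto elim: eventually_mono)

lemma slope_curv_swap12:
  assumes "holo2_at a p" "holo2_at b p" "a p \<noteq> b p"
  shows "slope_curv c a b d p = slope_curv c b a d p"
  unfolding slope_curv_def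
  by (rule curl_cong) (use holo2_distinct_near[OF assms] in eventually_elim, use eta_swap12 in blast)+

lemma slope_curv_swap23:
  assumes "holo2_at a p" "holo2_at b p" "holo2_at d p" "a p \<noteq> b p" "a p \<noteq> d p" "b p \<noteq> d p"
  shows "slope_curv c a b d p = slope_curv c a d b p"
  unfolding slope_curv_def
  by (rule curl_cong) (use holo2_distinct_near[OF assms(1,2,4)] holo2_distinct_near[OF assms(1,3,5)] holo2_distinct_near[OF assms(2,3,6)]
      in eventually_elim, use eta_swap23 in blast)+

text \<open>The general equation of the foliation of slope a. Its value f on (c, 1) is left free
  because a local factorization does not fix the scaling of its factors.\<close>

definition slope_oneform :: "complex \<Rightarrow> (point \<Rightarrow> complex) \<Rightarrow> (point \<Rightarrow> complex) \<Rightarrow> oneform" where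
  "slope_oneform c f a q = (- (a q * f q), f q * (1 + c * a q))"

lemma holo_slope_oneform: "holo2_at f p \<Longrightarrow> holo2_at a p \<Longrightarrow> holo_form_at (slope_oneform c f a) p"
  unfolding holo_form_at_def slope_oneform_def fst_conv snd_conv
  by (intro conjI holo2_uminus holo2_mult holo2_add holo2_const)

lemma wedge_slope_oneform: "wedge (slope_oneform c f a q) (slope_oneform c g b q) = f q * g q * (b q - a q)"
  by (simp add: wedge_def slope_oneform_def algebra_simps)

text \<open>All three forms \<delta>_st \<omega>_r acquire the same factor F = f g h, so \<eta> is
  the one for f = g = h = 1 plus dF / F. In the second formula (X, e - c X) is the 1-form with
  values X on (1, 0) and e on (c, 1).\<close>

lemma ext_deriv_triple:
  assumes h: "holo2_at f q" "holo2_at g q" "holo2_at h q" "holo2_at a q" "holo2_at b q" "holo2_at d q"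
    and nz: "f q \<noteq> 0" "g q \<noteq> 0" "h q \<noteq> 0" "b q \<noteq> d q"
  defines "F \<equiv> \<lambda>q. f q * g q * h q"
  shows "ext_deriv (\<lambda>q. cscale (wedge (slope_oneform c g b q) (slope_oneform c h d q)) (slope_oneform c f a q)) q =
    F q * (d q - b q) * (eta_val c a b d q + (partial_x F q / F q + a q * (De c F q / F q)))"
    and "wedge (X, e - c * X) (cscale (wedge (slope_oneform c g b q) (slope_oneform c h d q)) (slope_oneform c f a q)) =
    F q * (d q - b q) * (X + a q * e)"
proof -
  define M where "M q = F q * (d q - b q)" for q
  have A: "cscale (wedge (slope_oneform c g b q) (slope_oneform c h d q)) (slope_oneform c f a q) = slope_oneform c M a q" for q
    by (simp add: wedge_slope_oneform) (simp add: cscale_def slope_oneform_def M_def F_def mult_ac)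
  have hF: "holo2_at F q" unfolding F_def by (intro holo2_mult h)
  have hM: "holo2_at M q" unfolding M_def by (intro holo2_mult holo2_diff hF h)
  have F0: "F q \<noteq> 0" using nz by (simp add: F_def)
  have "ext_deriv (slope_oneform c M a) q = curl c (\<lambda>q. - (a q * M q)) M q"
    using ext_deriv_curl[OF holo_slope_oneform[OF hM h(4)], of c c] by (simp add: slope_oneform_def algebra_simps)
  also have "\<dots> = partial_x M q + (De c a q * M q + a q * De c M q)"
    unfolding curl_def using D_uminus(2)[OF holo2_mult[OF h(4) hM]] D_mult(2)[OF h(4) hM] by simp
  also have "partial_x M q = partial_x F q * (d q - b q) + F q * (partial_x d q - partial_x b q)"
    unfolding M_def using D_mult(1)[OF hF holo2_diff[OF h(6,5)]] D_diff(1)[OF h(6,5)] by simp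
  also have "De c M q = De c F q * (d q - b q) + F q * (De c d q - De c b q)"
    unfolding M_def using D_mult(2)[OF hF holo2_diff[OF h(6,5)]] D_diff(2)[OF h(6,5)] by simp
  also have "partial_x F q * (d q - b q) + F q * (partial_x d q - partial_x b q) +
      (De c a q * M q + a q * (De c F q * (d q - b q) + F q * (De c d q - De c b q))) =
      F q * (d q - b q) * (eta_val c a b d q + (partial_x F q / F q + a q * (De c F q / F q)))"
  proof -
    have "(d q - b q) * eta_val c a b d q = - (partial_x b q - partial_x d q + a q * (De c b q - De c d q)) + De c a q * (d q - b q)"
      using nz(4) by (simp add: eta_val_def field_simps)
    moreover have "F q * (partial_x F q / F q) = partial_x F q" "F q * (De c F q / F q) = De c F q" using F0 by simp_all
    moreover have "F q * (d q - b q) * (eta_val c a b d q + (partial_x F q / F q + a q * (De c F q / F q))) =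
       F q * ((d q - b q) * eta_val c a b d q) + (d q - b q) * (F q * (partial_x F q / F q)) + (d q - b q) * a q * (F q * (De c F q / F q))"
      by (simp only: distrib_left mult_ac add.assoc)
    ultimately have "F q * (d q - b q) * (eta_val c a b d q + (partial_x F q / F q + a q * (De c F q / F q))) =
       F q * (- (partial_x b q - partial_x d q + a q * (De c b q - De c d q)) + De c a q * (d q - b q)) + (d q - b q) * partial_x F q + (d q - b q) * a q * De c F q"
      by simp
    then show ?thesis by (simp add: M_def algebra_simps)
  qed
  finally show "ext_deriv (\<lambda>q. cscale (wedge (slope_oneform c g b q) (slope_oneform c h d q)) (slope_oneform c f a q)) q =
    F q * (d q - b q) * (eta_val c a b d q + (partial_x F q / F q + a q * (De c F q / F q)))"
    unfolding A .
  show "wedge (X, e - c * X) (cscale (wedge (slope_oneform c g b q) (slope_oneform c h d q)) (slope_oneform c f a q)) =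
    F q * (d q - b q) * (X + a q * e)"
    unfolding A by (simp add: wedge_def slope_oneform_def M_def algebra_simps)
qed

lemma eta_at_exists:
  assumes h: "holo2_at f p" "holo2_at g p" "holo2_at h p" "holo2_at a p" "holo2_at b p" "holo2_at d p"
    and nz: "f p \<noteq> 0" "g p \<noteq> 0" "h p \<noteq> 0" and ne: "a p \<noteq> b p" "a p \<noteq> d p" "b p \<noteq> d p"
  shows "\<exists>\<eta>. eta_at p (slope_oneform c f a) (slope_oneform c g b) (slope_oneform c h d) \<eta>"
proof -
  define F where "F q = f q * g q * h q" for q
  have hF: "holo2_at F p" and F0: "F p \<noteq> 0" unfolding F_def using nz by (auto intro!: holo2_mult h)
  define X where "X q = eta_x c a b d q + partial_x F q / F q" for q
  define e where "e q = eta_e c a b d q + De c F q / F q" for q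
  have "holo2_at X p" "holo2_at e p" unfolding X_def e_def
    by (intro holo2_add holo2_divide holo2_partial_x holo2_De hF F0 holo2_eta h ne)+
  then have hol: "holo_form_at (\<lambda>q. (X q, e q - c * X q)) p"
    unfolding holo_form_at_def fst_conv snd_conv by (intro conjI holo2_diff holo2_mult holo2_const)
  have "\<forall>\<^sub>F q in nhds p.
      ext_deriv (\<lambda>q. cscale (wedge (slope_oneform c g b q) (slope_oneform c h d q)) (slope_oneform c f a q)) q =
        wedge (X q, e q - c * X q) (cscale (wedge (slope_oneform c g b q) (slope_oneform c h d q)) (slope_oneform c f a q)) \<and>
      ext_deriv (\<lambda>q. cscale (wedge (slope_oneform c h d q) (slope_oneform c f a q)) (slope_oneform c g b q)) q =
        wedge (X q, e q - c * X q) (cscale (wedge (slope_oneform c h d q) (slope_oneform c f a q)) (slope_oneform c g b q)) \<and>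
      ext_deriv (\<lambda>q. cscale (wedge (slope_oneform c f a q) (slope_oneform c g b q)) (slope_oneform c h d q)) q =
        wedge (X q, e q - c * X q) (cscale (wedge (slope_oneform c f a q) (slope_oneform c g b q)) (slope_oneform c h d q))"
    using holo2_distinct_near[OF h(4,5) ne(1)] holo2_distinct_near[OF h(4,6) ne(2)] holo2_distinct_near[OF h(5,6) ne(3)]
      h(1-6)[THEN holo2_eventually] holo2_eventually_ne[OF h(1) nz(1)] holo2_eventually_ne[OF h(2) nz(2)] holo2_eventually_ne[OF h(3) nz(3)]
  proof eventually_elim
    case (elim q)
    have F1: "(\<lambda>q. f q * g q * h q) = F" "(\<lambda>q. g q * h q * f q) = F" "(\<lambda>q. h q * f q * g q) = F"
      by (auto simp: F_def fun_eq_iff)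
    have F2: "f q * g q * h q = F q" "g q * h q * f q = F q" "h q * f q * g q = F q"
      by (auto simp: F_def)
    have v: "X q + a q * e q = eta_val c a b d q + (partial_x F q / F q + a q * (De c F q / F q))"
      "X q + b q * e q = eta_val c b d a q + (partial_x F q / F q + b q * (De c F q / F q))"
      "X q + d q * e q = eta_val c d a b q + (partial_x F q / F q + d q * (De c F q / F q))"
      using eta_vals[of a q b c d] eta_val_third[of a q b d c] elim(1-3) eta_val_commute[of c b d a q]
      unfolding X_def e_def by (simp_all add: algebra_simps)
    note t1 = ext_deriv_triple[OF elim(4-9) elim(10-12) elim(3), where c = c]
      and t2 = ext_deriv_triple[OF elim(5,6,4,8,9,7) elim(11,12,10) elim(2)[symmetric], where c = c]
      and t3 = ext_deriv_triple[OF elim(6,4,5,9,7,8) elim(12,10,11) elim(1), where c = c]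
    show ?case unfolding t1 t2 t3 unfolding F1 F2 v by simp
  qed
  with hol show ?thesis unfolding eta_at_def Let_def by blast
qed

text \<open>Near p two of the three equations determine \<eta> on two transverse directions. So
  \<eta> is the form given by \<open>eta_x\<close> and \<open>eta_e\<close> plus dF / F, and the
  last summand is closed.\<close>

lemma eta_at_curv:
  assumes eta: "eta_at p \<alpha> \<beta> \<gamma> \<eta>"
    and eq: "\<forall>\<^sub>F q in nhds p. \<alpha> q = slope_oneform c f a q" "\<forall>\<^sub>F q in nhds p. \<beta> q = slope_oneform c g b q"
      "\<forall>\<^sub>F q in nhds p. \<gamma> q = slope_oneform c h d q"
    and h: "holo2_at f p" "holo2_at g p" "holo2_at h p" "holo2_at a p" "holo2_at b p" "holo2_at d p"
    and nz: "f p \<noteq> 0" "g p \<noteq> 0" "h p \<noteq> 0" and ne: "a p \<noteq> b p" "a p \<noteq> d p" "b p \<noteq> d p"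
  shows "ext_deriv \<eta> p = slope_curv c a b d p"
proof -
  define F where "F q = f q * g q * h q" for q
  have hF: "holo2_at F p" and F0: "F p \<noteq> 0" unfolding F_def using nz by (auto intro!: holo2_mult h)
  have hol: "holo_form_at \<eta> p" and ev: "\<forall>\<^sub>F q in nhds p.
      ext_deriv (\<lambda>q. cscale (wedge (\<beta> q) (\<gamma> q)) (\<alpha> q)) q = wedge (\<eta> q) (cscale (wedge (\<beta> q) (\<gamma> q)) (\<alpha> q)) \<and>
      ext_deriv (\<lambda>q. cscale (wedge (\<gamma> q) (\<alpha> q)) (\<beta> q)) q = wedge (\<eta> q) (cscale (wedge (\<gamma> q) (\<alpha> q)) (\<beta> q))"
    using eta unfolding eta_at_def Let_def by (auto elim: eventually_mono)
  have all: "\<forall>\<^sub>F q in nhds p. \<alpha> q = slope_oneform c f a q \<and> \<beta> q = slope_oneform c g b q \<and> \<gamma> q = slope_oneform c h d q"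
    using eq by eventually_elim simp
  \<comment> \<open>Exterior derivatives at a nearby point q need the equalities on a neighbourhood
    of q, not only at q.\<close>
  then have all2: "\<forall>\<^sub>F q in nhds p. \<forall>\<^sub>F r in nhds q. \<alpha> r = slope_oneform c f a r \<and> \<beta> r = slope_oneform c g b r \<and> \<gamma> r = slope_oneform c h d r"
    by (simp add: eventually_eventually)
  have ext_cong: "ext_deriv A q = ext_deriv B q" if "\<forall>\<^sub>F r in nhds q. A r = B r" for A B q
  proof -
    have "\<forall>\<^sub>F r in nhds q. snd (A r) = snd (B r)" "\<forall>\<^sub>F r in nhds q. fst (A r) = fst (B r)"
      using that by (auto elim: eventually_mono)
    then show ?thesis unfolding ext_deriv_def using partial_cong by metis
  qed
  have main: "\<forall>\<^sub>F q in nhds p. fst (\<eta> q) = eta_x c a b d q + partial_x F q / F q \<and>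
      c * fst (\<eta> q) + snd (\<eta> q) = eta_e c a b d q + De c F q / F q"
    using all all2 ev holo2_distinct_near[OF h(4,5) ne(1)] holo2_distinct_near[OF h(4,6) ne(2)] holo2_distinct_near[OF h(5,6) ne(3)]
      h(1-6)[THEN holo2_eventually] holo2_eventually_ne[OF h(1) nz(1)] holo2_eventually_ne[OF h(2) nz(2)] holo2_eventually_ne[OF h(3) nz(3)]
  proof eventually_elim
    case (elim q)
    have F1: "(\<lambda>q. f q * g q * h q) = F" "(\<lambda>q. g q * h q * f q) = F" by (auto simp: F_def fun_eq_iff)
    have F2: "f q * g q * h q = F q" "g q * h q * f q = F q" by (auto simp: F_def)
    have Fq: "F q \<noteq> 0" using elim by (simp add: F_def)
    let ?X = "fst (\<eta> q)" and ?e = "c * fst (\<eta> q) + snd (\<eta> q)"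
    have \<eta>: "\<eta> q = (?X, ?e - c * ?X)" by (simp add: prod_eq_iff)
    have c1: "ext_deriv (\<lambda>q. cscale (wedge (\<beta> q) (\<gamma> q)) (\<alpha> q)) q =
        ext_deriv (\<lambda>q. cscale (wedge (slope_oneform c g b q) (slope_oneform c h d q)) (slope_oneform c f a q)) q"
      by (rule ext_cong) (use elim(2) in eventually_elim, simp)
    have c2: "ext_deriv (\<lambda>q. cscale (wedge (\<gamma> q) (\<alpha> q)) (\<beta> q)) q =
        ext_deriv (\<lambda>q. cscale (wedge (slope_oneform c h d q) (slope_oneform c f a q)) (slope_oneform c g b q)) q"
      by (rule ext_cong) (use elim(2) in eventually_elim, simp)
    note t1 = ext_deriv_triple[OF elim(7-12) elim(13-15) elim(6), where c = c]
      and t2 = ext_deriv_triple[OF elim(8,9,7,11,12,10) elim(14,15,13) elim(5)[symmetric], where c = c]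
    have w: "wedge (\<eta> q) A = wedge (?X, ?e - c * ?X) A" for A using \<eta> by simp
    have 1: "F q * (d q - b q) * (eta_val c a b d q + (partial_x F q / F q + a q * (De c F q / F q))) = F q * (d q - b q) * (?X + a q * ?e)"
      using elim(3)[THEN conjunct1] unfolding c1 w unfolding elim(1)[THEN conjunct1] elim(1)[THEN conjunct2, THEN conjunct1] elim(1)[THEN conjunct2, THEN conjunct2] t1 unfolding F1 F2 by simp
    have 2: "F q * (a q - d q) * (eta_val c b d a q + (partial_x F q / F q + b q * (De c F q / F q))) = F q * (a q - d q) * (?X + b q * ?e)"
      using elim(3)[THEN conjunct2] unfolding c2 w unfolding elim(1)[THEN conjunct1] elim(1)[THEN conjunct2, THEN conjunct1] elim(1)[THEN conjunct2, THEN conjunct2] t2 unfolding F1 F2 by simp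
    have "eta_val c a b d q + (partial_x F q / F q + a q * (De c F q / F q)) = ?X + a q * ?e"
      using 1 Fq elim by simp
    moreover have "eta_val c b a d q + (partial_x F q / F q + b q * (De c F q / F q)) = ?X + b q * ?e"
      using 2 Fq elim eta_val_commute[of c b a d q] by simp
    ultimately have "(?X - partial_x F q / F q) + a q * (?e - De c F q / F q) = eta_val c a b d q"
      "(?X - partial_x F q / F q) + b q * (?e - De c F q / F q) = eta_val c b a d q"
      by (simp_all add: algebra_simps)
    from eta_unique[OF _ this] elim show ?case by (simp add: algebra_simps)
  qed
  have "ext_deriv \<eta> p = curl c (\<lambda>q. fst (\<eta> q)) (\<lambda>q. c * fst (\<eta> q) + snd (\<eta> q)) p"
    by (rule ext_deriv_curl[OF hol])
  also have "\<dots> = curl c (\<lambda>q. eta_x c a b d q + partial_x F q / F q) (\<lambda>q. eta_e c a b d q + De c F q / F q) p"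
    by (rule curl_cong; rule eventually_mono[OF main]) blast+
  also have "\<dots> = curl c (eta_x c a b d) (eta_e c a b d) p + curl c (\<lambda>q. partial_x F q / F q) (\<lambda>q. De c F q / F q) p"
    by (rule curl_add) (intro holo2_eta holo2_divide holo2_partial_x holo2_De hF F0 h ne)+
  also have "\<dots> = slope_curv c a b d p" unfolding curl_log_deriv[OF hF F0] slope_curv_def by simp
  finally show ?thesis .
qed

text \<open>The full sum counts each triple of distinct indices 3! = 6 times. Unlike the sum over
  increasing triples it can be reindexed by a permutation.\<close>

lemma sum_triples:
  fixes G :: "nat \<Rightarrow> nat \<Rightarrow> nat \<Rightarrow> complex"
  assumes s12: "\<And>i j l. G i j l = G j i l" and s23: "\<And>i j l. G i j l = G i l j" and z: "\<And>i l. G i i l = 0"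
  shows "(\<Sum>i<n. \<Sum>j<n. \<Sum>l<n. G i j l) = 6 * (\<Sum>t<n. \<Sum>s<t. \<Sum>r<s. G r s t)"
proof -
  have z': "G i j j = 0" "G i j i = 0" for i j using z s12 s23 by metis+
  have pairs: "(\<Sum>i<n. \<Sum>j<n. H i j) = 2 * (\<Sum>s<n. \<Sum>r<s. H r s)"
    if "\<And>i j. H i j = H j i" "\<And>i. H i i = 0" for n and H :: "nat \<Rightarrow> nat \<Rightarrow> complex"
  proof (induction n)
    case (Suc n)
    have "(\<Sum>j<n. H n j) = (\<Sum>j<n. H j n)" using that(1) by simp
    then show ?case using Suc that(2) by (simp add: sum.distrib algebra_simps)
  qed simp
  show ?thesis
  proof (induction n)
    case (Suc n)
    have e: "(\<Sum>i<n. \<Sum>j<n. G i j n) = 2 * (\<Sum>s<n. \<Sum>r<s. G r s n)"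
      by (rule pairs) (use s12 z in auto)
    have a1: "(\<Sum>i<n. \<Sum>l<n. G i n l) = (\<Sum>i<n. \<Sum>j<n. G i j n)" using s23 by simp
    have a2: "(\<Sum>j<n. \<Sum>l<n. G n j l) = (\<Sum>i<n. \<Sum>j<n. G i j n)"
      by (intro sum.cong refl) (metis s12 s23)
    have "(\<Sum>i<Suc n. \<Sum>j<Suc n. \<Sum>l<Suc n. G i j l) =
      (\<Sum>i<n. \<Sum>j<n. \<Sum>l<n. G i j l) + (\<Sum>i<n. \<Sum>j<n. G i j n) + (\<Sum>i<n. \<Sum>l<n. G i n l) + (\<Sum>j<n. \<Sum>l<n. G n j l)"
      using z z' by (simp add: sum.distrib algebra_simps)
    then show ?case using Suc e a1 a2 by (simp add: algebra_simps)
  qed simp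
qed

lemma sum_triples_permute:
  fixes G :: "nat \<Rightarrow> nat \<Rightarrow> nat \<Rightarrow> complex"
  assumes s12: "\<And>i j l. distinct [i, j, l] \<Longrightarrow> i < n \<Longrightarrow> j < n \<Longrightarrow> l < n \<Longrightarrow> G i j l = G j i l"
    and s23: "\<And>i j l. distinct [i, j, l] \<Longrightarrow> i < n \<Longrightarrow> j < n \<Longrightarrow> l < n \<Longrightarrow> G i j l = G i l j"
    and \<sigma>: "bij_betw \<sigma> {..<n} {..<n}"
  shows "(\<Sum>t<n. \<Sum>s<t. \<Sum>r<s. G (\<sigma> r) (\<sigma> s) (\<sigma> t)) = (\<Sum>t<n. \<Sum>s<t. \<Sum>r<s. G r s t)"
proof -
  \<comment> \<open>G is symmetric only at distinct indices below n; extension by zero makes the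
    symmetry total.\<close>
  define H where "H i j l = (if distinct [i, j, l] \<and> i < n \<and> j < n \<and> l < n then G i j l else 0)" for i j l
  define H' where "H' i j l = (if distinct [i, j, l] \<and> i < n \<and> j < n \<and> l < n then G (\<sigma> i) (\<sigma> j) (\<sigma> l) else 0)" for i j l
  have \<sigma>n: "\<sigma> i < n" if "i < n" for i using \<sigma> that unfolding bij_betw_def by blast
  have \<sigma>i: "\<sigma> i = \<sigma> j \<longleftrightarrow> i = j" if "i < n" "j < n" for i j using \<sigma> that unfolding bij_betw_def inj_on_def by blast
  have HH: "H' i j l = H (\<sigma> i) (\<sigma> j) (\<sigma> l)" if "i < n" "j < n" "l < n" for i j l
    using that \<sigma>n \<sigma>i by (auto simp: H_def H'_def)
  have e: "(\<Sum>t<n. \<Sum>s<t. \<Sum>r<s. G r s t) = (\<Sum>t<n. \<Sum>s<t. \<Sum>r<s. H r s t)"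
    by (intro sum.cong refl) (auto simp: H_def)
  have e': "(\<Sum>t<n. \<Sum>s<t. \<Sum>r<s. G (\<sigma> r) (\<sigma> s) (\<sigma> t)) = (\<Sum>t<n. \<Sum>s<t. \<Sum>r<s. H' r s t)"
    by (intro sum.cong refl) (auto simp: H'_def)
  have H: "6 * (\<Sum>t<n. \<Sum>s<t. \<Sum>r<s. H r s t) = (\<Sum>i<n. \<Sum>j<n. \<Sum>l<n. H i j l)"
    by (rule sum_triples[symmetric]) (use s12 s23 in \<open>auto simp: H_def\<close>)
  have symm: "H i j l = H j i l" "H i j l = H i l j" for i j l
    using s12[of i j l] s23[of i j l] by (auto simp: H_def)
  have symm': "H' i j l = H' j i l" "H' i j l = H' i l j" for i j l
  proof -
    show "H' i j l = H' j i l"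
    proof (cases "i < n \<and> j < n \<and> l < n")
      case True then show ?thesis using HH symm(1)[of "\<sigma> i" "\<sigma> j" "\<sigma> l"] by simp
    qed (auto simp: H'_def)
    show "H' i j l = H' i l j"
    proof (cases "i < n \<and> j < n \<and> l < n")
      case True then show ?thesis using HH symm(2)[of "\<sigma> i" "\<sigma> j" "\<sigma> l"] by simp
    qed (auto simp: H'_def)
  qed
  have H': "6 * (\<Sum>t<n. \<Sum>s<t. \<Sum>r<s. H' r s t) = (\<Sum>i<n. \<Sum>j<n. \<Sum>l<n. H' i j l)"
    by (rule sum_triples[OF symm', symmetric]) (simp add: H'_def)
  have r1: "(\<Sum>l<n. H x y (\<sigma> l)) = (\<Sum>l<n. H x y l)" for x y
    by (rule sum.reindex_bij_betw[OF \<sigma>, of "\<lambda>l. H x y l"])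
  have r2: "(\<Sum>j<n. \<Sum>l<n. H x (\<sigma> j) l) = (\<Sum>j<n. \<Sum>l<n. H x j l)" for x
    by (rule sum.reindex_bij_betw[OF \<sigma>, of "\<lambda>j. \<Sum>l<n. H x j l"])
  have r3: "(\<Sum>i<n. \<Sum>j<n. \<Sum>l<n. H (\<sigma> i) j l) = (\<Sum>i<n. \<Sum>j<n. \<Sum>l<n. H i j l)"
    by (rule sum.reindex_bij_betw[OF \<sigma>, of "\<lambda>i. \<Sum>j<n. \<Sum>l<n. H i j l"])
  have "(\<Sum>i<n. \<Sum>j<n. \<Sum>l<n. H' i j l) = (\<Sum>i<n. \<Sum>j<n. \<Sum>l<n. H (\<sigma> i) (\<sigma> j) (\<sigma> l))"
    by (intro sum.cong refl) (use HH in auto)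
  also have "\<dots> = (\<Sum>i<n. \<Sum>j<n. \<Sum>l<n. H i j l)" by (simp only: r1 r2 r3)
  finally have "6 * (\<Sum>t<n. \<Sum>s<t. \<Sum>r<s. H' r s t) = 6 * (\<Sum>t<n. \<Sum>s<t. \<Sum>r<s. H r s t)"
    by (simp only: H H')
  then show ?thesis unfolding e e' by simp
qed

section \<open>From local factorizations to slopes\<close>

lemma form_eval_slope_form_prod:
  "form_eval n (Polynomial.smult U (\<Prod>i<n. slope_form c (w i))) v = U * (\<Prod>i<n. snd v - w i * (fst v - c * snd v))"
proof -
  have "(\<Prod>i<n. slope_form c (w i)) = linear_prod n (\<lambda>i. - w i) (\<lambda>i. 1 + c * w i)"
    by (simp add: linear_prod_def slope_form_def)
  then have "form_eval n (Polynomial.smult U (\<Prod>i<n. slope_form c (w i))) v = U * (\<Prod>i<n. - w i * fst v + (1 + c * w i) * snd v)"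
    by (simp add: form_eval_smult form_eval_linear_prod)
  also have "(\<Prod>i<n. - w i * fst v + (1 + c * w i) * snd v) = (\<Prod>i<n. snd v - w i * (fst v - c * snd v))"
    by (intro prod.cong refl) (simp add: algebra_simps)
  finally show ?thesis .
qed

text \<open>Factorization is unique up to units and order: near p each factor has its slope among
  the \<open>w j\<close>, and since these are distinct at p, continuity makes it follow one fixed
  \<open>w j\<close>.\<close>

lemma decomposition_slopes:
  assumes dec: "decomposes_at p n \<omega> \<alpha>"
    and w: "\<And>i. i < n \<Longrightarrow> holo2_at (w i) p" and ne: "\<And>i j. i < n \<Longrightarrow> j < n \<Longrightarrow> i \<noteq> j \<Longrightarrow> w i p \<noteq> w j p"
    and U: "holo2_at U p" "U p \<noteq> 0"
    and \<omega>: "\<forall>\<^sub>F q in nhds p. \<omega> q = Polynomial.smult (U q) (\<Prod>i<n. slope_form c (w i q))"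
  shows "\<exists>f \<sigma>. bij_betw \<sigma> {..<n} {..<n} \<and> (\<forall>i<n. holo2_at (f i) p \<and> f i p \<noteq> 0 \<and>
     (\<forall>\<^sub>F q in nhds p. \<alpha> i q = slope_oneform c (f i) (w (\<sigma> i)) q))"
proof -
  define f where "f i q = c * fst (\<alpha> i q) + snd (\<alpha> i q)" for i q
  define a where "a i q = - fst (\<alpha> i q) / f i q" for i q
  have h\<alpha>: "holo2_at (\<lambda>q. fst (\<alpha> i q)) p" "holo2_at (\<lambda>q. snd (\<alpha> i q)) p" if "i < n" for i
    using dec that unfolding decomposes_at_def holo_form_at_def by blast+
  have hf: "holo2_at (f i) p" if "i < n" for i
    unfolding f_def by (intro holo2_add holo2_mult holo2_const h\<alpha> that)
  have eq: "\<forall>\<^sub>F q in nhds p. \<forall>v. (\<Prod>i<n. fst (\<alpha> i q) * fst v + snd (\<alpha> i q) * snd v) = U q * (\<Prod>i<n. snd v - w i q * (fst v - c * snd v))"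
  proof -
    have "\<forall>\<^sub>F q in nhds p. \<omega> q = (\<Prod>i<n. [:fst (\<alpha> i q), snd (\<alpha> i q):])" using dec unfolding decomposes_at_def by blast
    with \<omega> show ?thesis
    proof eventually_elim
      case (elim q)
      show ?case
      proof
        fix v
        have "form_eval n (linear_prod n (\<lambda>i. fst (\<alpha> i q)) (\<lambda>i. snd (\<alpha> i q))) v = form_eval n (Polynomial.smult (U q) (\<Prod>i<n. slope_form c (w i q))) v"
          using elim by (simp add: linear_prod_def)
        then show "(\<Prod>i<n. fst (\<alpha> i q) * fst v + snd (\<alpha> i q) * snd v) = U q * (\<Prod>i<n. snd v - w i q * (fst v - c * snd v))"
          unfolding form_eval_linear_prod form_eval_slope_form_prod .
      qed
    qed
  qed
  have f0: "\<forall>\<^sub>F q in nhds p. \<forall>i<n. f i q \<noteq> 0"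
    using eq holo2_eventually_ne[OF U]
  proof eventually_elim
    case (elim q)
    from elim(1)[rule_format, of "(c, 1)"] have "(\<Prod>i<n. f i q) = U q" by (simp add: f_def mult.commute)
    then show ?case using elim(2) by (metis finite_lessThan lessThan_iff prod_zero_iff)
  qed
  have a_in: "\<forall>\<^sub>F q in nhds p. \<forall>i<n. \<exists>j<n. a i q = w j q"
    using eq f0 holo2_eventually_ne[OF U]
  proof eventually_elim
    case (elim q)
    show ?case
    proof (intro allI impI)
      fix i assume i: "i < n"
      let ?v = "(1 + c * a i q, a i q)"
      have "fst (\<alpha> i q) * fst ?v + snd (\<alpha> i q) * snd ?v = fst (\<alpha> i q) + a i q * f i q"
        by (simp add: f_def algebra_simps)
      also have "\<dots> = 0" using elim(2) i by (simp add: a_def)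
      finally have "(\<Prod>i<n. fst (\<alpha> i q) * fst ?v + snd (\<alpha> i q) * snd ?v) = 0"
        using i by (intro prod_zero) auto
      then have "U q * (\<Prod>j<n. snd ?v - w j q * (fst ?v - c * snd ?v)) = 0" using elim(1)[rule_format, of ?v] by (simp only:)
      then have "(\<Prod>j<n. snd ?v - w j q * (fst ?v - c * snd ?v)) = 0" using elim(3) mult_eq_0_iff by blast
      then show "\<exists>j<n. a i q = w j q" by (auto simp: algebra_simps)
    qed
  qed
  \<comment> \<open>The permutation is read off at p; it is onto because every \<open>w m p\<close>
    is the slope of some factor.\<close>
  from eventually_nhds_x_imp_x[OF a_in] obtain \<sigma> where \<sigma>: "\<And>i. i < n \<Longrightarrow> \<sigma> i < n" "\<And>i. i < n \<Longrightarrow> a i p = w (\<sigma> i) p"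
    by metis
  have surj: "\<sigma> ` {..<n} = {..<n}"
  proof (intro equalityI subsetI)
    fix m assume "m \<in> {..<n}"
    then have m: "m < n" by simp
    let ?v = "(1 + c * w m p, w m p)"
    have "(\<Prod>j<n. snd ?v - w j p * (fst ?v - c * snd ?v)) = 0"
      by (intro prod_zero bexI[of _ m]) (use m in auto)
    then have "(\<Prod>i<n. fst (\<alpha> i p) * fst ?v + snd (\<alpha> i p) * snd ?v) = 0"
      using eventually_nhds_x_imp_x[OF eq] by simp
    then obtain i where i: "i < n" "fst (\<alpha> i p) * fst ?v + snd (\<alpha> i p) * snd ?v = 0" by auto
    have fi: "f i p \<noteq> 0" using eventually_nhds_x_imp_x[OF f0] i(1) by blast
    have "fst (\<alpha> i p) + w m p * f i p = 0" using i(2) by (simp add: f_def algebra_simps)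
    then have "a i p = w m p" using fi by (simp add: a_def field_simps add_eq_0_iff)
    then have "\<sigma> i = m" using \<sigma> i(1) ne[of "\<sigma> i" m] m by metis
    then show "m \<in> \<sigma> ` {..<n}" using i(1) by blast
  qed (use \<sigma> in auto)
  then have bij: "bij_betw \<sigma> {..<n} {..<n}" unfolding bij_betw_def using eq_card_imp_inj_on[of "{..<n}" \<sigma>] by simp
  have "holo2_at (f i) p \<and> f i p \<noteq> 0 \<and> (\<forall>\<^sub>F q in nhds p. \<alpha> i q = slope_oneform c (f i) (w (\<sigma> i)) q)" if i: "i < n" for i
  proof (intro conjI hf[OF i])
    show fp: "f i p \<noteq> 0" using eventually_nhds_x_imp_x[OF f0] i by blast
    have ha: "holo2_at (a i) p" unfolding a_def by (intro holo2_divide holo2_uminus h\<alpha> hf i fp)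
    have "\<forall>\<^sub>F q in nhds p. \<forall>j\<in>{..<n} - {\<sigma> i}. a i q \<noteq> w j q"
    proof (intro eventually_ball_finite ballI)
      fix j assume "j \<in> {..<n} - {\<sigma> i}"
      then have "a i p \<noteq> w j p" using \<sigma> ne[of "\<sigma> i" j] i by auto
      then show "\<forall>\<^sub>F q in nhds p. a i q \<noteq> w j q" using holo2_distinct_near[OF ha w] \<open>j \<in> _\<close> by auto
    qed simp
    then show "\<forall>\<^sub>F q in nhds p. \<alpha> i q = slope_oneform c (f i) (w (\<sigma> i)) q"
      using a_in f0
    proof eventually_elim
      case (elim q)
      have "a i q = w (\<sigma> i) q" using elim(1,2) i by blast
      moreover have fa: "fst (\<alpha> i q) = - (a i q * f i q)" using elim(3) i by (simp add: a_def)
      moreover have sa: "snd (\<alpha> i q) = f i q - c * fst (\<alpha> i q)" by (simp add: f_def)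
      have "snd (\<alpha> i q) = f i q * (1 + c * a i q)" unfolding sa fa by (simp add: algebra_simps)
      ultimately show ?case by (simp add: slope_oneform_def prod_eq_iff)
    qed
  qed
  then show ?thesis using bij by blast
qed

text \<open>The description has a witness, with the unit U placed in the factor of index 0. Any
  other factorization gives the same value, since the sum over triples sees neither the units nor
  the order of the factors.\<close>

lemma curvature_slopes:
  assumes n: "n \<ge> 1"
    and w: "\<And>i. i < n \<Longrightarrow> holo2_at (w i) p" and ne: "\<And>i j. i < n \<Longrightarrow> j < n \<Longrightarrow> i \<noteq> j \<Longrightarrow> w i p \<noteq> w j p"
    and U: "holo2_at U p" "U p \<noteq> 0"
    and \<omega>: "\<forall>\<^sub>F q in nhds p. \<omega> q = Polynomial.smult (U q) (\<Prod>i<n. slope_form c (w i q))"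
  shows "curvature n \<omega> p = (\<Sum>t<n. \<Sum>s<t. \<Sum>r<s. slope_curv c (w r) (w s) (w t) p)"
proof -
  define f where "f i = (if i = 0 then U else (\<lambda>_. 1))" for i :: nat
  have hf: "holo2_at (f i) p" "f i p \<noteq> 0" for i using U by (auto simp: f_def intro: holo2_const)
  define \<alpha> where "\<alpha> i = slope_oneform c (f i) (w i)" for i
  obtain m where m: "n = Suc m" using n by (cases n) auto
  have pf: "(\<Prod>i<n. f i q) = U q" for q
    unfolding m by (subst prod.lessThan_Suc_shift) (simp add: f_def)
  have dec: "decomposes_at p n \<omega> \<alpha>"
    unfolding decomposes_at_def
  proof (intro conjI allI impI)
    show "holo_form_at (\<alpha> i) p" if "i < n" for i unfolding \<alpha>_def by (rule holo_slope_oneform[OF hf(1) w[OF that]])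
    show "\<forall>\<^sub>F q in nhds p. \<omega> q = (\<Prod>i<n. [:fst (\<alpha> i q), snd (\<alpha> i q):])"
      using \<omega>
    proof eventually_elim
      case (elim q)
      have "[:fst (\<alpha> i q), snd (\<alpha> i q):] = [:f i q:] * slope_form c (w i q)" for i
        by (simp add: \<alpha>_def slope_oneform_def slope_form_def)
      then have "(\<Prod>i<n. [:fst (\<alpha> i q), snd (\<alpha> i q):]) = (\<Prod>i<n. [:f i q:]) * (\<Prod>i<n. slope_form c (w i q))"
        by (simp only: prod.distrib)
      also have "(\<Prod>i<n. [:f i q:]) = [:\<Prod>i<n. f i q:]"
      proof -
        have "(\<Prod>i<l. [:g i:]) = [:\<Prod>i<l. g i:]" for l and g :: "nat \<Rightarrow> complex"
          by (induction l) simp_all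
        then show ?thesis .
      qed
      finally show ?case using elim pf by simp
    qed
  qed
  define \<eta> where "\<eta> r s t = (SOME \<eta>. eta_at p (\<alpha> r) (\<alpha> s) (\<alpha> t) \<eta>)" for r s t
  have eta: "\<forall>r s t. r < s \<and> s < t \<and> t < n \<longrightarrow> eta_at p (\<alpha> r) (\<alpha> s) (\<alpha> t) (\<eta> r s t)"
  proof (intro allI impI)
    fix r s t assume rst: "r < s \<and> s < t \<and> t < n"
    have d: "w r p \<noteq> w s p" "w r p \<noteq> w t p" "w s p \<noteq> w t p"
      using ne[of r s] ne[of r t] ne[of s t] rst by auto
    have l: "r < n" "s < n" "t < n" using rst by auto
    show "eta_at p (\<alpha> r) (\<alpha> s) (\<alpha> t) (\<eta> r s t)"
      unfolding \<eta>_def using eta_at_exists[OF hf(1) hf(1) hf(1) w[OF l(1)] w[OF l(2)] w[OF l(3)] hf(2) hf(2) hf(2) d]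
      unfolding \<alpha>_def by (rule someI_ex)
  qed
  have val: "(\<Sum>t<n. \<Sum>s<t. \<Sum>r<s. ext_deriv (\<eta> r s t) p) = (\<Sum>t<n. \<Sum>s<t. \<Sum>r<s. slope_curv c (w r) (w s) (w t) p)"
    if dec: "decomposes_at p n \<omega> \<alpha>" and eta: "\<forall>r s t. r < s \<and> s < t \<and> t < n \<longrightarrow> eta_at p (\<alpha> r) (\<alpha> s) (\<alpha> t) (\<eta> r s t)"
    for \<alpha> \<eta>
  proof -
    obtain g \<sigma> where \<sigma>: "bij_betw \<sigma> {..<n} {..<n}" and g: "\<And>i. i < n \<Longrightarrow> holo2_at (g i) p" "\<And>i. i < n \<Longrightarrow> g i p \<noteq> 0"
      "\<And>i. i < n \<Longrightarrow> \<forall>\<^sub>F q in nhds p. \<alpha> i q = slope_oneform c (g i) (w (\<sigma> i)) q"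
      using decomposition_slopes[OF dec w ne U \<omega>] by blast
    have \<sigma>n: "\<sigma> i < n" if "i < n" for i using \<sigma> that unfolding bij_betw_def by blast
    have \<sigma>i: "\<sigma> i = \<sigma> j \<longleftrightarrow> i = j" if "i < n" "j < n" for i j using \<sigma> that unfolding bij_betw_def inj_on_def by blast
    have "(\<Sum>t<n. \<Sum>s<t. \<Sum>r<s. ext_deriv (\<eta> r s t) p) = (\<Sum>t<n. \<Sum>s<t. \<Sum>r<s. slope_curv c (w (\<sigma> r)) (w (\<sigma> s)) (w (\<sigma> t)) p)"
    proof (intro sum.cong refl)
      fix t s r assume "t \<in> {..<n}" "s \<in> {..<t}" "r \<in> {..<s}"
      then have rst: "r < s" "s < t" "t < n" "s < n" "r < n" by auto
      have d: "w (\<sigma> r) p \<noteq> w (\<sigma> s) p" "w (\<sigma> r) p \<noteq> w (\<sigma> t) p" "w (\<sigma> s) p \<noteq> w (\<sigma> t) p"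
        using ne[of "\<sigma> r" "\<sigma> s"] ne[of "\<sigma> r" "\<sigma> t"] ne[of "\<sigma> s" "\<sigma> t"]
          rst \<sigma>i[of r s] \<sigma>i[of r t] \<sigma>i[of s t] \<sigma>n by auto
      have "eta_at p (\<alpha> r) (\<alpha> s) (\<alpha> t) (\<eta> r s t)" using eta rst by blast
      then show "ext_deriv (\<eta> r s t) p = slope_curv c (w (\<sigma> r)) (w (\<sigma> s)) (w (\<sigma> t)) p"
        by (rule eta_at_curv[OF _ g(3)[OF rst(5)] g(3)[OF rst(4)] g(3)[OF rst(3)] g(1)[OF rst(5)] g(1)[OF rst(4)] g(1)[OF rst(3)]
            w[OF \<sigma>n[OF rst(5)]] w[OF \<sigma>n[OF rst(4)]] w[OF \<sigma>n[OF rst(3)]] g(2)[OF rst(5)] g(2)[OF rst(4)] g(2)[OF rst(3)] d])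
    qed
    also have "\<dots> = (\<Sum>t<n. \<Sum>s<t. \<Sum>r<s. slope_curv c (w r) (w s) (w t) p)"
    proof (rule sum_triples_permute[OF _ _ \<sigma>])
      fix i j l assume *: "distinct [i, j, l]" "i < n" "j < n" "l < n"
      have d: "w i p \<noteq> w j p" "w i p \<noteq> w l p" "w j p \<noteq> w l p" using ne[of i j] ne[of i l] ne[of j l] * by auto
      show "slope_curv c (w i) (w j) (w l) p = slope_curv c (w j) (w i) (w l) p"
        by (rule slope_curv_swap12[OF w w d(1)]) (use * in auto)
      show "slope_curv c (w i) (w j) (w l) p = slope_curv c (w i) (w l) (w j) p"
        by (rule slope_curv_swap23[OF w w w d]) (use * in auto)
    qed
    finally show ?thesis .
  qed
  show ?thesis
    unfolding curvature_def
  proof (rule the_equality)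
    show "\<exists>\<alpha> \<eta>. decomposes_at p n \<omega> \<alpha> \<and>
        (\<forall>r s t. r < s \<and> s < t \<and> t < n \<longrightarrow> eta_at p (\<alpha> r) (\<alpha> s) (\<alpha> t) (\<eta> r s t)) \<and>
        (\<Sum>t<n. \<Sum>s<t. \<Sum>r<s. slope_curv c (w r) (w s) (w t) p) = (\<Sum>t<n. \<Sum>s<t. \<Sum>r<s. ext_deriv (\<eta> r s t) p)"
      using dec eta val[OF dec eta] by metis
    fix \<kappa> assume "\<exists>\<alpha> \<eta>. decomposes_at p n \<omega> \<alpha> \<and>
        (\<forall>r s t. r < s \<and> s < t \<and> t < n \<longrightarrow> eta_at p (\<alpha> r) (\<alpha> s) (\<alpha> t) (\<eta> r s t)) \<and>
        \<kappa> = (\<Sum>t<n. \<Sum>s<t. \<Sum>r<s. ext_deriv (\<eta> r s t) p)"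
    then show "\<kappa> = (\<Sum>t<n. \<Sum>s<t. \<Sum>r<s. slope_curv c (w r) (w s) (w t) p)" using val by blast
  qed
qed

section \<open>The polar part of the curvature\<close>

lemma D_power:
  assumes "holo2_at f p"
  shows "partial_x (\<lambda>q. f q ^ n) p = of_nat n * f p ^ (n - 1) * partial_x f p"
    and "De c (\<lambda>q. f q ^ n) p = of_nat n * f p ^ (n - 1) * De c f p"
proof -
  have "((\<lambda>z. z ^ n) has_field_derivative of_nat n * f p ^ (n - 1)) (at (f p))"
    by (auto intro!: derivative_eq_intros)
  from hasd_partial[OF hasd_compose[OF holo2_hasd[OF assms] this]]
  show "partial_x (\<lambda>q. f q ^ n) p = of_nat n * f p ^ (n - 1) * partial_x f p"
    and "De c (\<lambda>q. f q ^ n) p = of_nat n * f p ^ (n - 1) * De c f p"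
    by (simp_all add: De_def algebra_simps)
qed

lemma sum_conjugate_fractions:
  fixes A B y v :: complex
  assumes "y - v \<noteq> 0" "y + v \<noteq> 0"
  shows "(A - B) / (y - v) + (A + B) / (y + v) = 2 * (A * y - B * v) / (y\<^sup>2 - v\<^sup>2)"
proof -
  have "(A - B) / (y - v) + (A + B) / (y + v) = ((A - B) * (y + v) + (A + B) * (y - v)) / ((y - v) * (y + v))"
    using assms by (simp add: add_frac_eq)
  also have "(A - B) * (y + v) + (A + B) * (y - v) = 2 * (A * y - B * v)" by (simp add: algebra_simps)
  also have "(y - v) * (y + v) = y\<^sup>2 - v\<^sup>2" by (simp add: power2_eq_square algebra_simps)
  finally show ?thesis .
qed

text \<open>The sum of \<open>eta_val c a b\<close> over the slopes u + v and u - v of the 2-web,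
  where v^2 = E. The terms odd in v cancel, so it is expressed by E and dE and stays holomorphic on
  E = 0 as long as b \<noteq> u.\<close>

definition pair_val :: "complex \<Rightarrow> (point \<Rightarrow> complex) \<Rightarrow> (point \<Rightarrow> complex) \<Rightarrow> (point \<Rightarrow> complex) \<Rightarrow> (point \<Rightarrow> complex) \<Rightarrow> point \<Rightarrow> complex" where
  "pair_val c u E a b q =
     (2 * (b q - u q) * (partial_x b q - partial_x u q + a q * (De c b q - De c u q)) - (partial_x E q + a q * De c E q))
       / ((b q - u q)\<^sup>2 - E q) + 2 * De c a q"

lemma eta_val_conjugate_sum:
  assumes h: "holo2_at u q" "holo2_at v q" and E: "\<forall>\<^sub>F r in nhds q. E r = (v r)\<^sup>2"
    and nz: "b q - u q - v q \<noteq> 0" "b q - u q + v q \<noteq> 0"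
  shows "eta_val c a b (\<lambda>r. u r + v r) q + eta_val c a b (\<lambda>r. u r - v r) q = pair_val c u E a b q"
proof -
  have Eq: "E q = (v q)\<^sup>2" by (rule eventually_nhds_x_imp_x[OF E])
  have dE: "partial_x E q = 2 * v q * partial_x v q" "De c E q = 2 * v q * De c v q"
    using partial_cong(1)[OF E] De_cong[OF E, of c] D_power(1)[OF h(2), where n = 2] D_power(2)[OF h(2), where n = 2 and c = c] by simp_all
  let ?\<beta> = "partial_x b q - partial_x u q + a q * (De c b q - De c u q)" and ?\<nu> = "partial_x v q + a q * De c v q"
  have "eta_val c a b (\<lambda>r. u r + v r) q + eta_val c a b (\<lambda>r. u r - v r) q =
      (?\<beta> - ?\<nu>) / (b q - u q - v q) + (?\<beta> + ?\<nu>) / (b q - u q + v q) + 2 * De c a q"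
    unfolding eta_val_def D_add[OF h] D_diff[OF h] by (simp add: algebra_simps)
  also have "(?\<beta> - ?\<nu>) / (b q - u q - v q) + (?\<beta> + ?\<nu>) / (b q - u q + v q) =
      2 * (?\<beta> * (b q - u q) - ?\<nu> * v q) / ((b q - u q)\<^sup>2 - (v q)\<^sup>2)"
    by (rule sum_conjugate_fractions[OF nz])
  also have "2 * (?\<beta> * (b q - u q) - ?\<nu> * v q) = 2 * (b q - u q) * ?\<beta> - (partial_x E q + a q * De c E q)"
    unfolding dE by (simp add: algebra_simps)
  finally show ?thesis unfolding pair_val_def Eq .
qed

text \<open>The value on (1, 0) + u (c, 1) of the form \<eta> of the slopes a, u + v, u - v with v^2
  = E. As the mean of its values on the two conjugate leaves it is even in v, hence expressed by E
  and dE, and holomorphic on E = 0 where a \<noteq> u.\<close>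

definition mid_val :: "complex \<Rightarrow> (point \<Rightarrow> complex) \<Rightarrow> (point \<Rightarrow> complex) \<Rightarrow> (point \<Rightarrow> complex) \<Rightarrow> point \<Rightarrow> complex" where
  "mid_val c u E a q =
     ((u q - a q) * (partial_x u q - partial_x a q + u q * (De c u q - De c a q) - De c E q / 2)
      + (E q * (De c u q - De c a q) - (partial_x E q + u q * De c E q) / 2)) / ((u q - a q)\<^sup>2 - E q) + De c u q"

text \<open>The pole is confined to the value on the leaf of slope a: the two conjugate slopes
  differ by 2 v, and the quotient of the derivative of 2 v by 2 v is that of E by 2 E.\<close>

lemma eta_mid_conjugate:
  fixes c :: complex
  assumes h: "holo2_at u q" "holo2_at v q" and E: "\<forall>\<^sub>F r in nhds q. E r = (v r)\<^sup>2"
    and nz: "a q \<noteq> u q + v q" "a q \<noteq> u q - v q" "v q \<noteq> 0"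
  defines "x \<equiv> eta_x c a (\<lambda>r. u r + v r) (\<lambda>r. u r - v r) q" and "e \<equiv> eta_e c a (\<lambda>r. u r + v r) (\<lambda>r. u r - v r) q"
  shows "x + a q * e = (partial_x E q + a q * De c E q) / (2 * E q) + De c a q"
    and "x + u q * e = mid_val c u E a q"
proof -
  have Eq: "E q = (v q)\<^sup>2" by (rule eventually_nhds_x_imp_x[OF E])
  have dE: "partial_x E q = 2 * v q * partial_x v q" "De c E q = 2 * v q * De c v q"
    using partial_cong(1)[OF E] De_cong[OF E, of c] D_power(1)[OF h(2), where n = 2] D_power(2)[OF h(2), where n = 2 and c = c] by simp_all
  have d: "u q + v q \<noteq> u q - v q" using nz(3) by (simp add: algebra_simps eq_neg_iff_add_eq_0)
  note vals = eta_vals[of a q "\<lambda>r. u r + v r" c "\<lambda>r. u r - v r", OF nz(1), folded x_def e_def]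
    eta_val_third[of a q "\<lambda>r. u r + v r" "\<lambda>r. u r - v r" c, OF nz(1,2) d, folded x_def e_def]
  note DD = D_add[OF h] D_diff[OF h]
  have "x + a q * e = (2 * (partial_x v q + a q * De c v q)) / (2 * v q) + De c a q"
    unfolding vals(1) eta_val_def DD by (simp add: algebra_simps)
  also have "(2 * (partial_x v q + a q * De c v q)) / (2 * v q) = (partial_x E q + a q * De c E q) / (2 * E q)"
    unfolding dE Eq using nz(3) by (simp add: field_simps power2_eq_square)
  finally show "x + a q * e = (partial_x E q + a q * De c E q) / (2 * E q) + De c a q" .
  \<comment> \<open>The numerators at the two conjugate slopes are \<open>?A - ?B\<close> and
    \<open>?A + ?B\<close>, with \<open>?A\<close> even and \<open>?B\<close> odd in v.\<close>
  let ?A = "partial_x u q - partial_x a q + u q * (De c u q - De c a q) - v q * De c v q"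
    and ?B = "partial_x v q + u q * De c v q - v q * (De c u q - De c a q)" and ?y = "u q - a q"
  have y: "?y - v q \<noteq> 0" "?y + v q \<noteq> 0" using nz by (auto simp: algebra_simps)
  have 1: "x + (u q + v q) * e = (?A - ?B) / (?y - v q) + De c u q + De c v q"
  proof -
    have "x + (u q + v q) * e = - (?A - ?B) / - (?y - v q) + De c u q + De c v q"
      unfolding vals(2) eta_val_def DD by (simp add: algebra_simps)
    then show ?thesis by (simp only: minus_divide_divide)
  qed
  have 2: "x + (u q - v q) * e = (?A + ?B) / (?y + v q) + De c u q - De c v q"
  proof -
    have "x + (u q - v q) * e = - (?A + ?B) / - (?y + v q) + De c u q - De c v q"
      unfolding vals(3) eta_val_def DD by (simp add: algebra_simps)
    then show ?thesis by (simp only: minus_divide_divide)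
  qed
  have "2 * (x + u q * e) = (x + (u q + v q) * e) + (x + (u q - v q) * e)" by (simp add: algebra_simps)
  also have "\<dots> = ((?A - ?B) / (?y - v q) + (?A + ?B) / (?y + v q)) + 2 * De c u q" unfolding 1 2 by simp
  also have "\<dots> = 2 * ((?A * ?y - ?B * v q) / (?y\<^sup>2 - (v q)\<^sup>2) + De c u q)"
    unfolding sum_conjugate_fractions[OF y] by (simp add: algebra_simps)
  finally have two: "2 * (x + u q * e) = 2 * ((?A * ?y - ?B * v q) / (?y\<^sup>2 - (v q)\<^sup>2) + De c u q)" .
  have "x + u q * e = (?A * ?y - ?B * v q) / (?y\<^sup>2 - (v q)\<^sup>2) + De c u q"
    by (rule mult_left_cancel[of "2 :: complex", THEN iffD1, OF _ two]) simp
  also have "?A * ?y - ?B * v q = ?y * (partial_x u q - partial_x a q + u q * (De c u q - De c a q) - De c E q / 2)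
      + (E q * (De c u q - De c a q) - (partial_x E q + u q * De c E q) / 2)"
    unfolding dE Eq by (simp add: algebra_simps power2_eq_square)
  finally show "x + u q * e = mid_val c u E a q" unfolding mid_val_def Eq .
qed

lemma local_square_root:
  assumes "holo2_at E p" "E p \<noteq> 0"
  shows "\<exists>v. holo2_at v p \<and> (\<forall>\<^sub>F q in nhds p. E q = (v q)\<^sup>2)"
proof -
  \<comment> \<open>This quotient is 1 at p, so nearby it avoids the branch cut of
    \<open>csqrt\<close>.\<close>
  have h: "holo2_at (\<lambda>q. E q / E p) p" by (rule holo2_divide[OF assms(1) holo2_const assms(2)])
  have "holo2_at (\<lambda>q. csqrt (E q / E p)) p"
    by (rule holo2_compose[OF h, of "- \<real>\<^sub>\<le>\<^sub>0"]) (use assms(2) in \<open>auto intro!: holomorphic_intros\<close>)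
  then have "holo2_at (\<lambda>q. csqrt (E q / E p) * csqrt (E p)) p" by (rule holo2_mult[OF _ holo2_const])
  moreover have "\<forall>\<^sub>F q in nhds p. E q = (csqrt (E q / E p) * csqrt (E p))\<^sup>2"
    by (rule always_eventually) (use assms(2) in \<open>simp add: power_mult_distrib\<close>)
  ultimately show ?thesis by blast
qed

lemma slope_form_conjugate:
  "slope_form c (u + v) * slope_form c (u - v) = (slope_form c u)\<^sup>2 - Polynomial.smult (v\<^sup>2) ([:1, - c:]\<^sup>2)"
  by (simp add: slope_form_def power2_eq_square algebra_simps)

lemma sum_triples_split:
  fixes G :: "nat \<Rightarrow> nat \<Rightarrow> nat \<Rightarrow> complex"
  shows "(\<Sum>t<k + 2. \<Sum>s<t. \<Sum>r<s. G r s t) =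
    (\<Sum>t<k. \<Sum>s<t. \<Sum>r<s. G r s t) + (\<Sum>s<k. \<Sum>r<s. G r s k + G r s (Suc k)) + (\<Sum>r<k. G r k (Suc k))"
  by (simp add: sum.distrib)

text \<open>Triples are grouped by the number of leaves of the 2-web in them. Those with none are
  holomorphic, and those with one become so after summation over the two conjugate leaves. A triple
  with both has the polar form (m/2) (\<rho> r / h) \<omega>0, where \<omega>0 is 1 on (c, 1) and
  vanishes on slope u, and \<rho> r is the term of index r in \<phi>.\<close>

lemma curvature_polar_part:
  fixes q :: "nat \<Rightarrow> point \<Rightarrow> complex"
  assumes q: "\<And>i. i < k \<Longrightarrow> holo2_at (q i) 0" and u: "holo2_at u 0" and E: "holo2_at E 0" "E 0 = 0"
    and U: "holo2_at U 0" "U 0 \<noteq> 0" and h: "holo2_at h 0" and c0: "holo2_at c0 0" "c0 0 \<noteq> 0"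
    and qq: "\<And>i j. i < k \<Longrightarrow> j < k \<Longrightarrow> i \<noteq> j \<Longrightarrow> q i 0 \<noteq> q j 0" and qu: "\<And>i. i < k \<Longrightarrow> q i 0 \<noteq> u 0"
    and Eh: "\<forall>\<^sub>F p in nhds 0. E p = h p ^ m * c0 p" and m: "m \<ge> 1"
    and \<omega>: "\<forall>\<^sub>F p in nhds 0. \<omega> p = Polynomial.smult (U p) ((\<Prod>i<k. slope_form c (q i p)) *
        ((slope_form c (u p))\<^sup>2 - Polynomial.smult (E p) ([:1, - c:]\<^sup>2)))"
  defines "\<phi> \<equiv> \<lambda>p. \<Sum>i<k. (partial_x h p + q i p * De c h p) / (q i p - u p)"
  shows "\<exists>K. holo2_at K 0 \<and> (\<forall>\<^sub>F p in nhds 0. h p \<noteq> 0 \<longrightarrow>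
    curvature (k + 2) \<omega> p = K p + of_nat m / 2 *
      ((h p * (partial_x \<phi> p + De c (\<lambda>p. u p * \<phi> p) p) - \<phi> p * (partial_x h p + u p * De c h p)) / (h p)\<^sup>2))"
proof -
  \<comment> \<open>\<open>Ne\<close> and \<open>Nx\<close> are \<open>eta_e\<close> and
    \<open>eta_x\<close> summed over the two conjugate leaves as third leaf.\<close>
  define Ne where "Ne r s p = (pair_val c u E (q r) (q s) p - pair_val c u E (q s) (q r) p) / (q r p - q s p)" for r s p
  define Nx where "Nx r s p = pair_val c u E (q r) (q s) p - q r p * Ne r s p" for r s p
  \<comment> \<open>\<open>J\<close> and \<open>I\<close> are what remains of \<open>eta_e\<close>
    and \<open>eta_x\<close> for the slopes q r, u + v, u - v after removal of the polar form; the
    term with c0 is the regular remainder of dE / (2 E).\<close>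
  define J where "J r p = ((partial_x c0 p + q r p * De c c0 p) / (2 * c0 p) + De c (q r) p - mid_val c u E (q r) p) / (q r p - u p)" for r p
  define I where "I r p = mid_val c u E (q r) p - u p * J r p" for r p
  define \<rho> where "\<rho> r p = (partial_x h p + q r p * De c h p) / (q r p - u p)" for r p
  define HX where "HX p = (\<Sum>t<k. \<Sum>s<t. \<Sum>r<s. eta_x c (q r) (q s) (q t) p) + (\<Sum>s<k. \<Sum>r<s. Nx r s p) + (\<Sum>r<k. I r p)" for p
  define HE where "HE p = (\<Sum>t<k. \<Sum>s<t. \<Sum>r<s. eta_e c (q r) (q s) (q t) p) + (\<Sum>s<k. \<Sum>r<s. Ne r s p) + (\<Sum>r<k. J r p)" for p
  \<comment> \<open>Open conditions that hold at the origin: the identities can then be proved at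
    every nearby point, and so be differentiated.\<close>
  define good where "good p \<longleftrightarrow> (\<forall>i<k. holo2_at (q i) p) \<and> holo2_at u p \<and> holo2_at E p \<and> holo2_at U p \<and> U p \<noteq> 0 \<and>
    holo2_at h p \<and> holo2_at c0 p \<and> c0 p \<noteq> 0 \<and> (\<forall>i<k. \<forall>j<k. i \<noteq> j \<longrightarrow> q i p \<noteq> q j p) \<and> (\<forall>i<k. q i p \<noteq> u p) \<and>
    (\<forall>i<k. (q i p - u p)\<^sup>2 - E p \<noteq> 0)" for p
  have goodD: "\<And>i. i < k \<Longrightarrow> holo2_at (q i) p" "holo2_at u p" "holo2_at E p" "holo2_at U p" "U p \<noteq> 0"
    "holo2_at h p" "holo2_at c0 p" "c0 p \<noteq> 0" "\<And>i j. i < k \<Longrightarrow> j < k \<Longrightarrow> i \<noteq> j \<Longrightarrow> q i p \<noteq> q j p" "\<And>i. i < k \<Longrightarrow> q i p \<noteq> u p"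
    "\<And>i. i < k \<Longrightarrow> (q i p - u p)\<^sup>2 - E p \<noteq> 0" if "good p" for p
    using that unfolding good_def by blast+
  have ev_all: "\<forall>\<^sub>F p in F. \<forall>i<k. P i p" if "\<And>i. i < k \<Longrightarrow> \<forall>\<^sub>F p in F. P i p" for P and F :: "point filter"
  proof -
    have "\<forall>\<^sub>F p in F. \<forall>i\<in>{..<k}. P i p" using that by (intro eventually_ball_finite) auto
    then show ?thesis by (rule eventually_mono) auto
  qed
  have ev_good: "\<forall>\<^sub>F p in nhds 0. good p"
  proof -
    have a: "\<forall>\<^sub>F p in nhds 0. \<forall>i<k. holo2_at (q i) p" using q by (intro ev_all holo2_eventually)
    have b: "\<forall>\<^sub>F p in nhds 0. \<forall>i<k. \<forall>j<k. i \<noteq> j \<longrightarrow> q i p \<noteq> q j p"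
    proof (intro ev_all)
      fix i j assume ij: "i < k" "j < k"
      show "\<forall>\<^sub>F p in nhds 0. i \<noteq> j \<longrightarrow> q i p \<noteq> q j p"
      proof (cases "i = j")
        case False
        from holo2_distinct_near[OF q[OF ij(1)] q[OF ij(2)] qq[OF ij False]]
        show ?thesis by (rule eventually_mono) simp
      qed simp
    qed
    have d: "\<forall>\<^sub>F p in nhds 0. \<forall>i<k. q i p \<noteq> u p" by (intro ev_all holo2_distinct_near q u qu)
    have e: "\<forall>\<^sub>F p in nhds 0. \<forall>i<k. (q i p - u p)\<^sup>2 - E p \<noteq> 0"
    proof (intro ev_all holo2_eventually_ne holo2_diff holo2_power q u E(1))
      fix i assume "i < k" then show "(q i 0 - u 0)\<^sup>2 - E 0 \<noteq> 0" using qu E(2) by simp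
    qed
    show ?thesis
      using a b d e holo2_eventually[OF u] holo2_eventually[OF E(1)] holo2_eventually[OF U(1)] holo2_eventually_ne[OF U]
        holo2_eventually[OF h] holo2_eventually[OF c0(1)] holo2_eventually_ne[OF c0]
      by eventually_elim (simp add: good_def)
  qed
  have good0: "good 0" by (rule eventually_nhds_x_imp_x[OF ev_good])
  have hpair: "holo2_at (pair_val c u E (q r) (q s)) p" if "good p" "r < k" "s < k" for r s p
    unfolding pair_val_def using goodD(11)[OF that(1,3)]
    by (intro holo2_add holo2_divide holo2_diff holo2_mult holo2_power holo2_const holo2_partial_x holo2_De goodD[OF that(1)] that)
  have hmid: "holo2_at (mid_val c u E (q r)) p" if "good p" "r < k" for r p
    unfolding mid_val_def
  proof (intro holo2_add holo2_divide holo2_diff holo2_mult holo2_power holo2_const holo2_partial_x holo2_De goodD[OF that(1)] that)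
    show "(u p - q r p)\<^sup>2 - E p \<noteq> 0" using goodD(11)[OF that] by (simp add: power2_commute)
  qed auto
  have hNe: "holo2_at (Ne r s) p" if "good p" "r < k" "s < k" "r \<noteq> s" for r s p
    unfolding Ne_def using goodD(9)[OF that]
    by (intro holo2_divide holo2_diff hpair goodD(1) that) auto
  have hNx: "holo2_at (Nx r s) p" if "good p" "r < k" "s < k" "r \<noteq> s" for r s p
    unfolding Nx_def by (intro holo2_diff holo2_mult hpair hNe goodD(1) that)
  have hJ: "holo2_at (J r) p" if "good p" "r < k" for r p
    unfolding J_def using goodD(8)[OF that(1)] goodD(10)[OF that]
    by (intro holo2_divide holo2_diff holo2_add holo2_mult holo2_const holo2_partial_x holo2_De hmid goodD that) auto
  have hI: "holo2_at (I r) p" if "good p" "r < k" for r p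
    unfolding I_def by (intro holo2_diff holo2_mult hmid hJ goodD(2) that)
  have heta: "holo2_at (eta_x c (q r) (q s) (q t)) p" "holo2_at (eta_e c (q r) (q s) (q t)) p"
    if "good p" "r < s" "s < t" "t < k" for r s t p
    using goodD(1)[OF that(1)] goodD(9)[OF that(1)] that by (auto intro!: holo2_eta)
  have h3x: "holo2_at (\<lambda>p. \<Sum>t<k. \<Sum>s<t. \<Sum>r<s. eta_x c (q r) (q s) (q t) p) p"
    and h3e: "holo2_at (\<lambda>p. \<Sum>t<k. \<Sum>s<t. \<Sum>r<s. eta_e c (q r) (q s) (q t) p) p"
    and h2x: "holo2_at (\<lambda>p. \<Sum>s<k. \<Sum>r<s. Nx r s p) p" and h2e: "holo2_at (\<lambda>p. \<Sum>s<k. \<Sum>r<s. Ne r s p) p"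
    and h1x: "holo2_at (\<lambda>p. \<Sum>r<k. I r p) p" and h1e: "holo2_at (\<lambda>p. \<Sum>r<k. J r p) p" if "good p" for p
    using that by (auto intro!: holo2_sum heta hNx hNe hI hJ)
  have hHX: "holo2_at HX p" and hHE: "holo2_at HE p" if "good p" for p
    unfolding HX_def HE_def
    by (intro holo2_add h3x[OF that] h2x[OF that] h1x[OF that] h3e[OF that] h2e[OF that] h1e[OF that])+
  have hK: "holo2_at (curl c HX HE) 0"
    unfolding curl_def by (intro holo2_diff holo2_partial_x holo2_De hHX hHE good0)
  have h\<rho>: "holo2_at (\<rho> r) p" if "good p" "r < k" for r p
    unfolding \<rho>_def using goodD(10)[OF that]
    by (intro holo2_divide holo2_add holo2_diff holo2_mult holo2_partial_x holo2_De goodD that) auto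
  have \<phi>: "\<phi> = (\<lambda>p. \<Sum>r<k. \<rho> r p)" unfolding \<phi>_def \<rho>_def ..
  have h\<phi>: "holo2_at \<phi> p" if "good p" for p unfolding \<phi> by (intro holo2_sum h\<rho> that) auto
  \<comment> \<open>The identities are proved at points off the curve, where \<surd>E exists; the
    functions \<open>HX\<close> and \<open>HE\<close> that they produce are holomorphic across the
    curve.\<close>
  have main: "curvature (k + 2) \<omega> p = curl c HX HE p + of_nat m / 2 *
      ((h p * (partial_x \<phi> p + De c (\<lambda>p. u p * \<phi> p) p) - \<phi> p * (partial_x h p + u p * De c h p)) / (h p)\<^sup>2)"
    if gp: "\<forall>\<^sub>F p in nhds p. good p" and hp: "h p \<noteq> 0" and Ehp: "\<forall>\<^sub>F p in nhds p. E p = h p ^ m * c0 p"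
      and \<omega>p: "\<forall>\<^sub>F p in nhds p. \<omega> p = Polynomial.smult (U p) ((\<Prod>i<k. slope_form c (q i p)) *
        ((slope_form c (u p))\<^sup>2 - Polynomial.smult (E p) ([:1, - c:]\<^sup>2)))" for p
  proof -
    have g: "good p" by (rule eventually_nhds_x_imp_x[OF gp])
    note G = goodD[OF g]
    have Ep: "E p \<noteq> 0" using eventually_nhds_x_imp_x[OF Ehp] hp G(8) by simp
    obtain v where v: "holo2_at v p" "\<forall>\<^sub>F q in nhds p. E q = (v q)\<^sup>2" using local_square_root[OF G(3) Ep] by blast
    have vp: "v p \<noteq> 0" using eventually_nhds_x_imp_x[OF v(2)] Ep by auto
    define P where "P r = u r + v r" for r
    define M where "M r = u r - v r" for r
    have hP: "holo2_at P p" and hM: "holo2_at M p" unfolding P_def M_def by (intro holo2_add holo2_diff G(2) v(1))+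
    have neq: "q i r \<noteq> P r" "q i r \<noteq> M r" if "(q i r - u r)\<^sup>2 - E r \<noteq> 0" "E r = (v r)\<^sup>2" for i r
      using that by (auto simp: P_def M_def power2_eq_square)
    have qP: "q i p \<noteq> P p" and qM: "q i p \<noteq> M p" if "i < k" for i
      using neq[OF G(11)[OF that]] eventually_nhds_x_imp_x[OF v(2)] by auto
    have PM: "P p \<noteq> M p" using vp by (simp add: P_def M_def algebra_simps eq_neg_iff_add_eq_0)
    \<comment> \<open>The two leaves of the 2-web get the last indices k and k + 1, as
      \<open>sum_triples_split\<close> expects.\<close>
    define w where "w i = (if i < k then q i else if i = k then P else M)" for i
    have w: "holo2_at (w i) p" for i using G(1) hP hM by (simp add: w_def)
    have wne: "w i p \<noteq> w j p" if "i < k + 2" "j < k + 2" "i \<noteq> j" for i j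
      using that G(9)[of i j] qP[of i] qP[THEN not_sym, of j] qM[of i] qM[THEN not_sym, of j] PM PM[THEN not_sym]
      by (cases "i < k"; cases "j < k"; cases "i = k"; cases "j = k") (simp_all add: w_def)
    have \<omega>w: "\<forall>\<^sub>F r in nhds p. \<omega> r = Polynomial.smult (U r) (\<Prod>i<k + 2. slope_form c (w i r))"
      using \<omega>p v(2)
    proof eventually_elim
      case (elim r)
      have "(\<Prod>i<k. slope_form c (w i r)) = (\<Prod>i<k. slope_form c (q i r))" by (rule prod.cong) (auto simp: w_def)
      then have "(\<Prod>i<k + 2. slope_form c (w i r)) = (\<Prod>i<k. slope_form c (q i r)) * (slope_form c (P r) * slope_form c (M r))"
        by (simp add: w_def mult.assoc)
      then show ?case using elim by (simp add: P_def M_def slope_form_conjugate)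
    qed
    have curv: "curvature (k + 2) \<omega> p = (\<Sum>t<k + 2. \<Sum>s<t. \<Sum>r<s. slope_curv c (w r) (w s) (w t) p)"
      by (rule curvature_slopes[OF _ w wne G(4,5) \<omega>w]) auto
    have t3: "(\<Sum>t<k. \<Sum>s<t. \<Sum>r<s. slope_curv c (w r) (w s) (w t) p) =
        curl c (\<lambda>p. \<Sum>t<k. \<Sum>s<t. \<Sum>r<s. eta_x c (q r) (q s) (q t) p) (\<lambda>p. \<Sum>t<k. \<Sum>s<t. \<Sum>r<s. eta_e c (q r) (q s) (q t) p) p"
    proof -
      have "curl c (\<lambda>p. \<Sum>t<k. \<Sum>s<t. \<Sum>r<s. eta_x c (q r) (q s) (q t) p) (\<lambda>p. \<Sum>t<k. \<Sum>s<t. \<Sum>r<s. eta_e c (q r) (q s) (q t) p) p =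
        (\<Sum>t<k. curl c (\<lambda>p. \<Sum>s<t. \<Sum>r<s. eta_x c (q r) (q s) (q t) p) (\<lambda>p. \<Sum>s<t. \<Sum>r<s. eta_e c (q r) (q s) (q t) p) p)"
        by (rule curl_sum) (auto intro!: holo2_sum heta[OF g])
      also have "\<dots> = (\<Sum>t<k. \<Sum>s<t. curl c (\<lambda>p. \<Sum>r<s. eta_x c (q r) (q s) (q t) p) (\<lambda>p. \<Sum>r<s. eta_e c (q r) (q s) (q t) p) p)"
        by (intro sum.cong refl curl_sum) (auto intro!: holo2_sum heta[OF g])
      also have "\<dots> = (\<Sum>t<k. \<Sum>s<t. \<Sum>r<s. curl c (eta_x c (q r) (q s) (q t)) (eta_e c (q r) (q s) (q t)) p)"
        by (intro sum.cong refl curl_sum) (auto intro!: heta[OF g])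
      also have "\<dots> = (\<Sum>t<k. \<Sum>s<t. \<Sum>r<s. slope_curv c (w r) (w s) (w t) p)"
        by (intro sum.cong refl) (auto simp: slope_curv_def w_def)
      finally show ?thesis ..
    qed
    have t2: "(\<Sum>s<k. \<Sum>r<s. slope_curv c (w r) (w s) (w k) p + slope_curv c (w r) (w s) (w (Suc k)) p) =
        curl c (\<lambda>p. \<Sum>s<k. \<Sum>r<s. Nx r s p) (\<lambda>p. \<Sum>s<k. \<Sum>r<s. Ne r s p) p"
    proof -
      have one: "slope_curv c (w r) (w s) (w k) p + slope_curv c (w r) (w s) (w (Suc k)) p = curl c (Nx r s) (Ne r s) p"
        if rs: "r < s" "s < k" for r s
      proof -
        have r: "r < k" "r \<noteq> s" using rs by auto
        note ne = G(9)[OF r(1) rs(2) r(2)] qP[OF r(1)] qP[OF rs(2)] qM[OF r(1)] qM[OF rs(2)]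
        have "slope_curv c (w r) (w s) (w k) p + slope_curv c (w r) (w s) (w (Suc k)) p =
          curl c (eta_x c (q r) (q s) P) (eta_e c (q r) (q s) P) p + curl c (eta_x c (q r) (q s) M) (eta_e c (q r) (q s) M) p"
          using rs by (simp add: w_def slope_curv_def)
        also have "\<dots> = curl c (\<lambda>p. eta_x c (q r) (q s) P p + eta_x c (q r) (q s) M p) (\<lambda>p. eta_e c (q r) (q s) P p + eta_e c (q r) (q s) M p) p"
          by (rule curl_add[symmetric]; rule holo2_eta[OF G(1)[OF r(1)] G(1)[OF rs(2)] hP ne(1-3)] holo2_eta[OF G(1)[OF r(1)] G(1)[OF rs(2)] hM ne(1,4,5)])
        also have "\<dots> = curl c (Nx r s) (Ne r s) p"
        proof -
          have "\<forall>\<^sub>F x in nhds p. eta_x c (q r) (q s) P x + eta_x c (q r) (q s) M x = Nx r s x \<and>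
              eta_e c (q r) (q s) P x + eta_e c (q r) (q s) M x = Ne r s x"
            using gp v(2) eventually_eventually[THEN iffD2, OF v(2)] holo2_eventually[OF v(1)]
          proof eventually_elim
            case (elim x)
            note gx = goodD[OF elim(1)]
            have d: "q r x \<noteq> q s x" by (rule gx(9)[OF r(1) rs(2) r(2)])
            note nx = neq[OF gx(11)[OF r(1)] elim(2)] neq[OF gx(11)[OF rs(2)] elim(2)]
            have 1: "eta_val c (q r) (q s) P x + eta_val c (q r) (q s) M x = pair_val c u E (q r) (q s) x"
              unfolding P_def M_def
              by (rule eta_val_conjugate_sum[OF gx(2) elim(4) elim(3)]) (use nx in \<open>auto simp: P_def M_def algebra_simps\<close>)
            have 2: "eta_val c (q s) (q r) P x + eta_val c (q s) (q r) M x = pair_val c u E (q s) (q r) x"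
              unfolding P_def M_def
              by (rule eta_val_conjugate_sum[OF gx(2) elim(4) elim(3)]) (use nx in \<open>auto simp: P_def M_def algebra_simps\<close>)
            let ?X = "eta_x c (q r) (q s) P x + eta_x c (q r) (q s) M x" and ?e = "eta_e c (q r) (q s) P x + eta_e c (q r) (q s) M x"
            have "?X + q r x * ?e = pair_val c u E (q r) (q s) x" "?X + q s x * ?e = pair_val c u E (q s) (q r) x"
              unfolding 1[symmetric] 2[symmetric] eta_vals[of "q r" x "q s", OF d, symmetric] by (simp_all add: algebra_simps)
            then show ?case using two_point_affine[OF d, of ?X ?e] unfolding Nx_def Ne_def by blast
          qed
          then show ?thesis by (intro curl_cong; rule eventually_mono) blast+
        qed
        finally show ?thesis .
      qed
      have "curl c (\<lambda>p. \<Sum>s<k. \<Sum>r<s. Nx r s p) (\<lambda>p. \<Sum>s<k. \<Sum>r<s. Ne r s p) p =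
          (\<Sum>s<k. curl c (\<lambda>p. \<Sum>r<s. Nx r s p) (\<lambda>p. \<Sum>r<s. Ne r s p) p)"
        by (rule curl_sum) (auto intro!: holo2_sum hNx[OF g] hNe[OF g])
      also have "\<dots> = (\<Sum>s<k. \<Sum>r<s. curl c (Nx r s) (Ne r s) p)"
        by (intro sum.cong refl curl_sum) (auto intro!: hNx[OF g] hNe[OF g])
      also have "\<dots> = (\<Sum>s<k. \<Sum>r<s. slope_curv c (w r) (w s) (w k) p + slope_curv c (w r) (w s) (w (Suc k)) p)"
        by (intro sum.cong refl) (use one in auto)
      finally show ?thesis ..
    qed
    \<comment> \<open>The total polar form has the value Z on (c, 1) and - u Z on (1, 0), so that it
      vanishes on slope u.\<close>
    define Z where "Z x = of_nat m / 2 * (\<phi> x / h x)" for x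
    have hZ: "holo2_at Z p" unfolding Z_def by (intro holo2_mult holo2_divide holo2_const h\<phi> g G(6) hp)
    define Zr where "Zr r x = of_nat m / 2 * (\<rho> r x / h x)" for r x
    have hZr: "holo2_at (Zr r) p" if "r < k" for r
      unfolding Zr_def by (intro holo2_mult holo2_divide holo2_const h\<rho> g G(6) hp that)
    have t1: "(\<Sum>r<k. slope_curv c (w r) (w k) (w (Suc k)) p) =
        curl c (\<lambda>p. \<Sum>r<k. I r p) (\<lambda>p. \<Sum>r<k. J r p) p + curl c (\<lambda>x. - (u x * Z x)) Z p"
    proof -
      have one: "slope_curv c (w r) (w k) (w (Suc k)) p = curl c (I r) (J r) p + curl c (\<lambda>x. - (u x * Zr r x)) (Zr r) p"
        if r: "r < k" for r
      proof -
        have "\<forall>\<^sub>F x in nhds p. eta_x c (q r) P M x = I r x + - (u x * Zr r x) \<and> eta_e c (q r) P M x = J r x + Zr r x"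
          using gp v(2) eventually_eventually[THEN iffD2, OF v(2)] holo2_eventually[OF v(1)] holo2_eventually_ne[OF v(1) vp]
            holo2_eventually_ne[OF G(6) hp] Ehp eventually_eventually[THEN iffD2, OF Ehp]
        proof eventually_elim
          case (elim x)
          note gx = goodD[OF elim(1)]
          note nx = neq[OF gx(11)[OF r] elim(2)]
          have qux: "q r x \<noteq> u x" by (rule gx(10)[OF r])
          let ?x = "eta_x c (q r) P M x" and ?e = "eta_e c (q r) P M x"
          have 1: "?x + q r x * ?e = (partial_x E x + q r x * De c E x) / (2 * E x) + De c (q r) x"
            and 2: "?x + u x * ?e = mid_val c u E (q r) x"
            unfolding P_def M_def
            by (rule eta_mid_conjugate[OF gx(2) elim(4) elim(3)], use nx elim(5) in \<open>simp_all add: P_def M_def\<close>)+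
          have hh: "holo2_at (\<lambda>p. h p ^ m) x" by (rule holo2_power[OF gx(6)])
          have hm: "h x ^ m = h x * h x ^ (m - 1)" using m by (cases m) auto
          have dE: "partial_x E x = of_nat m * h x ^ (m - 1) * partial_x h x * c0 x + h x ^ m * partial_x c0 x"
            "De c E x = of_nat m * h x ^ (m - 1) * De c h x * c0 x + h x ^ m * De c c0 x"
            using partial_cong(1)[OF elim(8)] De_cong[OF elim(8), of c] D_mult[OF hh gx(7)] D_power(1)[OF gx(6), where n = m] D_power(2)[OF gx(6), where n = m and c = c] by simp_all
          \<comment> \<open>Half the logarithmic derivative of E = h^m c0.\<close>
          have L: "(partial_x E x + q r x * De c E x) / (2 * E x) =
              of_nat m / 2 * ((partial_x h x + q r x * De c h x) / h x) + (partial_x c0 x + q r x * De c c0 x) / (2 * c0 x)"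
          proof -
            have "h x ^ (m - 1) \<noteq> 0" using elim(6) by simp
            then show ?thesis unfolding dE elim(7) hm using elim(6) gx(8) by (simp add: field_simps)
          qed
          have "?e * (q r x - u x) = (?x + q r x * ?e) - (?x + u x * ?e)" by (simp add: algebra_simps)
          also have "\<dots> = of_nat m / 2 * ((partial_x h x + q r x * De c h x) / h x) +
             ((partial_x c0 x + q r x * De c c0 x) / (2 * c0 x) + De c (q r) x - mid_val c u E (q r) x)"
            unfolding 1 2 L by simp
          finally have "?e = (of_nat m / 2 * ((partial_x h x + q r x * De c h x) / h x) +
             ((partial_x c0 x + q r x * De c c0 x) / (2 * c0 x) + De c (q r) x - mid_val c u E (q r) x)) / (q r x - u x)"
            using qux by (simp add: eq_divide_eq)
          also have "\<dots> = J r x + Zr r x"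
          proof -
            have "(s * (A / hh) + B) / d = B / d + s * ((A / d) / hh)" for s A hh B d :: complex
              by (simp add: add_divide_distrib)
            then show ?thesis unfolding J_def Zr_def \<rho>_def .
          qed
          finally have e: "?e = J r x + Zr r x" .
          moreover have "?x = mid_val c u E (q r) x - u x * ?e" using 2 by (simp add: algebra_simps)
          ultimately show ?case unfolding I_def by (simp add: algebra_simps)
        qed
        then have "slope_curv c (q r) P M p = curl c (\<lambda>x. I r x + - (u x * Zr r x)) (\<lambda>x. J r x + Zr r x) p"
          unfolding slope_curv_def by (intro curl_cong; rule eventually_mono) blast+
        also have "\<dots> = curl c (I r) (J r) p + curl c (\<lambda>x. - (u x * Zr r x)) (Zr r) p"
          by (intro curl_add holo2_uminus holo2_mult hI[OF g r] hJ[OF g r] hZr[OF r] G(2))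
        finally show ?thesis using r by (simp add: w_def)
      qed
      have "(\<Sum>r<k. slope_curv c (w r) (w k) (w (Suc k)) p) = (\<Sum>r<k. curl c (I r) (J r) p) + (\<Sum>r<k. curl c (\<lambda>x. - (u x * Zr r x)) (Zr r) p)"
        unfolding sum.distrib[symmetric] by (rule sum.cong) (use one in auto)
      also have "(\<Sum>r<k. curl c (I r) (J r) p) = curl c (\<lambda>p. \<Sum>r<k. I r p) (\<lambda>p. \<Sum>r<k. J r p) p"
        by (rule curl_sum[symmetric]) (auto intro!: hI[OF g] hJ[OF g])
      also have "(\<Sum>r<k. curl c (\<lambda>x. - (u x * Zr r x)) (Zr r) p) = curl c (\<lambda>x. \<Sum>r<k. - (u x * Zr r x)) (\<lambda>x. \<Sum>r<k. Zr r x) p"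
        by (rule curl_sum[symmetric]) (auto intro!: holo2_uminus holo2_mult hZr G(2))
      also have "(\<lambda>x. \<Sum>r<k. Zr r x) = Z" unfolding Zr_def Z_def \<phi> by (simp add: sum_distrib_left sum_divide_distrib)
      also have "(\<lambda>x. \<Sum>r<k. - (u x * Zr r x)) = (\<lambda>x. - (u x * Z x))"
        using \<open>(\<lambda>x. \<Sum>r<k. Zr r x) = Z\<close> by (simp add: sum_negf sum_distrib_left[symmetric] fun_eq_iff)
      finally show ?thesis .
    qed
    have hf: "curl c HX HE p = curl c (\<lambda>p. \<Sum>t<k. \<Sum>s<t. \<Sum>r<s. eta_x c (q r) (q s) (q t) p) (\<lambda>p. \<Sum>t<k. \<Sum>s<t. \<Sum>r<s. eta_e c (q r) (q s) (q t) p) p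
        + curl c (\<lambda>p. \<Sum>s<k. \<Sum>r<s. Nx r s p) (\<lambda>p. \<Sum>s<k. \<Sum>r<s. Ne r s p) p + curl c (\<lambda>p. \<Sum>r<k. I r p) (\<lambda>p. \<Sum>r<k. J r p) p"
      unfolding HX_def[abs_def] HE_def[abs_def]
      by (subst curl_add[OF holo2_add[OF h3x[OF g] h2x[OF g]] holo2_add[OF h3e[OF g] h2e[OF g]] h1x[OF g] h1e[OF g]],
          subst curl_add[OF h3x[OF g] h3e[OF g] h2x[OF g] h2e[OF g]]) simp
    have pol: "curl c (\<lambda>x. - (u x * Z x)) Z p = of_nat m / 2 *
      ((h p * (partial_x \<phi> p + De c (\<lambda>p. u p * \<phi> p) p) - \<phi> p * (partial_x h p + u p * De c h p)) / (h p)\<^sup>2)"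
    proof -
      have hu\<phi>: "holo2_at (\<lambda>p. u p * \<phi> p) p" by (intro holo2_mult G(2) h\<phi> g)
      have a: "partial_x Z p = of_nat m / 2 * ((partial_x \<phi> p * h p - \<phi> p * partial_x h p) / (h p)\<^sup>2)"
        unfolding Z_def[abs_def]
        using D_mult(1)[OF holo2_const holo2_divide[OF h\<phi>[OF g] G(6) hp], of "of_nat m / 2"] D_divide(1)[OF h\<phi>[OF g] G(6) hp]
        by (simp add: D_const)
      have "(\<lambda>x. - (u x * Z x)) = (\<lambda>x. - (of_nat m / 2) * ((u x * \<phi> x) / h x))" by (simp add: Z_def fun_eq_iff)
      then have b: "De c (\<lambda>x. - (u x * Z x)) p = - (of_nat m / 2) * ((De c (\<lambda>p. u p * \<phi> p) p * h p - u p * \<phi> p * De c h p) / (h p)\<^sup>2)"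
        using D_mult(2)[OF holo2_const holo2_divide[OF hu\<phi> G(6) hp], of c "- (of_nat m / 2)"] D_divide(2)[OF hu\<phi> G(6) hp, of c]
        by (simp add: D_const)
      have gen: "s * x - (- s) * y = s * (x + y)" for s x y :: complex by (simp add: algebra_simps)
      have "curl c (\<lambda>x. - (u x * Z x)) Z p = of_nat m / 2 * ((partial_x \<phi> p * h p - \<phi> p * partial_x h p) / (h p)\<^sup>2
          + (De c (\<lambda>p. u p * \<phi> p) p * h p - u p * \<phi> p * De c h p) / (h p)\<^sup>2)"
        unfolding curl_def a b by (rule gen)
      then show ?thesis unfolding add_divide_distrib[symmetric] by (simp add: algebra_simps)
    qed
    show ?thesis
      unfolding curv sum_triples_split t3 t2 t1 hf pol[symmetric] by simp
  qed
  have "\<forall>\<^sub>F p in nhds 0. h p \<noteq> 0 \<longrightarrow> curvature (k + 2) \<omega> p = curl c HX HE p + of_nat m / 2 *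
      ((h p * (partial_x \<phi> p + De c (\<lambda>p. u p * \<phi> p) p) - \<phi> p * (partial_x h p + u p * De c h p)) / (h p)\<^sup>2)"
    using eventually_eventually[THEN iffD2, OF ev_good] eventually_eventually[THEN iffD2, OF Eh] eventually_eventually[THEN iffD2, OF \<omega>]
    by eventually_elim (use main in blast)
  with hK show ?thesis by blast
qed

section \<open>Holomorphy and invariance along the discriminant\<close>

text \<open>With \<open>\<theta>\<close> the form vanishing on the barycenter, \<open>g = dh(X)\<close> and \<open>\<phi> dx \<and> dy = dh \<and> \<theta>\<close>, where \<open>X\<close> spans
  \<open>W\<^sub>2\<close> along \<open>h = 0\<close>, the polar part is \<open>d(\<phi> \<omega>\<^sub>0 / h)\<close> with \<open>\<phi> \<omega>\<^sub>0 = k dh + g \<theta>\<close>: it is holomorphic as soon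
  as \<open>h\<close> divides \<open>\<phi>\<close> or \<open>g\<close>.\<close>

lemma polar_part_holomorphic_iff:
  fixes q :: "nat \<Rightarrow> point \<Rightarrow> complex" and u h f K :: "point \<Rightarrow> complex" and c m :: complex
  assumes h: "holo2_at h 0" "h 0 = 0" "(partial_x h 0, partial_y h 0) \<noteq> 0"
    and q: "\<And>i. i < k \<Longrightarrow> holo2_at (q i) 0" and u: "holo2_at u 0" and qu: "\<And>i. i < k \<Longrightarrow> q i 0 \<noteq> u 0"
    and S: "\<forall>\<^sub>F p in nhds 0. p \<in> S \<longleftrightarrow> h p = 0" and K: "holo2_at K 0" and m: "m \<noteq> 0"
  defines "\<phi> \<equiv> \<lambda>p. \<Sum>i<k. (partial_x h p + q i p * De c h p) / (q i p - u p)"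
    and "g \<equiv> \<lambda>p. partial_x h p + u p * De c h p"
  assumes f: "\<forall>\<^sub>F p in nhds 0. h p \<noteq> 0 \<longrightarrow>
    f p = K p + m * ((h p * (partial_x \<phi> p + De c (\<lambda>p. u p * \<phi> p) p) - \<phi> p * g p) / (h p)\<^sup>2)"
  shows "holomorphic_along f S \<longleftrightarrow>
    (\<forall>\<^sub>F p in nhds 0. h p = 0 \<longrightarrow> g p = 0) \<or> (\<forall>\<^sub>F p in nhds 0. h p = 0 \<longrightarrow> \<phi> p = 0)"
proof
  have hg: "holo2_at g 0" unfolding g_def
    by (intro holo2_add holo2_mult holo2_partial_x holo2_De h u)
  have h\<phi>: "holo2_at \<phi> 0" unfolding \<phi>_def
    by (intro holo2_sum holo2_divide holo2_diff holo2_add holo2_mult holo2_partial_x holo2_De h u q) (use qu in auto)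
  define R where "R p = partial_x \<phi> p + De c (\<lambda>p. u p * \<phi> p) p" for p
  have hu\<phi>: "holo2_at (\<lambda>p. u p * \<phi> p) 0" by (intro holo2_mult u h\<phi>)
  have hR: "holo2_at R 0" unfolding R_def by (intro holo2_add holo2_partial_x holo2_De h\<phi> hu\<phi>)
  {
    assume "holomorphic_along f S"
    then obtain G where G: "holo2_at G 0" "\<forall>\<^sub>F p in nhds 0. p \<notin> S \<longrightarrow> f p = G p"
      unfolding holomorphic_along_def by blast
    \<comment> \<open>h^2 times the difference of the two expressions for f. It vanishes off the
      curve, hence identically, and on h = 0 it reduces to m \<phi> g.\<close>
    define D where "D p = (h p)\<^sup>2 * (G p - K p) - m * (h p * R p - \<phi> p * g p)" for p
    have "holo2_at D 0" unfolding D_def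
      by (intro holo2_diff holo2_mult holo2_power holo2_const h G(1) K hR h\<phi> hg)
    moreover have "\<forall>\<^sub>F p in nhds 0. h p \<noteq> 0 \<longrightarrow> D p = 0"
      using S G(2) f
    proof eventually_elim
      case (elim p)
      show ?case
      proof
        assume hp: "h p \<noteq> 0"
        then have "G p = K p + m * ((h p * R p - \<phi> p * g p) / (h p)\<^sup>2)" using elim unfolding R_def by metis
        then show "D p = 0" unfolding D_def using hp by simp
      qed
    qed
    ultimately have "\<forall>\<^sub>F p in nhds 0. D p = 0" by (rule zero_off_curve[OF h])
    then have "\<forall>\<^sub>F p in nhds 0. h p = 0 \<longrightarrow> g p * \<phi> p = 0"
      by eventually_elim (use m in \<open>auto simp: D_def\<close>)
    then show "(\<forall>\<^sub>F p in nhds 0. h p = 0 \<longrightarrow> g p = 0) \<or> (\<forall>\<^sub>F p in nhds 0. h p = 0 \<longrightarrow> \<phi> p = 0)"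
      by (rule product_zero_on_curve[OF h hg h\<phi>])
  }
  have extend: "holomorphic_along f S"
    if R1: "holo2_at R1 0" "\<forall>\<^sub>F p in nhds 0. h p * R p - \<phi> p * g p = (h p)\<^sup>2 * R1 p" for R1
    unfolding holomorphic_along_def
  proof (intro exI[of _ "\<lambda>p. K p + m * R1 p"] conjI)
    show "holo2_at (\<lambda>p. K p + m * R1 p) 0" by (intro holo2_add holo2_mult holo2_const K R1(1))
    show "\<forall>\<^sub>F p in nhds 0. p \<notin> S \<longrightarrow> f p = K p + m * R1 p"
      using S f R1(2)
    proof eventually_elim
      case (elim p) then show ?case by (simp add: R_def)
    qed
  qed
  assume "(\<forall>\<^sub>F p in nhds 0. h p = 0 \<longrightarrow> g p = 0) \<or> (\<forall>\<^sub>F p in nhds 0. h p = 0 \<longrightarrow> \<phi> p = 0)"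
  then show "holomorphic_along f S"
  proof
    assume "\<forall>\<^sub>F p in nhds 0. h p = 0 \<longrightarrow> \<phi> p = 0"
    from divide_by_smooth[OF h h\<phi> this] obtain a where a: "holo2_at a 0" "\<forall>\<^sub>F p in nhds 0. \<phi> p = h p * a p" by blast
    have hua: "holo2_at (\<lambda>p. u p * a p) 0" by (intro holo2_mult u a)
    show ?thesis
    proof (rule extend)
      show "holo2_at (\<lambda>p. partial_x a p + De c (\<lambda>p. u p * a p) p) 0"
        by (intro holo2_add holo2_partial_x holo2_De a hua)
      show "\<forall>\<^sub>F p in nhds 0. h p * R p - \<phi> p * g p = (h p)\<^sup>2 * (partial_x a p + De c (\<lambda>p. u p * a p) p)"
        using eventually_eventually[THEN iffD2, OF a(2)] a(2) holo2_eventually[OF h(1)] holo2_eventually[OF a(1)] holo2_eventually[OF u]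
          holo2_eventually[OF hua]
      proof eventually_elim
        case (elim p)
        have u\<phi>: "\<forall>\<^sub>F p in nhds p. u p * \<phi> p = h p * (u p * a p)"
          using elim(1) by eventually_elim simp
        have "partial_x \<phi> p = partial_x h p * a p + h p * partial_x a p"
          using partial_cong(1)[OF elim(1)] D_mult(1)[OF elim(3,4)] by simp
        moreover have "De c (\<lambda>p. u p * \<phi> p) p = De c h p * (u p * a p) + h p * De c (\<lambda>p. u p * a p) p"
          using De_cong[OF u\<phi>, of c] D_mult(2)[OF elim(3,6), of c] by simp
        \<comment> \<open>Here R is a g plus a multiple of h, and h a g is exactly \<phi> g.\<close>
        ultimately show ?case
          unfolding R_def elim(2) g_def by (simp add: power2_eq_square algebra_simps)
      qed
    qed
  next
    assume "\<forall>\<^sub>F p in nhds 0. h p = 0 \<longrightarrow> g p = 0"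
    from divide_by_smooth[OF h hg this] obtain a where a: "holo2_at a 0" "\<forall>\<^sub>F p in nhds 0. g p = h p * a p" by blast
    \<comment> \<open>Since partial_x h + q i De h = g + (q i - u) De h, division by q i - u and
      summation give \<phi> = h b + k De h. The second summand need not vanish on the curve and has
      to cancel later.\<close>
    define b where "b p = (\<Sum>i<k. 1 / (q i p - u p)) * a p" for p
    have hb: "holo2_at b 0" unfolding b_def
      by (intro holo2_mult holo2_sum holo2_divide holo2_diff holo2_const q u a) (use qu in auto)
    have hub: "holo2_at (\<lambda>p. u p * b p) 0" by (intro holo2_mult u hb)
    have evqu: "\<forall>\<^sub>F p in nhds 0. \<forall>i\<in>{..<k}. q i p \<noteq> u p"
      using q qu u by (intro eventually_ball_finite ballI holo2_distinct_near) auto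
    have \<phi>b: "\<forall>\<^sub>F p in nhds 0. \<phi> p = h p * b p + of_nat k * De c h p"
      using evqu a(2)
    proof eventually_elim
      case (elim p)
      have "\<phi> p = (\<Sum>i<k. 1 / (q i p - u p) * g p + De c h p)"
        unfolding \<phi>_def g_def
      proof (rule sum.cong[OF refl])
        fix i assume "i \<in> {..<k}"
        then have w: "q i p - u p \<noteq> 0" using elim(1) by auto
        have e: "partial_x h p + q i p * De c h p = (partial_x h p + u p * De c h p) + (q i p - u p) * De c h p"
          by (simp add: algebra_simps)
        have "(A + w * D) / w = 1 / w * A + D" if "w \<noteq> 0" for A D w :: complex
          using that by (simp add: add_divide_distrib)
        from this[OF w] show "(partial_x h p + q i p * De c h p) / (q i p - u p) =
            1 / (q i p - u p) * (partial_x h p + u p * De c h p) + De c h p" unfolding e .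
      qed
      also have "\<dots> = (\<Sum>i<k. 1 / (q i p - u p)) * g p + of_nat k * De c h p"
        by (simp add: sum.distrib sum_distrib_right)
      finally show ?case unfolding elim(2) b_def by (simp add: mult_ac)
    qed
    show ?thesis
    proof (rule extend)
      show "holo2_at (\<lambda>p. partial_x b p + De c (\<lambda>p. u p * b p) p + of_nat k * De c a p) 0"
        by (intro holo2_add holo2_mult holo2_const holo2_partial_x holo2_De a hb hub)
      show "\<forall>\<^sub>F p in nhds 0. h p * R p - \<phi> p * g p = (h p)\<^sup>2 * (partial_x b p + De c (\<lambda>p. u p * b p) p + of_nat k * De c a p)"
        using eventually_eventually[THEN iffD2, OF \<phi>b] \<phi>b eventually_eventually[THEN iffD2, OF a(2)] a(2)
          holo2_eventually[OF h(1)] holo2_eventually[OF a(1)] holo2_eventually[OF u] holo2_eventually[OF hb] holo2_eventually[OF hub]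
      proof eventually_elim
        case (elim p)
        note hD = holo2_De[OF elim(5), of c] and hX = holo2_partial_x[OF elim(5)]
        have huD: "holo2_at (\<lambda>p. u p * De c h p) p" by (rule holo2_mult[OF elim(7) hD])
        have hkD: "holo2_at (\<lambda>p. of_nat k * De c h p) p" and hkuD: "holo2_at (\<lambda>p. of_nat k * (u p * De c h p)) p"
          by (intro holo2_mult holo2_const hD huD)+
        have u\<phi>: "\<forall>\<^sub>F p in nhds p. u p * \<phi> p = h p * (u p * b p) + of_nat k * (u p * De c h p)"
          using elim(1) by eventually_elim (simp add: algebra_simps)
        have 1: "partial_x \<phi> p = (partial_x h p * b p + h p * partial_x b p) + of_nat k * partial_x (De c h) p"
          using partial_cong(1)[OF elim(1)] D_add(1)[OF holo2_mult[OF elim(5,8)] hkD] D_mult(1)[OF elim(5,8)]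
            D_mult(1)[OF holo2_const hD, of "of_nat k"] by (simp add: D_const)
        have 2: "De c (\<lambda>p. u p * \<phi> p) p = (De c h p * (u p * b p) + h p * De c (\<lambda>p. u p * b p) p) + of_nat k * De c (\<lambda>p. u p * De c h p) p"
          using De_cong[OF u\<phi>, of c] D_add(2)[OF holo2_mult[OF elim(5,9)] hkuD, of c] D_mult(2)[OF elim(5,9), of c]
            D_mult(2)[OF holo2_const huD, of c "of_nat k"] by (simp add: D_const)
        \<comment> \<open>De g is computed in two ways: from the definition of g, using that the two
          derivatives commute, and from g = h a. The resulting term k a De h of R, multiplied by h,
          cancels against k De h times g.\<close>
        have 3: "partial_x (De c h) p + De c (\<lambda>p. u p * De c h p) p = De c h p * a p + h p * De c a p"
        proof -
          have "De c g p = De c (partial_x h) p + De c (\<lambda>p. u p * De c h p) p"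
            unfolding g_def using D_add(2)[OF hX huD, of c] .
          moreover have "De c g p = De c h p * a p + h p * De c a p"
            using De_cong[OF elim(3), of c] D_mult(2)[OF elim(5,6), of c] by simp
          ultimately show ?thesis using D_commute[OF elim(5), of c] by simp
        qed
        have R: "R p = h p * (partial_x b p + De c (\<lambda>p. u p * b p) p) + b p * g p + of_nat k * (partial_x (De c h) p + De c (\<lambda>p. u p * De c h p) p)"
          unfolding R_def 1 2 g_def by (simp add: algebra_simps)
        show ?case unfolding R 3 elim(2) elim(4) by (simp add: power2_eq_square algebra_simps)
      qed
    qed
  qed
qed

text \<open>Two smooth equations of the same set divide each other, so their gradients at p are
  proportional and the tangent line does not depend on the chosen equation.\<close>

lemma tangent_line_eq:
  assumes h: "smooth_equation S p h"
  shows "tangent_line S p = {v. partial_x h p * fst v + partial_y h p * snd v = 0}"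
proof -
  have ratio: "partial_x h' p = partial_x h p * a p \<and> partial_y h' p = partial_y h p * a p"
    if h: "smooth_equation S p h" and h': "smooth_equation S p h'" and a: "holo2_at a p" "\<forall>\<^sub>F q in nhds p. h' q = h q * a q"
    for h h' a
  proof -
    have "holo2_at h p" "h p = 0" using h unfolding smooth_equation_def by blast+
    then show ?thesis
      using partial_cong[OF a(2)] hasd_partial[OF hasd_mult[OF holo2_hasd[OF \<open>holo2_at h p\<close>] holo2_hasd[OF a(1)]]] by simp
  qed
  have sub: "partial_x h' p * fst v + partial_y h' p * snd v = 0"
    if h: "smooth_equation S p h" and h': "smooth_equation S p h'" and v: "partial_x h p * fst v + partial_y h p * snd v = 0" for h h' v
  proof -
    have h1: "holo2_at h p" "h p = 0" "(partial_x h p, partial_y h p) \<noteq> 0" "\<forall>\<^sub>F q in nhds p. q \<in> S \<longleftrightarrow> h q = 0"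
      using h unfolding smooth_equation_def by blast+
    have h2: "holo2_at h' p" "\<forall>\<^sub>F q in nhds p. q \<in> S \<longleftrightarrow> h' q = 0"
      using h' unfolding smooth_equation_def by blast+
    have "\<forall>\<^sub>F q in nhds p. h q = 0 \<longrightarrow> h' q = 0" using h1(4) h2(2) by eventually_elim simp
    from divide_by_smooth[OF h1(1-3) h2(1) this] obtain a where "holo2_at a p" "\<forall>\<^sub>F q in nhds p. h' q = h q * a q" by blast
    from ratio[OF h h' this] have "partial_x h' p * fst v + partial_y h' p * snd v = a p * (partial_x h p * fst v + partial_y h p * snd v)"
      by (simp add: algebra_simps)
    then show ?thesis using v by simp
  qed
  show ?thesis unfolding tangent_line_def using h sub by blast
qed

text \<open>Normalized to be 1 at z, the factor of index i takes the value - s i at e. Hence the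
  barycenter is the kernel of the sum of the normalized factors, a description free of e.\<close>

lemma barycenter_line_factored:
  fixes a b :: "nat \<Rightarrow> complex"
  assumes P: "\<And>v. form_eval k P v = L * (\<Prod>i<k. a i * fst v + b i * snd v)"
    and L: "L \<noteq> 0" and k: "k \<ge> 1" and z: "\<And>i. i < k \<Longrightarrow> a i * fst z + b i * snd z \<noteq> 0"
  shows "barycenter_line k P z = {v. (\<Sum>i<k. (a i * fst v + b i * snd v) / (a i * fst z + b i * snd z)) = 0}"
proof -
  define l where "l i v = a i * fst v + b i * snd v" for i and v :: "complex \<times> complex"
  define \<Lambda> where "\<Lambda> v = (\<Sum>i<k. l i v / l i z)" for v
  have lz: "l i z \<noteq> 0" if "i < k" for i using z[OF that] by (simp add: l_def)
  have P': "form_eval k P v = L * (\<Prod>i<k. l i v)" for v unfolding P l_def ..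
  have Pz: "form_eval k P z \<noteq> 0" unfolding P' using L lz by simp
  have ll: "l i (v + cscale t w) = l i v + t * l i w" for i v t w by (simp add: l_def cscale_def algebra_simps)
  have ls: "l i (cscale t w) = t * l i w" for i t w by (simp add: l_def cscale_def algebra_simps)
  have \<Lambda>l: "\<Lambda> (v + cscale t w) = \<Lambda> v + t * \<Lambda> w" for v t w
    unfolding \<Lambda>_def ll by (simp add: add_divide_distrib sum.distrib sum_distrib_left)
  have \<Lambda>s: "\<Lambda> (cscale t w) = t * \<Lambda> w" for t w
    unfolding \<Lambda>_def ls by (simp add: sum_distrib_left)
  have \<Lambda>z: "\<Lambda> z = of_nat k" unfolding \<Lambda>_def using lz by simp
  have split: "form_eval k P (cscale x e + cscale y z) = form_eval k P z * (\<Prod>i<k. y - (- l i e / l i z) * x)" for x y e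
  proof -
    have "(\<Prod>i<k. l i (cscale x e + cscale y z)) = (\<Prod>i<k. l i z * (y - (- l i e / l i z) * x))"
      by (rule prod.cong) (use lz in \<open>auto simp: ll ls field_simps\<close>)
    then show ?thesis unfolding P' by (simp only: prod.distrib mult.assoc)
  qed
  show ?thesis
    unfolding barycenter_line_def if_not_P[OF Pz] l_def[symmetric] \<Lambda>_def[symmetric]
  proof (intro equalityI subsetI)
    fix v assume "v \<in> {v. \<exists>e s. wedge e z \<noteq> 0 \<and> (\<forall>x y. form_eval k P (cscale x e + cscale y z) = form_eval k P z * (\<Prod>i<k. y - s i * x)) \<and>
        v \<in> cline (e + cscale ((\<Sum>i<k. s i) / of_nat k) z)}"
    then obtain e s t where es: "\<And>x y. form_eval k P (cscale x e + cscale y z) = form_eval k P z * (\<Prod>i<k. y - s i * x)"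
      and v: "v = cscale t (e + cscale ((\<Sum>i<k. s i) / of_nat k) z)" by (auto simp: cline_def)
    \<comment> \<open>The given s splits the same polynomial; comparing derivatives at 0 yields
      equality of the sums without matching the \<open>s i\<close> one by one.\<close>
    have "(\<lambda>x. \<Prod>i<k. 1 - (- l i e / l i z) * x) = (\<lambda>x. \<Prod>i<k. 1 - s i * x)"
    proof
      fix x
      have "form_eval k P z * (\<Prod>i<k. 1 - (- l i e / l i z) * x) = form_eval k P z * (\<Prod>i<k. 1 - s i * x)"
        unfolding split[symmetric] es[symmetric] ..
      then show "(\<Prod>i<k. 1 - (- l i e / l i z) * x) = (\<Prod>i<k. 1 - s i * x)" using Pz by simp
    qed
    note eq = this
    have d: "((\<lambda>x. \<Prod>i<k. 1 - r i * x) has_field_derivative - (\<Sum>i<k. r i)) (at 0)" for r :: "nat \<Rightarrow> complex"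
    proof -
      have "((\<lambda>x. C * (\<Prod>i<k. 1 - r i * x)) has_field_derivative C * (\<Sum>i<k. - r i * (\<Prod>j\<in>{..<k} - {i}. 1 - r j * 0))) (at 0)" for C
        by (auto intro!: derivative_eq_intros has_field_derivative_prod)
      from this[of 1] show ?thesis by (simp add: sum_negf)
    qed
    have "- (\<Sum>i<k. - l i e / l i z) = - (\<Sum>i<k. s i)"
      by (rule DERIV_unique[OF d[of "\<lambda>i. - l i e / l i z", unfolded eq] d[of s]])
    then have "\<Lambda> e = - (\<Sum>i<k. s i)" by (simp add: \<Lambda>_def sum_negf)
    then have "\<Lambda> v = 0" unfolding v \<Lambda>s \<Lambda>l \<Lambda>z using k by simp
    then show "v \<in> {v. \<Lambda> v = 0}" by simp
  next
    fix v assume "v \<in> {v. \<Lambda> v = 0}"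
    then have v0: "\<Lambda> v = 0" by simp
    have z0: "z \<noteq> 0" using lz[of 0] k by (auto simp: l_def)
    have wit: "\<exists>e s. wedge e z \<noteq> 0 \<and> (\<forall>x y. form_eval k P (cscale x e + cscale y z) = form_eval k P z * (\<Prod>i<k. y - s i * x)) \<and>
        v \<in> cline (e + cscale ((\<Sum>i<k. s i) / of_nat k) z)"
      if "wedge e z \<noteq> 0" "v \<in> cline (e + cscale ((\<Sum>i<k. - l i e / l i z) / of_nat k) z)" for e
      using that split by (intro exI[of _ e] exI[of _ "\<lambda>i. - l i e / l i z"]) blast
    show "v \<in> {v. \<exists>e s. wedge e z \<noteq> 0 \<and> (\<forall>x y. form_eval k P (cscale x e + cscale y z) = form_eval k P z * (\<Prod>i<k. y - s i * x)) \<and>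
        v \<in> cline (e + cscale ((\<Sum>i<k. s i) / of_nat k) z)}"
    \<comment> \<open>A nonzero v in the kernel is its own witness e, with barycenter parameter 0;
      for v = 0 any vector independent of z will do.\<close>
    proof (cases "v = 0")
      case True
      obtain e where "wedge e z \<noteq> 0"
      proof (cases "fst z = 0")
        case True
        then have "wedge (1, 0) z \<noteq> 0" using z0 by (auto simp: wedge_def prod_eq_iff)
        then show ?thesis using that by blast
      next
        case False
        then have "wedge (0, 1) z \<noteq> 0" by (simp add: wedge_def)
        then show ?thesis using that by blast
      qed
      moreover have "v \<in> cline y" for y using True by (auto simp: cline_def cscale_def zero_prod_def intro!: image_eqI[of _ _ 0])
      ultimately show ?thesis using wit by blast
    next
      case False
      have "wedge v z \<noteq> 0"
      proof
        assume w: "wedge v z = 0"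
        have "\<exists>t. v = cscale t z"
        proof (cases "fst z = 0")
          case True
          then have "snd z \<noteq> 0" using z0 by (auto simp: prod_eq_iff)
          then have "v = cscale (snd v / snd z) z" using w True by (auto simp: wedge_def cscale_def prod_eq_iff)
          then show ?thesis by blast
        next
          case False
          then have "v = cscale (fst v / fst z) z" using w by (auto simp: wedge_def cscale_def prod_eq_iff field_simps)
          then show ?thesis by blast
        qed
        then obtain t where t: "v = cscale t z" by blast
        then have "t = 0" using v0 k unfolding t \<Lambda>s \<Lambda>z by simp
        then show False using \<open>v \<noteq> 0\<close> t by (simp add: cscale_def zero_prod_def)
      qed
      moreover have "(\<Sum>i<k. - l i v / l i z) = 0" using v0 by (simp add: \<Lambda>_def sum_negf)
      then have "v + cscale ((\<Sum>i<k. - l i v / l i z) / of_nat k) z = v" by (simp add: cscale_def prod_eq_iff)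
      moreover have "v \<in> cline v" unfolding cline_def by (rule image_eqI[of _ _ 1]) (simp_all add: cscale_def)
      ultimately show ?thesis using wit[of v] by simp
    qed
  qed
qed

text \<open>With fst v - c snd v and snd v as coordinates of v in the frame, both sets are kernels
  of linear forms; the inclusion says that the second form is a multiple of the first, nonzero
  one.\<close>

lemma tangent_kernel_subset_iff:
  fixes A B C D c :: complex
  assumes "(A, B) \<noteq> (0, 0)"
  shows "{v. A * (fst v - c * snd v) + B * snd v = 0} \<subseteq> {v. C * (fst v - c * snd v) + D * snd v = 0} \<longleftrightarrow> C * B - D * A = 0"
proof
  assume sub: "{v. A * (fst v - c * snd v) + B * snd v = 0} \<subseteq> {v. C * (fst v - c * snd v) + D * snd v = 0}"
  have "(B - c * A, - A) \<in> {v. A * (fst v - c * snd v) + B * snd v = 0}" by (simp add: algebra_simps)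
  then have "(B - c * A, - A) \<in> {v. C * (fst v - c * snd v) + D * snd v = 0}" using sub by blast
  then show "C * B - D * A = 0" by (simp add: algebra_simps)
next
  assume eq: "C * B - D * A = 0"
  show "{v. A * (fst v - c * snd v) + B * snd v = 0} \<subseteq> {v. C * (fst v - c * snd v) + D * snd v = 0}"
  proof
    fix v assume "v \<in> {v. A * (fst v - c * snd v) + B * snd v = 0}"
    then have v: "A * (fst v - c * snd v) + B * snd v = 0" by simp
    let ?w = "C * (fst v - c * snd v) + D * snd v"
    have "B * ?w = D * (A * (fst v - c * snd v) + B * snd v) + (C * B - D * A) * (fst v - c * snd v)"
      "A * ?w = C * (A * (fst v - c * snd v) + B * snd v) - (C * B - D * A) * snd v"
      by (simp_all add: algebra_simps)
    then have "B * ?w = 0" "A * ?w = 0" unfolding v eq by simp_all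
    then show "v \<in> {v. C * (fst v - c * snd v) + D * snd v = 0}" using assms by auto
  qed
qed

theorem theorem1:
  fixes k :: nat and \<omega> \<omega>2 \<omega>k :: symform
  assumes "k \<ge> 1"
    and "web_germ (k + 2) \<omega>"
    and "0 \<in> disc_support (k + 2) \<omega>"
    and "regular_point (disc_support (k + 2) \<omega>) 0"
    and "web_germ 2 \<omega>2"
    and "web_germ k \<omega>k"
    and "same_web \<omega> (superpose \<omega>2 \<omega>k)"
    and "same_divisor (web_disc 2 \<omega>2) (web_disc (k + 2) \<omega>)"
  shows "holomorphic_along (curvature (k + 2) \<omega>) (disc_support (k + 2) \<omega>) \<longleftrightarrow>
           invariant_by (disc_support (k + 2) \<omega>) (web_tangents 2 \<omega>2) \<or>
           invariant_by (disc_support (k + 2) \<omega>) (barycenter_tangents 2 \<omega>2 k \<omega>k)"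
proof -
  define S where "S = disc_support (k + 2) \<omega>"
  obtain h where h: "smooth_equation S 0 h" using assms(4) unfolding regular_point_def S_def by blast
  then have h0: "holo2_at h 0" "h 0 = 0" "(partial_x h 0, partial_y h 0) \<noteq> 0"
    and hS: "\<forall>\<^sub>F p in nhds 0. p \<in> S \<longleftrightarrow> h p = 0" unfolding smooth_equation_def by blast+
  obtain c q u E Lk L2 where q': "\<forall>i<k. holo2_at (q i) 0" and u: "holo2_at u 0" and EL: "holo2_at E 0" "holo2_at Lk 0" "holo2_at L2 0"
      "Lk 0 \<noteq> 0" "L2 0 \<noteq> 0" "E 0 = 0"
    and qq': "\<forall>i<k. \<forall>j<k. i \<noteq> j \<longrightarrow> q i 0 \<noteq> q j 0" and qu': "\<forall>i<k. q i 0 \<noteq> u 0"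
    and \<omega>k: "\<forall>\<^sub>F p in nhds 0. \<omega>k p = Polynomial.smult (Lk p) (\<Prod>i<k. slope_form c (q i p))"
    and \<omega>2: "\<forall>\<^sub>F p in nhds 0. \<omega>2 p = Polynomial.smult (L2 p) ((slope_form c (u p))\<^sup>2 - Polynomial.smult (E p) ([:1, - c:]\<^sup>2))"
    and ES: "\<forall>\<^sub>F p in nhds 0. p \<in> S \<longleftrightarrow> E p = 0"
    using normal_form[OF assms(1,2,5,6,7,8,3)] unfolding S_def[symmetric] by (elim exE conjE)
  note q = q'[rule_format] and E = EL(1,6) and Lk = EL(2,4) and L2 = EL(3,5) and qq = qq'[rule_format] and qu = qu'[rule_format]
  have "\<forall>\<^sub>F p in nhds 0. E p = 0 \<longrightarrow> h p = 0" using ES hS by eventually_elim simp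
  \<comment> \<open>The discriminant need not be reduced: m is the multiplicity of E along the
    curve, and it matters only that the factor m / 2 is nonzero.\<close>
  from factor_along_curve[OF h0 E this] obtain m c0 where m: "m \<ge> 1" and c0: "holo2_at c0 0" "c0 0 \<noteq> 0"
    and Eh: "\<forall>\<^sub>F p in nhds 0. E p = h p ^ m * c0 p" by blast
  obtain r where r: "holo2_at r 0" "r 0 \<noteq> 0" "\<forall>\<^sub>F p in nhds 0. \<omega> p = Polynomial.smult (r p) (\<omega>2 p * \<omega>k p)"
    using assms(7) unfolding same_web_def superpose_def by blast
  define U where "U p = r p * (L2 p * Lk p)" for p
  have U: "holo2_at U 0" "U 0 \<noteq> 0" unfolding U_def using r L2 Lk by (auto intro!: holo2_mult)
  have \<omega>: "\<forall>\<^sub>F p in nhds 0. \<omega> p = Polynomial.smult (U p) ((\<Prod>i<k. slope_form c (q i p)) *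
        ((slope_form c (u p))\<^sup>2 - Polynomial.smult (E p) ([:1, - c:]\<^sup>2)))"
    using r(3) \<omega>2 \<omega>k
  proof eventually_elim
    case (elim p)
    have "Polynomial.smult x (Polynomial.smult y B * Polynomial.smult z A) = Polynomial.smult (x * (y * z)) (A * B)"
      for x y z :: complex and A B :: "complex poly"
      by (simp add: mult_ac)
    then show ?case unfolding U_def elim .
  qed
  define \<phi> where "\<phi> = (\<lambda>p. \<Sum>i<k. (partial_x h p + q i p * De c h p) / (q i p - u p))"
  define g where "g = (\<lambda>p. partial_x h p + u p * De c h p)"
  have "\<exists>K. holo2_at K 0 \<and> (\<forall>\<^sub>F p in nhds 0. h p \<noteq> 0 \<longrightarrow>
    curvature (k + 2) \<omega> p = K p + of_nat m / 2 *
      ((h p * (partial_x \<phi> p + De c (\<lambda>p. u p * \<phi> p) p) - \<phi> p * g p) / (h p)\<^sup>2))"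
    unfolding \<phi>_def g_def by (rule curvature_polar_part[OF q u E U h0(1) c0 qq qu Eh m \<omega>])
  then obtain K where K: "holo2_at K 0" "\<forall>\<^sub>F p in nhds 0. h p \<noteq> 0 \<longrightarrow>
    curvature (k + 2) \<omega> p = K p + of_nat m / 2 *
      ((h p * (partial_x \<phi> p + De c (\<lambda>p. u p * \<phi> p) p) - \<phi> p * g p) / (h p)\<^sup>2)"
    by (elim exE conjE)
  have m0: "of_nat m / 2 \<noteq> (0 :: complex)" using m by simp
  have "holomorphic_along (curvature (k + 2) \<omega>) S \<longleftrightarrow>
      (\<forall>\<^sub>F p in nhds 0. h p = 0 \<longrightarrow> g p = 0) \<or> (\<forall>\<^sub>F p in nhds 0. h p = 0 \<longrightarrow> \<phi> p = 0)"
    unfolding \<phi>_def g_def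
    by (rule polar_part_holomorphic_iff[OF h0 q u qu hS K(1) m0 K(2)[unfolded \<phi>_def g_def]])
  \<comment> \<open>Invariance speaks of the regular points of S; near 0 these are exactly the
    points of the curve, where the differential of h has the components partial_x h and De h in the
    frame.\<close>
  moreover have near: "\<forall>\<^sub>F p in nhds 0. (regular_point S p \<longleftrightarrow> h p = 0) \<and> (h p = 0 \<longrightarrow>
      tangent_line S p = {v. partial_x h p * (fst v - c * snd v) + De c h p * snd v = 0} \<and> (partial_x h p, De c h p) \<noteq> (0, 0))"
  proof -
    have grad: "\<forall>\<^sub>F p in nhds 0. (partial_x h p, partial_y h p) \<noteq> 0"
    proof (cases "partial_x h 0 = 0")
      case False
      from holo2_eventually_ne[OF holo2_partial_x[OF h0(1)] this] show ?thesis by eventually_elim (simp add: zero_prod_def)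
    next
      case True
      then have "partial_y h 0 \<noteq> 0" using h0(3) by (simp add: zero_prod_def)
      from holo2_eventually_ne[OF holo2_partial_y[OF h0(1)] this] show ?thesis by eventually_elim (simp add: zero_prod_def)
    qed
    show ?thesis
      using grad holo2_eventually[OF h0(1)] eventually_eventually[THEN iffD2, OF hS] hS
    proof eventually_elim
      case (elim p)
      have "h p = 0" if reg: "regular_point S p"
      proof -
        obtain h' where h': "holo2_at h' p" "h' p = 0" "(partial_x h' p, partial_y h' p) \<noteq> 0"
            "\<forall>\<^sub>F q in nhds p. q \<in> S \<longleftrightarrow> h' q = 0"
          using reg unfolding regular_point_def smooth_equation_def by (elim exE conjE)
        from eventually_nhds_x_imp_x[OF h'(4)] h'(2) elim(4) show ?thesis by simp
      qed
      moreover have sm: "smooth_equation S p h" if "h p = 0"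
        unfolding smooth_equation_def by (intro conjI elim(1,2,3) that)
      moreover have "tangent_line S p = {v. partial_x h p * (fst v - c * snd v) + De c h p * snd v = 0}" if "h p = 0"
        unfolding tangent_line_eq[OF sm[OF that]] by (simp add: De_def algebra_simps)
      moreover have "(partial_x h p, De c h p) \<noteq> (0, 0)" using elim(1) by (auto simp: De_def zero_prod_def)
      moreover have "regular_point S p" if "h p = 0" unfolding regular_point_def by (rule exI[of _ h]) (rule sm[OF that])
      ultimately show ?case by (intro conjI iffI impI)
    qed
  qed
  have evu: "\<forall>\<^sub>F p in nhds 0. \<forall>i\<in>{..<k}. q i p \<noteq> u p"
    using q qu u by (intro eventually_ball_finite ballI holo2_distinct_near) auto
  \<comment> \<open>On the curve E = 0, so both leaves of \<omega>2 have the slope u there.\<close>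
  have tangents2: "\<forall>\<^sub>F p in nhds 0. h p = 0 \<longrightarrow> (\<forall>v. form_eval 2 (\<omega>2 p) v = 0 \<longleftrightarrow> - u p * (fst v - c * snd v) + 1 * snd v = 0)"
    using \<omega>2 ES hS holo2_eventually_ne[OF L2]
  proof eventually_elim
    case (elim p)
    show ?case
    proof (intro impI allI)
      fix v assume "h p = 0"
      then have "E p = 0" using elim by simp
      then have w: "\<omega>2 p = Polynomial.smult (L2 p) (\<Prod>i<(2::nat). slope_form c (u p))"
        using elim(1) by (simp add: prod_constant)
      have "form_eval 2 (\<omega>2 p) v = L2 p * (\<Prod>i<(2::nat). snd v - u p * (fst v - c * snd v))"
        unfolding w by (rule form_eval_slope_form_prod)
      then show "form_eval 2 (\<omega>2 p) v = 0 \<longleftrightarrow> - u p * (fst v - c * snd v) + 1 * snd v = 0"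
        using elim(4) by simp
    qed
  qed
  \<comment> \<open>On the curve both webs in question have a single tangent line, the kernel of a
    form with components C and D in the frame; one determinant then decides the invariance.\<close>
  have inv: "invariant_by S T \<longleftrightarrow> (\<forall>\<^sub>F p in nhds 0. h p = 0 \<longrightarrow> F p = 0)"
    if T: "\<forall>\<^sub>F p in nhds 0. h p = 0 \<longrightarrow> T p = {v. C p * (fst v - c * snd v) + D p * snd v = 0}"
      and F: "\<forall>\<^sub>F p in nhds 0. h p = 0 \<longrightarrow> (C p * De c h p - D p * partial_x h p = 0 \<longleftrightarrow> F p = 0)"
    for T and C D F :: "point \<Rightarrow> complex"
  proof -
    have "\<forall>\<^sub>F p in nhds 0. (regular_point S p \<longrightarrow> tangent_line S p \<subseteq> T p) \<longleftrightarrow> (h p = 0 \<longrightarrow> F p = 0)"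
      using near T F
    proof eventually_elim
      case (elim p)
      show ?case
      proof (cases "h p = 0")
        case True
        then show ?thesis using elim tangent_kernel_subset_iff[of "partial_x h p" "De c h p" c "C p" "D p"] by simp
      qed (use elim in simp)
    qed
    then show ?thesis unfolding invariant_by_def by (rule eventually_subst)
  qed
  have "invariant_by S (web_tangents 2 \<omega>2) \<longleftrightarrow> (\<forall>\<^sub>F p in nhds 0. h p = 0 \<longrightarrow> g p = 0)"
  proof (rule inv)
    show "\<forall>\<^sub>F p in nhds 0. h p = 0 \<longrightarrow> web_tangents 2 \<omega>2 p = {v. - u p * (fst v - c * snd v) + 1 * snd v = 0}"
      using tangents2 unfolding web_tangents_def by eventually_elim blast
    show "\<forall>\<^sub>F p in nhds 0. h p = 0 \<longrightarrow> (- u p * De c h p - 1 * partial_x h p = 0 \<longleftrightarrow> g p = 0)"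
    proof (intro always_eventually allI impI)
      fix p
      have "- u p * De c h p - 1 * partial_x h p = - g p" by (simp add: g_def)
      then show "- u p * De c h p - 1 * partial_x h p = 0 \<longleftrightarrow> g p = 0" by simp
    qed
  qed
  moreover have "invariant_by S (barycenter_tangents 2 \<omega>2 k \<omega>k) \<longleftrightarrow> (\<forall>\<^sub>F p in nhds 0. h p = 0 \<longrightarrow> \<phi> p = 0)"
  proof (rule inv)
    \<comment> \<open>The components in the frame of the sum of normalized factors from
      \<open>barycenter_line_factored\<close>, taken at a vector of slope u and up to the scale of
      that vector.\<close>
    let ?la = "\<lambda>p. \<Sum>i<k. - q i p / (u p - q i p)" and ?mu = "\<lambda>p. \<Sum>i<k. 1 / (u p - q i p)"
    show "\<forall>\<^sub>F p in nhds 0. h p = 0 \<longrightarrow> barycenter_tangents 2 \<omega>2 k \<omega>k p = {v. ?la p * (fst v - c * snd v) + ?mu p * snd v = 0}"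
      using tangents2 \<omega>k evu holo2_eventually_ne[OF Lk]
    proof eventually_elim
      case (elim p)
      show ?case
      proof
        assume hp: "h p = 0"
        define V where "V = {v. ?la p * (fst v - c * snd v) + ?mu p * snd v = 0}"
        have t2: "form_eval 2 (\<omega>2 p) z = 0 \<longleftrightarrow> snd z = u p * (fst z - c * snd z)" for z
        proof -
          have e: "- u p * (fst z - c * snd z) + 1 * snd z = snd z - u p * (fst z - c * snd z)" by simp
          show ?thesis unfolding elim(1)[rule_format, OF hp, of z] e by simp
        qed
        have fk: "form_eval k (\<omega>k p) v = Lk p * (\<Prod>i<k. (- q i p) * fst v + (1 + c * q i p) * snd v)" for v
          unfolding elim(2) form_eval_slope_form_prod by (simp add: algebra_simps)
        have bl: "barycenter_line k (\<omega>k p) z = V" if z: "z \<noteq> 0" "snd z = u p * (fst z - c * snd z)" for z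
        proof -
          define x where "x = fst z - c * snd z"
          have x0: "x \<noteq> 0" using z by (auto simp: x_def prod_eq_iff)
          have lz: "(- q i p) * fst z + (1 + c * q i p) * snd z = x * (u p - q i p)" for i
          proof -
            have "(- q i p) * fst z + (1 + c * q i p) * snd z = snd z - q i p * x" by (simp add: x_def algebra_simps)
            also have "\<dots> = x * (u p - q i p)" unfolding z(2)[folded x_def] by (simp add: algebra_simps)
            finally show ?thesis .
          qed
          have lv: "(- q i p) * fst v + (1 + c * q i p) * snd v = - q i p * (fst v - c * snd v) + 1 * snd v" for i v
            by (simp add: algebra_simps)
          have "barycenter_line k (\<omega>k p) z =
            {v. (\<Sum>i<k. ((- q i p) * fst v + (1 + c * q i p) * snd v) / ((- q i p) * fst z + (1 + c * q i p) * snd z)) = 0}"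
            by (rule barycenter_line_factored[OF fk elim(4) assms(1)]) (unfold lz, use elim(3) x0 in auto)
          also have "\<dots> = V"
          proof -
            \<comment> \<open>The case w = 0 does no harm: both sides are then 0 by the convention
              for division.\<close>
            have e: "(- a / w * y + 1 / w * s) / x = (- a * y + 1 * s) / (x * w)" for a w y s :: complex
              by (cases "w = 0") (simp_all add: field_simps x0)
            have sumeq: "(\<Sum>i<k. (- q i p * y + 1 * s) / (x * (u p - q i p))) = (?la p * y + ?mu p * s) / x" for y s
              unfolding e[symmetric] by (simp only: sum_distrib_right sum.distrib sum_divide_distrib add_divide_distrib)
            show ?thesis unfolding lz unfolding lv unfolding sumeq V_def using x0 by simp
          qed
          finally show ?thesis .
        qed
        \<comment> \<open>A nonzero vector of slope u: the union over the tangent vectors of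
          \<omega>2 is nonempty, and each of its members is V.\<close>
        have "(1 + c * u p, u p) \<noteq> 0" by (auto simp: zero_prod_def)
        moreover have "snd (1 + c * u p, u p) = u p * (fst (1 + c * u p, u p) - c * snd (1 + c * u p, u p))" by simp
        ultimately show "barycenter_tangents 2 \<omega>2 k \<omega>k p = V"
          unfolding barycenter_tangents_def t2 using bl by blast
      qed
    qed
    show "\<forall>\<^sub>F p in nhds 0. h p = 0 \<longrightarrow> (?la p * De c h p - ?mu p * partial_x h p = 0 \<longleftrightarrow> \<phi> p = 0)"
    \<comment> \<open>This holds at every p: where q i p = u p, the corresponding terms on both
      sides are 0 by the convention for division.\<close>
    proof (intro always_eventually allI impI)
      fix p
      have "?la p * De c h p - ?mu p * partial_x h p = (\<Sum>i<k. - q i p / (u p - q i p) * De c h p - 1 / (u p - q i p) * partial_x h p)"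
        by (simp add: sum_distrib_right sum_subtractf)
      also have "\<dots> = \<phi> p"
        unfolding \<phi>_def
      proof (rule sum.cong[OF refl])
        fix i
        have "- q i p / (u p - q i p) * De c h p - 1 / (u p - q i p) * partial_x h p = - (partial_x h p + q i p * De c h p) / - (q i p - u p)"
          by (simp add: add_divide_distrib diff_divide_distrib)
        then show "- q i p / (u p - q i p) * De c h p - 1 / (u p - q i p) * partial_x h p = (partial_x h p + q i p * De c h p) / (q i p - u p)"
          by (simp only: minus_divide_divide)
      qed
      finally show "?la p * De c h p - ?mu p * partial_x h p = 0 \<longleftrightarrow> \<phi> p = 0" by simp
    qed
  qed
  ultimately show ?thesis unfolding S_def by simp
qed

end
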